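(* Let $n>2$ be an integer, $2^*=2n/(n-2)$ and $d\mu(r)=r^{n-1}dr$ on $\mathbb{R}^+=(0,\infty)$. There exists a positive constant $C$ depending only on $n$ such that, for every $f$ with $f, Lf\in L^2(\mathbb{R}^n)$, where $L=\mathbf{x}\cdot\nabla$, $$\|rF(r)\|^2_{L^{2^*}(\mathbb{R}^+;d\mu)}\le C\left\{\|Lf\|^2_{L^2(\mathbb{R}^n)}-\frac{n^2}{4}\|f\|^2_{L^2(\mathbb{R}^n)}\right\}^{1/n}\|f\|_{L^2(\mathbb{R}^n)}^{2(1-1/n)},$$ where $F(r)=\frac{1}{|\mathbb{S}^{n-1}|}\int_{\mathbb{S}^{n-1}}f(r\omega)\,d\omega$.
   Context: $(\mathbf{x}\cdot\nabla)f=\sum_{j=1}^n x_j\,\partial f/\partial x_j$ in the sense of distributions. $F$ is the integral mean of $f$ over the unit sphere $\mathbb{S}^{n-1}$ (with surface measure $d\omega$), and $\|rF(r)\|_{L^{2^*}(\mathbb{R}^+;d\mu)}=\big(\int_0^\infty|rF(r)|^{2^*}r^{n-1}dr\big)^{1/2^*}$. *)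

theory Defs
  imports "HOL-Analysis.Analysis"
begin

section \<open>Lebesgue spaces\<close>

definition mem_Lp :: "real \<Rightarrow> 'a measure \<Rightarrow> ('a \<Rightarrow> complex) \<Rightarrow> bool" where
  "mem_Lp p M f \<longleftrightarrow> f \<in> borel_measurable M \<and> integrable M (\<lambda>x. norm (f x) powr p)"

definition Lp_norm :: "real \<Rightarrow> 'a measure \<Rightarrow> ('a \<Rightarrow> complex) \<Rightarrow> real" where
  "Lp_norm p M f = (\<integral>x. norm (f x) powr p \<partial>M) powr (1 / p)"

text \<open>The measure \<open>r\<^sup>n\<^sup>-\<^sup>1 dr\<close> on the open half-line.\<close>

definition radial_measure :: "nat \<Rightarrow> real measure" where
  "radial_measure n = density (lebesgue_on {0<..}) (\<lambda>r. ennreal (r ^ (n - 1)))"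


section \<open>Spherical means\<close>

text \<open>
  Surface measure on the unit sphere, obtained as the cone measure: a Borel set \<open>A\<close> of the sphere
  has measure \<open>n\<close> times the volume of \<open>{t \<omega> | 0 < t \<le> 1, \<omega> \<in> A}\<close>. This is the normalisation
  with total mass \<open>|S\<^sup>n\<^sup>-\<^sup>1|\<close> for which \<open>dx = r\<^sup>n\<^sup>-\<^sup>1 dr d\<omega>\<close>. It is completed so that, for a merely
  Lebesgue measurable \<open>f\<close>, the function \<open>\<omega> \<mapsto> f (r \<omega>)\<close> is measurable for almost every \<open>r\<close>.
\<close>

definition sphere_measure :: "(real ^ 'n) measure" where
  "sphere_measure = completion (scale_measure (of_nat CARD('n))
     (distr (restrict_space lborel (cball 0 1 - {0})) (restrict_space borel (sphere 0 1)) sgn))"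

definition spherical_mean :: "(real ^ 'n \<Rightarrow> complex) \<Rightarrow> real \<Rightarrow> complex" where
  "spherical_mean f r =
     (\<integral>\<omega>. f (r *\<^sub>R \<omega>) \<partial>sphere_measure) /\<^sub>R measure (sphere_measure :: (real ^ 'n) measure) (sphere 0 1)"


section \<open>Test functions and distributions\<close>

definition partial_deriv :: "'n::finite \<Rightarrow> (real ^ 'n \<Rightarrow> complex) \<Rightarrow> real ^ 'n \<Rightarrow> complex" where
  "partial_deriv j \<phi> x = frechet_derivative \<phi> (at x) (axis j 1)"

text \<open>In the successor case differentiability, together with continuity of all partial derivatives
  (from the recursive call), amounts to continuous differentiability.\<close>

primrec C_k :: "nat \<Rightarrow> (real ^ 'n \<Rightarrow> complex) \<Rightarrow> bool" where
  "C_k 0 \<phi> \<longleftrightarrow> continuous_on UNIV \<phi>"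
| "C_k (Suc k) \<phi> \<longleftrightarrow> (\<forall>x. \<phi> differentiable (at x)) \<and> (\<forall>j. C_k k (partial_deriv j \<phi>))"

definition test_function :: "(real ^ 'n \<Rightarrow> complex) \<Rightarrow> bool" where
  "test_function \<phi> \<longleftrightarrow> (\<forall>k. C_k k \<phi>) \<and> compact (closure {x. \<phi> x \<noteq> 0})"

text \<open>Distributions are represented as functionals that are only ever evaluated at test functions.\<close>

type_synonym 'n distribution = "(real ^ 'n \<Rightarrow> complex) \<Rightarrow> complex"

definition regular_distribution :: "(real ^ 'n::finite \<Rightarrow> complex) \<Rightarrow> 'n distribution" where
  "regular_distribution f \<phi> = (\<integral>x. f x * \<phi> x \<partial>lebesgue)"

definition distr_partial :: "'n::finite \<Rightarrow> 'n distribution \<Rightarrow> 'n distribution" where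
  "distr_partial j T \<phi> = - T (partial_deriv j \<phi>)"

definition distr_mult :: "(real ^ 'n::finite \<Rightarrow> complex) \<Rightarrow> 'n distribution \<Rightarrow> 'n distribution" where
  "distr_mult a T \<phi> = T (\<lambda>x. a x * \<phi> x)"

definition distr_euler :: "('n::finite) distribution \<Rightarrow> 'n distribution" where
  "distr_euler T \<phi> = (\<Sum>j\<in>UNIV. distr_mult (\<lambda>x. complex_of_real (x $ j)) (distr_partial j T) \<phi>)"

text \<open>\<open>g\<close> represents \<open>(x \<cdot> \<nabla>) f\<close> in the sense of distributions; for locally integrable \<open>f\<close> and \<open>g\<close>
  this determines \<open>g\<close> up to null sets.\<close>

definition is_euler_derivative :: "(real ^ 'n \<Rightarrow> complex) \<Rightarrow> (real ^ 'n \<Rightarrow> complex) \<Rightarrow> bool" where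
  "is_euler_derivative f g \<longleftrightarrow>
     (\<forall>\<phi>. test_function \<phi> \<longrightarrow> distr_euler (regular_distribution f) \<phi> = regular_distribution g \<phi>)"

end

theory Submission
  imports Defs "HOL-Real_Asymp.Real_Asymp" "HOL-Computational_Algebra.Polynomial"
begin

text \<open>
  Dilations make the problem one-dimensional. The operators \<open>V\<^sub>s f(x) = s\<^sup>n\<^sup>/\<^sup>2 f(s x)\<close>, \<open>s > 0\<close>,
  form a unitary group on \<open>L\<^sup>2\<close> with generator \<open>L + n/2\<close>. Put \<open>h = Lf + (n/2) f\<close>. Pairing \<open>f\<close> with
  dilated test functions turns the distributional equation into

  \<open>V\<^sub>\<lambda> f - f = \<integral> V\<^sub>s h ds/s\<close> over \<open>1 \<le> s \<le> \<lambda>\<close>, almost everywhere (\<open>dilation_difference_AE\<close>),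

  and everything follows from this identity.

  Energy. Since \<open>V\<^sub>\<lambda>\<close> preserves the norm and \<open>V\<^sub>\<lambda> f - f\<close> has norm at most \<open>ln \<lambda> \<parallel>h\<parallel>\<close>, expanding
  \<open>\<parallel>V\<^sub>\<lambda> f\<parallel>\<^sup>2\<close> to first order in \<open>ln \<lambda>\<close> gives \<open>Re \<langle>h, f\<rangle> = 0\<close>. Hence
  \<open>\<parallel>Lf\<parallel>\<^sup>2 - (n\<^sup>2/4) \<parallel>f\<parallel>\<^sup>2 = \<parallel>h\<parallel>\<^sup>2\<close> (\<open>sqnorm_euler\<close>): the bracket in the theorem is the squared norm of \<open>h\<close>.

  Spherical means. Let \<open>u(r) = r\<^sup>n\<^sup>/\<^sup>2 F(r)\<close>. Averaging the identity over spheres and applying the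
  Cauchy--Schwarz inequality in \<open>s\<close> and in \<open>\<omega>\<close>, one obtains \<open>|u(\<lambda>r) - u(r)|\<^sup>2 \<le> K ln \<lambda>\<close> for
  almost every \<open>r\<close> (\<open>log_profile_holder\<close>), with \<open>K = \<parallel>h\<parallel>\<^sup>2 / |S\<^sup>n\<^sup>-\<^sup>1|\<close>. In the variable \<open>ln r\<close> this is the
  Hoelder continuity of exponent \<open>1/2\<close> of an \<open>H\<^sup>1\<close> function. Also
  \<open>\<integral> |u|\<^sup>2 dr/r \<le> A = \<parallel>f\<parallel>\<^sup>2 / |S\<^sup>n\<^sup>-\<^sup>1|\<close> (\<open>log_profile_energy\<close>).

  One dimension. Averaging the Hoelder bound over a dilation interval of logarithmic length \<open>d\<close> and
  choosing \<open>d\<close> to balance the two terms yields \<open>|u|\<^sup>2 \<le> 4 sqrt(A K)\<close> almost everywhere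
  (\<open>AE_bound_of_dilation_holder\<close>). For \<open>p = 2\<^sup>*\<close> the weights match exactly:
  \<open>|r F|\<^sup>p r\<^sup>n\<^sup>-\<^sup>1 = |u|\<^sup>p / r\<close>. Interpolating, \<open>\<integral> |u|\<^sup>p dr/r \<le> (sup |u|\<^sup>2)\<^sup>(\<^sup>p\<^sup>-\<^sup>2\<^sup>)\<^sup>/\<^sup>2 A\<close>, and taking the power
  \<open>2/p = 1 - 2/n\<close> leaves \<open>(16 K)\<^sup>1\<^sup>/\<^sup>n A\<^sup>1\<^sup>-\<^sup>1\<^sup>/\<^sup>n\<close>.
\<close>

section \<open>Polar coordinates for the cone measure\<close>

lemma nn_integral_scaleR:
  fixes k :: "'a::euclidean_space \<Rightarrow> ennreal"
  assumes [measurable]: "k \<in> borel_measurable borel" and c: "c > 0"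
  shows "(\<integral>\<^sup>+x. k (c *\<^sub>R x) \<partial>lborel) = ennreal (1 / c ^ DIM('a)) * (\<integral>\<^sup>+x. k x \<partial>lborel)"
proof -
  have "(\<integral>\<^sup>+x. k x \<partial>lborel) = ennreal (c ^ DIM('a)) * (\<integral>\<^sup>+x. k (c *\<^sub>R x) \<partial>lborel)"
    using c by (subst lborel_affine[of c 0])
      (auto simp: nn_integral_density nn_integral_distr nn_integral_cmult)
  then show ?thesis
    using c by (simp add: mult.assoc[symmetric] ennreal_mult[symmetric])
qed

lemma lborel_integral_scaleR:
  fixes k :: "'a::euclidean_space \<Rightarrow> 'b::{banach, second_countable_topology}"
  assumes [measurable]: "k \<in> borel_measurable borel" and c: "c > 0"
  shows "integrable lborel (\<lambda>x. k (c *\<^sub>R x)) \<longleftrightarrow> integrable lborel k"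
    and "(\<integral>x. k (c *\<^sub>R x) \<partial>lborel) = (1 / c ^ DIM('a)) *\<^sub>R (\<integral>x. k x \<partial>lborel)"
proof -
  have e: "distr lborel borel (\<lambda>x::'a. c *\<^sub>R x) = density lborel (\<lambda>_. ennreal (1 / c ^ DIM('a)))"
    (is "?D = ?E")
  proof (rule measure_eqI)
    fix A assume "A \<in> sets ?D"
    then have [measurable]: "A \<in> sets borel" by simp
    have "emeasure ?D A = (\<integral>\<^sup>+x. indicator A x \<partial>?D)"
      by simp
    also have "\<dots> = (\<integral>\<^sup>+x. indicator A (c *\<^sub>R x) \<partial>lborel)"
      by (rule nn_integral_distr) auto
    also have "\<dots> = emeasure ?E A"
      by (subst nn_integral_scaleR) (auto simp: c emeasure_density nn_integral_cmult)
    finally show "emeasure ?D A = emeasure ?E A" .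
  qed auto
  have "integrable lborel (\<lambda>x. k (c *\<^sub>R x)) \<longleftrightarrow> integrable ?D k"
    by (subst integrable_distr_eq) auto
  also have "\<dots> \<longleftrightarrow> integrable lborel (\<lambda>x. (1 / c ^ DIM('a)) *\<^sub>R k x)"
    unfolding e using c by (subst integrable_density) auto
  also have "\<dots> \<longleftrightarrow> integrable lborel k"
    using c integrable_scaleR_right[of "c ^ DIM('a)" lborel "\<lambda>x. (1 / c ^ DIM('a)) *\<^sub>R k x"]
    by auto
  finally show "integrable lborel (\<lambda>x. k (c *\<^sub>R x)) \<longleftrightarrow> integrable lborel k" .
  have "(\<integral>x. k (c *\<^sub>R x) \<partial>lborel) = (\<integral>x. k x \<partial>?D)"
    by (subst integral_distr) auto
  also have "\<dots> = (1 / c ^ DIM('a)) *\<^sub>R (\<integral>x. k x \<partial>lborel)"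
    unfolding e using c by (subst integral_density) auto
  finally show "(\<integral>x. k (c *\<^sub>R x) \<partial>lborel) = (1 / c ^ DIM('a)) *\<^sub>R (\<integral>x. k x \<partial>lborel)" .
qed

text \<open>The uncompleted surface measure. Tonelli and Borel measurability are available for it, so all
  work is done with Borel representatives on \<open>cone_measure\<close>.\<close>
definition cone_measure :: "(real ^ 'n) measure" where
  "cone_measure = scale_measure (of_nat CARD('n))
     (distr (restrict_space lborel (cball 0 1 - {0})) (restrict_space borel (sphere 0 1)) sgn)"

lemma sphere_measure_eq: "sphere_measure = completion cone_measure"
  unfolding sphere_measure_def cone_measure_def ..

lemma sets_cone_measure [measurable_cong, simp]:
  "sets cone_measure = sets (restrict_space borel (sphere 0 1))"
  by (simp add: cone_measure_def)

lemma space_cone_measure: "space cone_measure = sphere 0 1"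
  by (simp add: cone_measure_def space_scale_measure space_restrict_space)

lemma measurable_cone_ident: "(\<lambda>\<omega>. \<omega>) \<in> cone_measure \<rightarrow>\<^sub>M borel"
  by (subst measurable_cong_sets[OF sets_cone_measure refl]) (rule measurable_restrict_space1, simp)

lemma nn_integral_cone:
  fixes k :: "real ^ 'n \<Rightarrow> ennreal"
  assumes [measurable]: "k \<in> borel_measurable borel"
  shows "(\<integral>\<^sup>+\<omega>. k \<omega> \<partial>cone_measure)
    = of_nat CARD('n) * (\<integral>\<^sup>+y. k (sgn y) * indicator (cball 0 1 - {0}) y \<partial>lborel)"
proof -
  have m: "sgn \<in> restrict_space lborel (cball 0 1 - {0}) \<rightarrow>\<^sub>M restrict_space borel (sphere (0::real^'n) 1)"
  proof (rule measurable_restrict_space2)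
    show "sgn \<in> restrict_space lborel (cball 0 1 - {0}) \<rightarrow>\<^sub>M (borel :: (real^'n) measure)"
      by (rule measurable_restrict_space1) simp
  qed (auto simp: space_restrict_space norm_sgn)
  have k: "k \<in> borel_measurable (restrict_space borel (sphere (0::real^'n) 1))"
    by (intro measurable_restrict_space1) measurable
  let ?D = "distr (restrict_space lborel (cball 0 1 - {0})) (restrict_space borel (sphere (0::real^'n) 1)) sgn"
  have "(\<integral>\<^sup>+\<omega>. k \<omega> \<partial>cone_measure) = of_nat CARD('n) * (\<integral>\<^sup>+\<omega>. k \<omega> \<partial>?D)"
    unfolding cone_measure_def using k by (intro nn_integral_scale_measure) simp
  also have "(\<integral>\<^sup>+\<omega>. k \<omega> \<partial>?D) = (\<integral>\<^sup>+y. k (sgn y) \<partial>restrict_space lborel (cball 0 1 - {0}))"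
    using k by (intro nn_integral_distr[OF m]) simp
  also have "\<dots> = (\<integral>\<^sup>+y. k (sgn y) * indicator (cball 0 1 - {0}) y \<partial>lborel)"
    by (intro nn_integral_restrict_space) simp
  finally show ?thesis .
qed

lemma emeasure_cone_space:
  "emeasure (cone_measure :: (real ^ 'n) measure) (sphere 0 1)
    = ennreal (CARD('n) * measure lborel (cball (0::real^'n) 1))"
proof -
  have "emeasure (cone_measure :: (real ^ 'n) measure) (sphere 0 1)
      = (\<integral>\<^sup>+\<omega>. 1 \<partial>(cone_measure :: (real ^ 'n) measure))"
    by (simp add: space_cone_measure)
  also have "\<dots> = of_nat CARD('n) * emeasure lborel (cball (0::real^'n) 1 - {0})"
    by (subst nn_integral_cone) auto
  also have "emeasure lborel (cball (0::real^'n) 1 - {0}) = emeasure lborel (cball (0::real^'n) 1)"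
    by (rule emeasure_Diff_null_set) (auto simp: null_sets_def)
  also have "\<dots> = ennreal (measure lborel (cball (0::real^'n) 1))"
    by (rule emeasure_eq_ennreal_measure) (use emeasure_lborel_cball_finite[of "0::real^'n" 1] in simp)
  finally show ?thesis
    by (simp add: ennreal_mult ennreal_of_nat_eq_real_of_nat)
qed

lemma measure_cone_space:
  "measure (cone_measure :: (real ^ 'n) measure) (sphere 0 1)
    = CARD('n) * measure lborel (cball (0::real^'n) 1)"
  by (simp add: measure_def[of cone_measure] emeasure_cone_space)

lemma measure_cone_pos: "measure (cone_measure :: (real ^ 'n) measure) (sphere 0 1) > 0"
  unfolding measure_cone_space using content_cball_pos[of 1 "0::real^'n"] by simp

lemma finite_cone_measure: "finite_measure cone_measure"
  by (rule finite_measureI) (simp add: space_cone_measure emeasure_cone_space)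

lemma sigma_finite_cone_measure: "sigma_finite_measure cone_measure"
  using finite_cone_measure finite_measure_def by blast

lemma nn_integral_power_tail:
  assumes a: "(a::real) > 0" and N: "N > 0"
  shows "(\<integral>\<^sup>+s. ennreal (1 / s ^ (N + 1)) * indicator {a..} s \<partial>lborel) = ennreal (1 / (N * a ^ N))"
proof -
  have "(\<integral>\<^sup>+s. ennreal (1 / s ^ (N + 1)) * indicator {a..} s \<partial>lborel)
     = ennreal (0 - (- (1 / (N * a ^ N))))"
  proof (rule nn_integral_FTC_atLeast)
    show "((\<lambda>s::real. - (1 / (real N * s ^ N))) \<longlongrightarrow> 0) at_top"
      using N by real_asymp
    fix s assume "a \<le> s"
    with a have s: "s > 0" by simp
    show "0 \<le> 1 / s ^ (N + 1)" using s by simp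
    show "((\<lambda>s. - (1 / (real N * s ^ N))) has_real_derivative 1 / s ^ (N + 1)) (at s)"
      using s N
      by (auto intro!: derivative_eq_intros simp: field_simps power_add[symmetric] simp flip: power_Suc)
  qed simp
  then show ?thesis by simp
qed

text \<open>
  The cone measure is itself a volume integral over the unit ball, so polar coordinates come
  down to substitutions: with \<open>N\<close> the dimension, the right-hand side is
  \<open>N \<integral>\<integral> k(r sgn y) r\<^sup>N\<^sup>-\<^sup>1 dr dy\<close> over the ball. Substituting \<open>r = s |y|\<close>, then \<open>x = s y\<close>, and using
  Tonelli twice gives \<open>N \<integral> k(x) |x|\<^sup>N \<integral> s\<^sup>-\<^sup>N\<^sup>-\<^sup>1 ds dx\<close> over \<open>s \<ge> |x|\<close>, in which the inner integral equals
  \<open>1 / (N |x|\<^sup>N)\<close>.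
\<close>
theorem nn_integral_polar:
  fixes k :: "real ^ 'n \<Rightarrow> ennreal"
  assumes [measurable]: "k \<in> borel_measurable borel"
  shows "(\<integral>\<^sup>+x. k x \<partial>lborel)
    = (\<integral>\<^sup>+r. (\<integral>\<^sup>+\<omega>. k (r *\<^sub>R \<omega>) \<partial>cone_measure) * ennreal (r ^ (CARD('n) - 1)) * indicator {0<..} r \<partial>lborel)"
proof -
  define N where "N = CARD('n)"
  have N: "N > 0" by (simp add: N_def)
  let ?B = "cball (0::real^'n) 1 - {0}"
  have [measurable]: "(indicator ?B :: _ \<Rightarrow> ennreal) \<in> borel_measurable borel"
    by (intro borel_measurable_indicator) auto
  have "(\<integral>\<^sup>+r. (\<integral>\<^sup>+\<omega>. k (r *\<^sub>R \<omega>) \<partial>cone_measure) * ennreal (r ^ (N - 1)) * indicator {0<..} r \<partial>lborel)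
    = (\<integral>\<^sup>+r. (\<integral>\<^sup>+y. of_nat N * (k (r *\<^sub>R sgn y) * indicator ?B y * ennreal (r ^ (N - 1)) * indicator {0<..} r) \<partial>lborel) \<partial>lborel)"
  proof (rule nn_integral_cong)
    fix r :: real
    have "(\<integral>\<^sup>+\<omega>. k (r *\<^sub>R \<omega>) \<partial>cone_measure) = (\<integral>\<^sup>+y. of_nat N * (k (r *\<^sub>R sgn y) * indicator ?B y) \<partial>lborel)"
      by (simp add: nn_integral_cone nn_integral_cmult N_def)
    then show "(\<integral>\<^sup>+\<omega>. k (r *\<^sub>R \<omega>) \<partial>cone_measure) * ennreal (r ^ (N - 1)) * indicator {0<..} r
      = (\<integral>\<^sup>+y. of_nat N * (k (r *\<^sub>R sgn y) * indicator ?B y * ennreal (r ^ (N - 1)) * indicator {0<..} r) \<partial>lborel)"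
      by (simp add: nn_integral_multc[symmetric] mult.assoc)
  qed
  also have "\<dots> = (\<integral>\<^sup>+y. (\<integral>\<^sup>+r. of_nat N * (k (r *\<^sub>R sgn y) * indicator ?B y * ennreal (r ^ (N - 1)) * indicator {0<..} r) \<partial>lborel) \<partial>lborel)"
    by (rule lborel_pair.Fubini') measurable
  also have "\<dots> = (\<integral>\<^sup>+y. (\<integral>\<^sup>+s. of_nat N * (k (s *\<^sub>R y) * indicator ?B y * ennreal (norm y ^ N * s ^ (N - 1)) * indicator {0<..} s) \<partial>lborel) \<partial>lborel)"
  proof (rule nn_integral_cong)
    fix y :: "real ^ 'n"
    show "(\<integral>\<^sup>+r. of_nat N * (k (r *\<^sub>R sgn y) * indicator ?B y * ennreal (r ^ (N - 1)) * indicator {0<..} r) \<partial>lborel)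
      = (\<integral>\<^sup>+s. of_nat N * (k (s *\<^sub>R y) * indicator ?B y * ennreal (norm y ^ N * s ^ (N - 1)) * indicator {0<..} s) \<partial>lborel)"
    proof (cases "y = 0")
      case False
      have *: "norm y * (norm y * s) ^ (N - 1) = norm y ^ N * s ^ (N - 1)" for s
        using N by (cases N) (auto simp: power_mult_distrib)
      have **: "ennreal (norm y) * (c * ennreal ((norm y * s) ^ (N - 1))) = c * ennreal (norm y ^ N * s ^ (N - 1))"
        if "s > 0" for s c
        unfolding *[symmetric] using that by (simp add: ennreal_mult ac_simps)
      show ?thesis
        apply (subst nn_integral_real_affine[where c="norm y" and t=0])
        using False apply (auto simp: nn_integral_cmult[symmetric] sgn_div_norm intro!: nn_integral_cong)
        subgoal for s
          using False **[of s "k (s *\<^sub>R y)"] by (cases "s > 0") (auto simp: indicator_def zero_less_mult_iff ac_simps)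
        done
    qed simp
  qed
  also have "\<dots> = (\<integral>\<^sup>+s. (\<integral>\<^sup>+y. of_nat N * (k (s *\<^sub>R y) * indicator ?B y * ennreal (norm y ^ N * s ^ (N - 1)) * indicator {0<..} s) \<partial>lborel) \<partial>lborel)"
    by (rule lborel_pair.Fubini') measurable
  also have "\<dots> = (\<integral>\<^sup>+s. (\<integral>\<^sup>+x. of_nat N * (k x * ennreal (norm x ^ N / s ^ (N + 1)) * (if 0 < norm x \<and> norm x \<le> s then 1 else 0)) \<partial>lborel) \<partial>lborel)"
  proof (rule nn_integral_cong)
    fix s :: real
    show "(\<integral>\<^sup>+y. of_nat N * (k (s *\<^sub>R y) * indicator ?B y * ennreal (norm y ^ N * s ^ (N - 1)) * indicator {0<..} s) \<partial>lborel)
       = (\<integral>\<^sup>+x. of_nat N * (k x * ennreal (norm x ^ N / s ^ (N + 1)) * (if 0 < norm x \<and> norm x \<le> s then 1 else 0)) \<partial>lborel)"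
    proof (cases "s > 0")
      case True
      let ?k = "\<lambda>x. of_nat N * (k x * ennreal (norm x ^ N * s ^ (N - 1) / s ^ N) * (if 0 < norm x \<and> norm x \<le> s then 1 else 0))"
      have km: "?k \<in> borel_measurable borel"
        by measurable
      have "(\<integral>\<^sup>+y. of_nat N * (k (s *\<^sub>R y) * indicator ?B y * ennreal (norm y ^ N * s ^ (N - 1)) * indicator {0<..} s) \<partial>lborel)
         = (\<integral>\<^sup>+y. ?k (s *\<^sub>R y) \<partial>lborel)"
        using True by (intro nn_integral_cong) (auto simp: indicator_def power_mult_distrib mult_le_cancel_left)
      also have "\<dots> = ennreal (1 / s ^ N) * (\<integral>\<^sup>+x. ?k x \<partial>lborel)"
        using True by (subst nn_integral_scaleR[OF km]) (auto simp: N_def)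
      also have "\<dots> = (\<integral>\<^sup>+x. ennreal (1 / s ^ N) * ?k x \<partial>lborel)"
        by (rule nn_integral_cmult[symmetric]) (use km in simp)
      also have "\<dots> = (\<integral>\<^sup>+x. of_nat N * (k x * ennreal (norm x ^ N / s ^ (N + 1)) * (if 0 < norm x \<and> norm x \<le> s then 1 else 0)) \<partial>lborel)"
      proof (rule nn_integral_cong)
        fix x :: "real ^ 'n"
        have "norm x ^ N / s ^ (N + 1) = (1 / s ^ N) * (norm x ^ N * s ^ (N - 1) / s ^ N)"
          using True N by (cases N) (auto simp: field_simps)
        then have "ennreal (norm x ^ N / s ^ (N + 1)) = ennreal (1 / s ^ N) * ennreal (norm x ^ N * s ^ (N - 1) / s ^ N)"
          using True by (subst ennreal_mult[symmetric]) auto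
        then show "ennreal (1 / s ^ N) * ?k x = of_nat N * (k x * ennreal (norm x ^ N / s ^ (N + 1)) * (if 0 < norm x \<and> norm x \<le> s then 1 else 0))"
          by (simp add: ac_simps)
      qed
      finally show ?thesis .
    next
      case False
      then have "\<not> (0 < norm x \<and> norm x \<le> s)" for x :: "real ^ 'n"
        by linarith
      then show ?thesis
        using False by (simp only: if_False) simp
    qed
  qed
  also have "\<dots> = (\<integral>\<^sup>+x. (\<integral>\<^sup>+s. of_nat N * (k x * ennreal (norm x ^ N / s ^ (N + 1)) * (if 0 < norm x \<and> norm x \<le> s then 1 else 0)) \<partial>lborel) \<partial>lborel)"
    by (rule lborel_pair.Fubini') measurable
  also have "\<dots> = (\<integral>\<^sup>+x. k x \<partial>lborel)"
  proof (rule nn_integral_cong_AE)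
    show "AE x in lborel. (\<integral>\<^sup>+s. of_nat N * (k x * ennreal (norm x ^ N / s ^ (N + 1)) * (if 0 < norm x \<and> norm x \<le> s then 1 else 0)) \<partial>lborel) = k x"
      using AE_lborel_singleton[of "0::real^'n"]
    proof eventually_elim
      case (elim x)
      have "(\<integral>\<^sup>+s. of_nat N * (k x * ennreal (norm x ^ N / s ^ (N + 1)) * (if 0 < norm x \<and> norm x \<le> s then 1 else 0)) \<partial>lborel)
        = (\<integral>\<^sup>+s. (of_nat N * k x * ennreal (norm x ^ N)) * (ennreal (1 / s ^ (N + 1)) * indicator {norm x..} s) \<partial>lborel)"
      proof (rule nn_integral_cong)
        fix s :: real
        have "ennreal (norm x ^ N / s ^ (N + 1)) = ennreal (norm x ^ N) * ennreal (1 / s ^ (N + 1))" if "norm x \<le> s"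
          using that by (subst ennreal_mult[symmetric]) (auto simp: order.trans[OF norm_ge_zero that])
        then show "of_nat N * (k x * ennreal (norm x ^ N / s ^ (N + 1)) * (if 0 < norm x \<and> norm x \<le> s then 1 else 0))
          = (of_nat N * k x * ennreal (norm x ^ N)) * (ennreal (1 / s ^ (N + 1)) * indicator {norm x..} s)"
          using elim by (auto simp: indicator_def ac_simps)
      qed
      also have "\<dots> = (of_nat N * k x * ennreal (norm x ^ N)) * ennreal (1 / (N * norm x ^ N))"
        using elim nn_integral_power_tail[of "norm x" N] N
        by (subst nn_integral_cmult) (auto simp del: power_Suc)
      also have "\<dots> = k x * ennreal (N * (norm x ^ N * (1 / (N * norm x ^ N))))"
        by (subst ennreal_mult, simp, simp, subst ennreal_mult)
          (auto simp: ennreal_of_nat_eq_real_of_nat ac_simps)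
      also have "N * (norm x ^ N * (1 / (N * norm x ^ N))) = 1" using elim N by simp
      finally show ?case by simp
    qed
  qed
  finally show ?thesis unfolding N_def ..
qed

section \<open>Explicit test functions and the fundamental lemma\<close>

text \<open>
  The classical flat function \<open>exp (-1/x)\<close>, together with polynomial factors in \<open>1/x\<close> so that the
  family is closed under differentiation.
\<close>
definition flat_fn :: "real poly \<Rightarrow> real \<Rightarrow> real" where
  "flat_fn P x = (if x > 0 then poly P (1 / x) * exp (- (1 / x)) else 0)"

lemma poly_times_exp_tendsto_0:
  fixes P :: "real poly"
  shows "((\<lambda>y. poly P y * exp (- y)) \<longlongrightarrow> 0) at_top"
proof -
  have "((\<lambda>y. \<Sum>i\<le>degree P. coeff P i * (y ^ i / exp y)) \<longlongrightarrow> 0) at_top"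
    by (intro tendsto_null_sum tendsto_mult_right_zero tendsto_power_div_exp_0)
  then show ?thesis
    by (simp add: poly_altdef sum_distrib_right exp_minus divide_inverse mult.assoc)
qed

lemma flat_fn_has_derivative:
  "(flat_fn P has_real_derivative flat_fn ([:0, 0, 1:] * (P - pderiv P)) x) (at x)"
proof -
  consider "x > 0" | "x < 0" | "x = 0" by linarith
  then show ?thesis
  proof cases
    case 1
    have "((\<lambda>x. poly P (1 / x) * exp (- (1 / x))) has_real_derivative
        flat_fn ([:0, 0, 1:] * (P - pderiv P)) x) (at x)"
      using 1 by (auto intro!: derivative_eq_intros DERIV_chain2[OF poly_DERIV]
          simp: flat_fn_def field_simps power2_eq_square)
    moreover have "eventually (\<lambda>y. poly P (1 / y) * exp (- (1 / y)) = flat_fn P y) (nhds x)"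
      using eventually_nhds_in_open[of "{0<..}" x] 1
      by (auto elim!: eventually_mono simp: flat_fn_def)
    ultimately show ?thesis
      by (subst (asm) DERIV_cong_ev) auto
  next
    case 2
    have "eventually (\<lambda>y. 0 = flat_fn P y) (nhds x)"
      using eventually_nhds_in_open[of "{..<0}" x] 2
      by (auto elim!: eventually_mono simp: flat_fn_def)
    then have "(flat_fn P has_real_derivative 0) (at x)"
      using DERIV_const[of 0 "at x"] DERIV_cong_ev[OF refl _ refl, of "\<lambda>_. 0" "flat_fn P" x 0] by simp
    then show ?thesis using 2 by (simp add: flat_fn_def)
  next
    case 3
    have "((\<lambda>h. flat_fn P h / h) \<longlongrightarrow> 0) (at 0)"
    proof (rule filterlim_split_at)
      have "((\<lambda>h. 0) \<longlongrightarrow> 0) (at_left (0::real))" by simp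
      then show "((\<lambda>h. flat_fn P h / h) \<longlongrightarrow> 0) (at_left 0)"
        by (rule Lim_transform_eventually)
          (auto simp: flat_fn_def eventually_at_left_field intro!: exI[of _ "-1"])
      have "((\<lambda>h. poly (pCons 0 P) (1 / h) * exp (- (1 / h))) \<longlongrightarrow> 0) (at_right 0)"
        using filterlim_compose[OF poly_times_exp_tendsto_0[of "pCons 0 P"] filterlim_inverse_at_top_right]
        by (simp only: inverse_eq_divide)
      then show "((\<lambda>h. flat_fn P h / h) \<longlongrightarrow> 0) (at_right 0)"
        by (rule Lim_transform_eventually)
          (auto simp: flat_fn_def eventually_at_right_field intro!: exI[of _ 1])
    qed
    then show ?thesis
      using 3 by (simp add: has_field_derivative_iff flat_fn_def)
  qed
qed

text \<open>
  An algebra of smooth functions that is closed under partial derivatives and under dilations.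
  Closure under partial derivatives makes all its members \<open>C\<^sup>k\<close> for every \<open>k\<close> by a single induction.
  It contains the coordinate functions because these occur as coefficients in \<open>x \<cdot> \<nabla>\<close>.
\<close>
inductive_set bump_algebra :: "(real ^ 'n \<Rightarrow> complex) set" where
  flat: "(\<lambda>x. complex_of_real (flat_fn P (a * x $ i + b))) \<in> bump_algebra"
| coord: "(\<lambda>x. complex_of_real (x $ i)) \<in> bump_algebra"
| const: "(\<lambda>x. c) \<in> bump_algebra"
| add: "\<phi> \<in> bump_algebra \<Longrightarrow> \<psi> \<in> bump_algebra \<Longrightarrow> (\<lambda>x. \<phi> x + \<psi> x) \<in> bump_algebra"
| mult: "\<phi> \<in> bump_algebra \<Longrightarrow> \<psi> \<in> bump_algebra \<Longrightarrow> (\<lambda>x. \<phi> x * \<psi> x) \<in> bump_algebra"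

lemma bump_algebra_prod:
  "finite I \<Longrightarrow> (\<And>i. i \<in> I \<Longrightarrow> \<phi> i \<in> bump_algebra) \<Longrightarrow> (\<lambda>x. \<Prod>i\<in>I. \<phi> i x) \<in> bump_algebra"
  by (induction rule: finite_induct) (auto intro: bump_algebra.intros)

lemma bump_algebra_scale:
  assumes "\<phi> \<in> bump_algebra"
  shows "(\<lambda>x. \<phi> (s *\<^sub>R x)) \<in> bump_algebra"
  using assms
proof induction
  case (flat P a i b)
  then show ?case using bump_algebra.flat[of P "a * s" i b] by (simp add: mult.assoc)
next
  case (coord i)
  then show ?case
    using bump_algebra.mult[OF bump_algebra.const[of "of_real s"] bump_algebra.coord[of i]] by simp
qed (auto intro: bump_algebra.intros)

lemma partial_deriv_eq:
  assumes "(\<phi> has_derivative D) (at x)"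
  shows "partial_deriv j \<phi> x = D (axis j 1)"
  using frechet_derivative_at[OF assms] by (simp add: partial_deriv_def)

lemma bump_algebra_derivative:
  fixes \<phi> :: "real ^ 'n \<Rightarrow> complex"
  assumes "\<phi> \<in> bump_algebra"
  shows "\<exists>D. (\<forall>x. (\<phi> has_derivative D x) (at x)) \<and> (\<forall>j. (\<lambda>x. D x (axis j 1)) \<in> bump_algebra)"
  using assms
proof induction
  case (flat P a i b)
  let ?Q = "[:0, 0, 1:] * (P - pderiv P)"
  let ?D = "\<lambda>x h. complex_of_real (flat_fn ?Q (a * x $ i + b) * (a * h $ i))"
  have "((\<lambda>x. complex_of_real (flat_fn P (a * x $ i + b))) has_derivative ?D x) (at x)" for x
  proof -
    have "((\<lambda>x::real^'n. a * x $ i + b) has_derivative (\<lambda>h. a * h $ i)) (at x)"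
      by (auto intro!: derivative_eq_intros bounded_linear.has_derivative[OF bounded_linear_vec_nth])
    from has_derivative_compose[OF this flat_fn_has_derivative[of P "a * x $ i + b", unfolded has_field_derivative_def]]
    show ?thesis
      by (intro bounded_linear.has_derivative[OF bounded_linear_of_real]) (simp add: ac_simps)
  qed
  moreover have "(\<lambda>x. ?D x (axis j 1)) \<in> bump_algebra" for j
    using bump_algebra.mult[OF bump_algebra.const[of "of_real (a * axis j 1 $ i)"] bump_algebra.flat[of ?Q a i b]]
    by (simp add: ac_simps)
  ultimately show ?case by (intro exI[of _ ?D]) blast
next
  case (coord i)
  have "((\<lambda>x::real^'n. complex_of_real (x $ i)) has_derivative (\<lambda>h. complex_of_real (h $ i))) (at x)" for x
    by (intro bounded_linear.has_derivative[OF bounded_linear_of_real]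
        bounded_linear.has_derivative[OF bounded_linear_vec_nth] has_derivative_ident)
  then show ?case
    by (intro exI[of _ "\<lambda>x h. complex_of_real (h $ i)"]) (auto intro: bump_algebra.const)
next
  case (const c)
  then show ?case by (intro exI[of _ "\<lambda>x h. 0"]) (auto intro: bump_algebra.const)
next
  case (add \<phi> \<psi>)
  then obtain D E where "\<forall>x. (\<phi> has_derivative D x) (at x)" "\<forall>j. (\<lambda>x. D x (axis j 1)) \<in> bump_algebra"
     "\<forall>x. (\<psi> has_derivative E x) (at x)" "\<forall>j. (\<lambda>x. E x (axis j 1)) \<in> bump_algebra"
    by blast
  then show ?case
    by (intro exI[of _ "\<lambda>x h. D x h + E x h"])
      (auto intro!: bump_algebra.add has_derivative_add)
next
  case (mult \<phi> \<psi>)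
  then obtain D E where "\<forall>x. (\<phi> has_derivative D x) (at x)" "\<forall>j. (\<lambda>x. D x (axis j 1)) \<in> bump_algebra"
     "\<forall>x. (\<psi> has_derivative E x) (at x)" "\<forall>j. (\<lambda>x. E x (axis j 1)) \<in> bump_algebra"
    by blast
  with mult show ?case
    by (intro exI[of _ "\<lambda>x h. \<phi> x * E x h + D x h * \<psi> x"])
      (auto intro!: bump_algebra.add bump_algebra.mult has_derivative_mult)
qed

lemma bump_algebra_differentiable: "\<phi> \<in> bump_algebra \<Longrightarrow> \<phi> differentiable (at x)"
  using bump_algebra_derivative differentiable_def by blast

lemma bump_algebra_partial_deriv: "\<phi> \<in> bump_algebra \<Longrightarrow> partial_deriv j \<phi> \<in> bump_algebra"
proof -
  assume "\<phi> \<in> bump_algebra"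
  then obtain D where D: "\<forall>x. (\<phi> has_derivative D x) (at x)" "(\<lambda>x. D x (axis j 1)) \<in> bump_algebra"
    using bump_algebra_derivative by blast
  then have "partial_deriv j \<phi> = (\<lambda>x. D x (axis j 1))"
    by (auto simp: partial_deriv_eq)
  with D show ?thesis by simp
qed

lemma bump_algebra_continuous: "\<phi> \<in> bump_algebra \<Longrightarrow> continuous_on UNIV \<phi>"
  by (auto simp: continuous_on_eq_continuous_at intro!: differentiable_imp_continuous_within bump_algebra_differentiable)

lemma bump_algebra_C_k: "\<phi> \<in> bump_algebra \<Longrightarrow> C_k k \<phi>"
  by (induction k arbitrary: \<phi>)
    (auto intro: bump_algebra_continuous bump_algebra_differentiable bump_algebra_partial_deriv)

text \<open>Smooth functions vanishing off the box from \<open>a\<close> to \<open>b\<close>, each coordinate being cut off by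
  \<open>exp (-1 / ((m+1) t))\<close> at distance \<open>t\<close> from a face; they tend to the indicator of the box as
  \<open>m \<rightarrow> \<infinity>\<close>.\<close>
definition box_bump :: "nat \<Rightarrow> real ^ 'n \<Rightarrow> real ^ 'n \<Rightarrow> real ^ 'n \<Rightarrow> complex" where
  "box_bump m a b x = (\<Prod>i\<in>UNIV. complex_of_real (flat_fn 1 (Suc m * (x $ i - a $ i)))
      * complex_of_real (flat_fn 1 (Suc m * (b $ i - x $ i))))"

lemma box_bump_in_bump_algebra: "box_bump m a b \<in> bump_algebra"
proof -
  have "(\<lambda>x. complex_of_real (flat_fn 1 (real (Suc m) * x $ i + (- real (Suc m) * a $ i)))
    * complex_of_real (flat_fn 1 (- real (Suc m) * x $ i + real (Suc m) * b $ i))) \<in> bump_algebra" for i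
    by (intro bump_algebra.intros)
  from bump_algebra_prod[OF finite this]
  have "(\<lambda>x. \<Prod>i\<in>UNIV. complex_of_real (flat_fn 1 (real (Suc m) * x $ i + (- real (Suc m) * a $ i)))
    * complex_of_real (flat_fn 1 (- real (Suc m) * x $ i + real (Suc m) * b $ i))) \<in> bump_algebra" .
  also have "(\<lambda>x. \<Prod>i\<in>UNIV. complex_of_real (flat_fn 1 (real (Suc m) * x $ i + (- real (Suc m) * a $ i)))
    * complex_of_real (flat_fn 1 (- real (Suc m) * x $ i + real (Suc m) * b $ i))) = box_bump m a b"
    by (rule ext) (simp add: box_bump_def algebra_simps)
  finally show ?thesis .
qed

lemma box_bump_outside: "x \<notin> box a b \<Longrightarrow> box_bump m a b x = 0"
  by (auto simp: box_bump_def mem_box_cart flat_fn_def mult_less_0_iff zero_less_mult_iff)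

lemma norm_box_bump_le: "norm (box_bump m a b x) \<le> indicator (box a b) x"
proof (cases "x \<in> box a b")
  case True
  have "\<bar>flat_fn 1 y\<bar> \<le> 1" for y by (simp add: flat_fn_def)
  then have "norm (box_bump m a b x) \<le> (\<Prod>i\<in>(UNIV::'a set). 1)"
    unfolding box_bump_def prod_norm[symmetric]
    by (intro prod_mono) (auto simp: norm_mult intro!: mult_le_one)
  with True show ?thesis by simp
qed (simp add: box_bump_outside)

lemma box_bump_tendsto: "(\<lambda>m. box_bump m a b x) \<longlonglongrightarrow> indicator (box a b) x"
proof (cases "x \<in> box a b")
  case True
  have *: "(\<lambda>m. flat_fn 1 (Suc m * c)) \<longlonglongrightarrow> 1" if "c > 0" for c :: real
  proof -
    have "(\<lambda>m. exp (- (1 / (real (Suc m) * c)))) \<longlonglongrightarrow> 1"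
      using that by real_asymp
    moreover have "real (Suc m) * c > 0" for m
      using that by simp
    ultimately show ?thesis by (simp only: flat_fn_def if_True poly_1 mult_1)
  qed
  have "(\<lambda>m. box_bump m a b x) \<longlonglongrightarrow> (\<Prod>i\<in>(UNIV::'a set). complex_of_real 1 * complex_of_real 1)"
    unfolding box_bump_def using True
    by (intro tendsto_prod tendsto_mult tendsto_of_real *) (auto simp: mem_box_cart)
  with True show ?thesis by simp
qed (simp add: box_bump_outside)

lemma compact_support_bounded:
  fixes \<phi> :: "real ^ 'n \<Rightarrow> complex"
  assumes "\<And>x. norm x > R \<Longrightarrow> \<phi> x = 0"
  shows "compact (closure {x. \<phi> x \<noteq> 0})"
  using assms by (auto simp: compact_closure not_less[symmetric] intro!: boundedI[of _ R])

text \<open>The fundamental lemma of the calculus of variations. By dominated convergence \<open>D\<close> has vanishing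
  integral over every box; inside a fixed box the sets with vanishing integral form a Dynkin system,
  so they include all Borel sets.\<close>
lemma AE_zero_of_box_bumps:
  fixes D :: "real ^ 'n \<Rightarrow> complex"
  assumes int: "\<And>a b. set_integrable lborel (box a b) D"
  assumes zero: "\<And>m a b. (\<integral>x. D x * box_bump m a b x \<partial>lborel) = 0"
  shows "AE x in lborel. D x = 0"
proof -
  have box0: "(\<integral>x. indicator (box a b) x *\<^sub>R D x \<partial>lborel) = 0" for a b
  proof -
    have "(\<lambda>m. \<integral>x. D x * box_bump m a b x \<partial>lborel) \<longlonglongrightarrow> (\<integral>x. indicator (box a b) x *\<^sub>R D x \<partial>lborel)"
    proof (rule integral_dominated_convergence)
      show "integrable lborel (\<lambda>x. norm (indicator (box a b) x *\<^sub>R D x))"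
        using int[of a b] unfolding set_integrable_def by (rule integrable_norm)
      have m: "(\<lambda>x. indicator (box a b) x *\<^sub>R D x) \<in> borel_measurable lborel"
        using int[of a b] by (auto simp: set_integrable_def)
      then show "(\<lambda>x. indicator (box a b) x *\<^sub>R D x) \<in> borel_measurable lborel" .
      have "(\<lambda>x. D x * box_bump i a b x) = (\<lambda>x. (indicator (box a b) x *\<^sub>R D x) * box_bump i a b x)" for i
        by (rule ext) (auto simp: indicator_def box_bump_outside)
      moreover have "box_bump i a b \<in> borel_measurable lborel" for i
        using borel_measurable_continuous_onI[OF bump_algebra_continuous[OF box_bump_in_bump_algebra]] by simp
      ultimately show "(\<lambda>x. D x * box_bump i a b x) \<in> borel_measurable lborel" for i
        using borel_measurable_times[OF m] by metis
      show "AE x in lborel. (\<lambda>i. D x * box_bump i a b x) \<longlonglongrightarrow> indicator (box a b) x *\<^sub>R D x"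
      proof (rule AE_I2)
        fix x :: "real ^ 'n"
        have "(\<lambda>i. D x * box_bump i a b x) \<longlonglongrightarrow> D x * indicator (box a b) x"
          by (intro tendsto_mult tendsto_const box_bump_tendsto)
        then show "(\<lambda>i. D x * box_bump i a b x) \<longlonglongrightarrow> indicator (box a b) x *\<^sub>R D x"
          by (auto simp: indicator_def)
      qed
      show "AE x in lborel. norm (D x * box_bump i a b x) \<le> norm (indicator (box a b) x *\<^sub>R D x)" for i
      proof (rule AE_I2)
        fix x :: "real ^ 'n"
        have "norm (D x) * norm (box_bump i a b x) \<le> norm (D x) * indicator (box a b) x"
          by (intro mult_left_mono norm_box_bump_le) auto
        then show "norm (D x * box_bump i a b x) \<le> norm (indicator (box a b) x *\<^sub>R D x)"
          by (simp add: norm_mult mult.commute)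
      qed
    qed
    then show ?thesis by (simp add: zero LIMSEQ_const_iff)
  qed
  have "AE x in lborel. x \<in> box (- (real k *\<^sub>R One)) (real k *\<^sub>R One) \<longrightarrow> D x = 0" for k
  proof -
    let ?B = "box (- (real k *\<^sub>R One)) (real k *\<^sub>R One) :: (real ^ 'n) set"
    let ?D = "\<lambda>x. indicator ?B x *\<^sub>R D x"
    have iD: "integrable lborel ?D"
      using int by (simp add: set_integrable_def)
    have "(\<integral>x. indicator A x *\<^sub>R ?D x \<partial>lborel) = 0" if "A \<in> sets borel" for A
    proof -
      have AA: "A \<in> sigma_sets UNIV (range (\<lambda>(a, b). box a b))"
        using that borel_eq_box[where 'a="real^'n"] by (metis UNIV_I sets_measure_of top_greatest Pow_UNIV subset_UNIV)
      have 1: "Int_stable (range (\<lambda>(a, b). box a b :: (real^'n) set))"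
        by (auto simp: Int_stable_def box_Int_box)
      have 2: "range (\<lambda>(a, b). box a b :: (real^'n) set) \<subseteq> Pow UNIV"
        by simp
      from 1 2 AA show ?thesis
      proof (induction A rule: sigma_sets_induct_disjoint)
        fix A :: "(real^'n) set" assume "A \<in> range (\<lambda>(a, b). box a b)"
        then obtain a b c d where "A \<inter> ?B = box c d" by (auto simp: box_Int_box)
        then have "(\<lambda>x. indicator A x *\<^sub>R ?D x) = (\<lambda>x. indicator (box c d) x *\<^sub>R D x)"
          by (metis (no_types) indicator_inter_arith scaleR_scaleR)
        then show "(\<integral>x. indicator A x *\<^sub>R ?D x \<partial>lborel) = 0" using box0 by simp
      next
        fix A :: "(real^'n) set" assume A: "A \<in> sigma_sets UNIV (range (\<lambda>(a, b). box a b))"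
          and 0: "(\<integral>x. indicator A x *\<^sub>R ?D x \<partial>lborel) = 0"
        have [measurable]: "A \<in> sets borel" using A by (simp add: borel_eq_box)
        have "(\<integral>x. indicator (UNIV - A) x *\<^sub>R ?D x \<partial>lborel) = (\<integral>x. ?D x - indicator A x *\<^sub>R ?D x \<partial>lborel)"
          by (intro Bochner_Integration.integral_cong) (auto simp: indicator_def)
        also have "\<dots> = (\<integral>x. ?D x \<partial>lborel) - (\<integral>x. indicator A x *\<^sub>R ?D x \<partial>lborel)"
          by (intro Bochner_Integration.integral_diff iD integrable_mult_indicator[OF _ iD]) simp
        also have "\<dots> = 0" using 0 box0 by simp
        finally show "(\<integral>x. indicator (UNIV - A) x *\<^sub>R ?D x \<partial>lborel) = 0" .
      next
        fix A :: "nat \<Rightarrow> (real^'n) set"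
        assume dis: "disjoint_family A" and A: "range A \<subseteq> sigma_sets UNIV (range (\<lambda>(a, b). box a b))"
          and 0: "\<And>i. (\<integral>x. indicator (A i) x *\<^sub>R ?D x \<partial>lborel) = 0"
        have A: "\<And>i. A i \<in> sets lborel" using A by (auto simp: borel_eq_box)
        have "(\<integral>x\<in>(\<Union>i. A i). ?D x \<partial>lborel) = (\<Sum>i. (\<integral>x\<in>(A i). ?D x \<partial>lborel))"
        proof (rule lebesgue_integral_countable_add[OF A])
          show "set_integrable lborel (\<Union> (range A)) ?D"
            unfolding set_integrable_def using A by (intro integrable_mult_indicator[OF _ iD]) auto
        qed (use dis in \<open>auto simp: disjoint_family_on_def\<close>)
        then show "(\<integral>x. indicator (\<Union> (range A)) x *\<^sub>R ?D x \<partial>lborel) = 0"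
          using 0 by (simp add: set_lebesgue_integral_def)
      qed (auto)
    qed
    then have "AE x in lborel. ?D x = 0"
      using iD by (intro sigma_finite_measure.density_zero[OF lborel.sigma_finite_measure_axioms]) (auto simp: set_lebesgue_integral_def)
    then show ?thesis by eventually_elim (auto simp: indicator_def)
  qed
  then have "AE x in lborel. \<forall>k. x \<in> box (- (real k *\<^sub>R One)) (real k *\<^sub>R One) \<longrightarrow> D x = 0"
    unfolding AE_all_countable by blast
  then show ?thesis
  proof eventually_elim
    case (elim x)
    have "x \<in> (\<Union>k. box (- (real k *\<^sub>R One)) (real k *\<^sub>R One))" by (simp add: UN_box_eq_UNIV)
    with elim show ?case by blast
  qed
qed

section \<open>Square-integrable functions and the dilation group\<close>
definition square_integrable :: "(real ^ 'n \<Rightarrow> complex) \<Rightarrow> bool" where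
  "square_integrable f \<longleftrightarrow> f \<in> borel_measurable borel \<and> integrable lborel (\<lambda>x. (norm (f x))\<^sup>2)"

definition sqnorm :: "(real ^ 'n \<Rightarrow> complex) \<Rightarrow> real" where
  "sqnorm f = (\<integral>x. (norm (f x))\<^sup>2 \<partial>lborel)"

definition dilation :: "real \<Rightarrow> (real ^ 'n \<Rightarrow> complex) \<Rightarrow> real ^ 'n \<Rightarrow> complex" where
  "dilation s f x = s powr (CARD('n) / 2) *\<^sub>R f (s *\<^sub>R x)"

lemma square_integrable_measurable: "square_integrable f \<Longrightarrow> f \<in> borel_measurable borel"
  by (simp add: square_integrable_def)

lemma sqnorm_nonneg: "sqnorm f \<ge> 0"
  by (simp add: sqnorm_def)

lemma nn_integral_sqnorm:
  assumes "square_integrable f"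
  shows "(\<integral>\<^sup>+x. (ennreal (norm (f x)))\<^sup>2 \<partial>lborel) = ennreal (sqnorm f)"
proof -
  have "(\<integral>\<^sup>+x. (ennreal (norm (f x)))\<^sup>2 \<partial>lborel) = (\<integral>\<^sup>+x. ennreal ((norm (f x))\<^sup>2) \<partial>lborel)"
    by (simp add: ennreal_power)
  also have "\<dots> = ennreal (sqnorm f)"
    using assms unfolding sqnorm_def square_integrable_def
    by (intro nn_integral_eq_integral) auto
  finally show ?thesis .
qed

lemma square_integrable_nn:
  assumes "f \<in> borel_measurable borel" "(\<integral>\<^sup>+x. (ennreal (norm (f x)))\<^sup>2 \<partial>lborel) < \<infinity>"
  shows "square_integrable f"
  using assms by (auto simp: square_integrable_def ennreal_power intro!: integrableI_bounded)

lemma mult_le_half_squares: "x * y \<le> (x\<^sup>2 + y\<^sup>2) / (2::real)"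
  using zero_le_power2[of "x - y"] by (simp add: power2_diff)

lemma square_integrable_mult:
  assumes "square_integrable f" "square_integrable g"
  shows "integrable lborel (\<lambda>x. f x * g x)"
    and "(\<integral>\<^sup>+x. ennreal (norm (f x * g x)) \<partial>lborel) \<le> ennreal ((sqnorm f + sqnorm g) / 2)"
proof -
  have [measurable]: "f \<in> borel_measurable borel" "g \<in> borel_measurable borel"
    using assms by (auto simp: square_integrable_def)
  have i: "integrable lborel (\<lambda>x. ((norm (f x))\<^sup>2 + (norm (g x))\<^sup>2) / 2)"
    using assms by (auto simp: square_integrable_def)
  have b: "norm (f x * g x) \<le> ((norm (f x))\<^sup>2 + (norm (g x))\<^sup>2) / 2" for x
    by (simp only: norm_mult mult_le_half_squares)
  show "integrable lborel (\<lambda>x. f x * g x)"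
  proof (rule Bochner_Integration.integrable_bound[OF i])
    show "AE x in lborel. norm (f x * g x) \<le> norm (((norm (f x))\<^sup>2 + (norm (g x))\<^sup>2) / 2)"
      using b by (intro AE_I2) (simp add: order.trans[OF b])
  qed measurable
  have "(\<integral>\<^sup>+x. ennreal (norm (f x * g x)) \<partial>lborel) \<le> (\<integral>\<^sup>+x. ennreal (((norm (f x))\<^sup>2 + (norm (g x))\<^sup>2) / 2) \<partial>lborel)"
    by (intro nn_integral_mono ennreal_leI b)
  also have "\<dots> = ennreal (\<integral>x. ((norm (f x))\<^sup>2 + (norm (g x))\<^sup>2) / 2 \<partial>lborel)"
    by (intro nn_integral_eq_integral i) auto
  also have "(\<integral>x. ((norm (f x))\<^sup>2 + (norm (g x))\<^sup>2) / 2 \<partial>lborel) = (sqnorm f + sqnorm g) / 2"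
    using assms by (simp add: sqnorm_def square_integrable_def)
  finally show "(\<integral>\<^sup>+x. ennreal (norm (f x * g x)) \<partial>lborel) \<le> ennreal ((sqnorm f + sqnorm g) / 2)" .
qed

lemma square_integrable_bounded_support:
  fixes f :: "real ^ 'n \<Rightarrow> complex"
  assumes [measurable]: "f \<in> borel_measurable borel"
    and b: "\<And>x. norm (f x) \<le> M" and z: "\<And>x. norm x > R \<Longrightarrow> f x = 0"
  shows "square_integrable f"
  unfolding square_integrable_def
proof (intro conjI)
  have i: "integrable lborel (\<lambda>x. indicator (cball (0::real^'n) R) x *\<^sub>R M\<^sup>2 :: real)"
    using emeasure_lborel_cball_finite[of "0::real^'n" R]
    by (intro integrable_scaleR_left integrable_real_indicator) auto
  show "integrable lborel (\<lambda>x. (norm (f x))\<^sup>2)"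
  proof (rule Bochner_Integration.integrable_bound[OF i])
    show "AE x in lborel. norm ((norm (f x))\<^sup>2) \<le> norm (indicator (cball 0 R) x *\<^sub>R M\<^sup>2 :: real)"
      using z b by (intro AE_I2) (auto simp: indicator_def intro!: power_mono)
  qed measurable
qed fact

lemma square_integrable_linear:
  assumes "square_integrable f" "square_integrable g"
  shows "square_integrable (\<lambda>x. f x + c * g x)"
  unfolding square_integrable_def
proof (intro conjI)
  have [measurable]: "f \<in> borel_measurable borel" "g \<in> borel_measurable borel"
    using assms by (auto simp: square_integrable_def)
  show "(\<lambda>x. f x + c * g x) \<in> borel_measurable borel" by measurable
  have i: "integrable lborel (\<lambda>x. 2 * (norm (f x))\<^sup>2 + 2 * (norm c)\<^sup>2 * (norm (g x))\<^sup>2)"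
    using assms by (auto simp: square_integrable_def)
  show "integrable lborel (\<lambda>x. (norm (f x + c * g x))\<^sup>2)"
  proof (rule Bochner_Integration.integrable_bound[OF i])
    show "AE x in lborel. norm ((norm (f x + c * g x))\<^sup>2) \<le> norm (2 * (norm (f x))\<^sup>2 + 2 * (norm c)\<^sup>2 * (norm (g x))\<^sup>2)"
    proof (rule AE_I2)
      fix x
      have "(norm (f x + c * g x))\<^sup>2 \<le> (norm (f x) + norm c * norm (g x))\<^sup>2"
        by (intro power_mono) (auto simp: norm_mult[symmetric] norm_triangle_ineq)
      also have "\<dots> \<le> 2 * (norm (f x))\<^sup>2 + 2 * (norm c)\<^sup>2 * (norm (g x))\<^sup>2"
        using mult_le_half_squares[of "norm (f x)" "norm c * norm (g x)"]
        by (simp add: power2_sum power_mult_distrib)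
      finally show "norm ((norm (f x + c * g x))\<^sup>2) \<le> norm (2 * (norm (f x))\<^sup>2 + 2 * (norm c)\<^sup>2 * (norm (g x))\<^sup>2)"
        by simp
    qed
  qed measurable
qed

lemma powr_half_square: "s > 0 \<Longrightarrow> (s powr (real N / 2))\<^sup>2 = s ^ N"
  by (simp add: power2_eq_square powr_add[symmetric] powr_realpow)

lemma dilation_measurable:
  assumes [measurable]: "f \<in> borel_measurable borel"
  shows "dilation s f \<in> borel_measurable borel"
  unfolding dilation_def[abs_def] by measurable

lemma square_integrable_dilation:
  fixes f :: "real ^ 'n \<Rightarrow> complex"
  assumes f: "square_integrable f" and s: "s > 0"
  shows "square_integrable (dilation s f)" "sqnorm (dilation s f) = sqnorm f"
proof -
  have fm [measurable]: "f \<in> borel_measurable borel" using f by (simp add: square_integrable_def)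
  have "(\<integral>\<^sup>+x. (ennreal (norm (dilation s f x)))\<^sup>2 \<partial>lborel)
    = (\<integral>\<^sup>+x. ennreal (s ^ CARD('n)) * (ennreal (norm (f (s *\<^sub>R x))))\<^sup>2 \<partial>lborel)"
  proof (rule nn_integral_cong)
    fix x :: "real ^ 'n"
    have "(norm (dilation s f x))\<^sup>2 = s ^ CARD('n) * (norm (f (s *\<^sub>R x)))\<^sup>2"
      using s by (simp add: dilation_def power_mult_distrib powr_half_square)
    then show "(ennreal (norm (dilation s f x)))\<^sup>2 = ennreal (s ^ CARD('n)) * (ennreal (norm (f (s *\<^sub>R x))))\<^sup>2"
      using s by (simp only: ennreal_power norm_ge_zero) (simp add: ennreal_mult)
  qed
  also have "\<dots> = ennreal (s ^ CARD('n)) * (\<integral>\<^sup>+x. (ennreal (norm (f (s *\<^sub>R x))))\<^sup>2 \<partial>lborel)"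
    by (rule nn_integral_cmult) measurable
  also have "\<dots> = ennreal (s ^ CARD('n)) * (ennreal (1 / s ^ CARD('n)) * ennreal (sqnorm f))"
    using s by (subst nn_integral_scaleR[where k = "\<lambda>x. (ennreal (norm (f x)))\<^sup>2"])
      (auto simp: nn_integral_sqnorm[OF f])
  also have "\<dots> = ennreal (s ^ CARD('n) * (1 / s ^ CARD('n)) * sqnorm f)"
    using s by (subst ennreal_mult, simp, simp add: sqnorm_nonneg, subst ennreal_mult)
      (auto simp: mult.assoc)
  also have "\<dots> = ennreal (sqnorm f)" using s by simp
  finally have e: "(\<integral>\<^sup>+x. (ennreal (norm (dilation s f x)))\<^sup>2 \<partial>lborel) = ennreal (sqnorm f)" .
  show d: "square_integrable (dilation s f)"
    by (rule square_integrable_nn) (auto simp: e intro: dilation_measurable fm)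
  show "sqnorm (dilation s f) = sqnorm f"
    using e nn_integral_sqnorm[OF d] by (simp add: sqnorm_nonneg)
qed

text \<open>The adjoint of \<open>V\<^sub>s\<close> for the bilinear pairing is \<open>V\<close> with parameter \<open>1/s\<close>; this moves dilations from \<open>f\<close>
  onto test functions.\<close>
lemma integral_dilation_mult:
  fixes f g :: "real ^ 'n \<Rightarrow> complex"
  assumes [measurable]: "f \<in> borel_measurable borel" "g \<in> borel_measurable borel" and s: "s > 0"
  shows "(\<integral>x. dilation s f x * g x \<partial>lborel) = (\<integral>x. f x * dilation (1 / s) g x \<partial>lborel)"
proof -
  let ?p = "s powr (CARD('n) / 2)"
  let ?k = "\<lambda>x. f x * g ((1 / s) *\<^sub>R x)"
  have "(\<integral>x. dilation s f x * g x \<partial>lborel) = (\<integral>x. ?p *\<^sub>R ?k (s *\<^sub>R x) \<partial>lborel)"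
    using s by (simp add: dilation_def)
  also have "\<dots> = ?p *\<^sub>R (1 / s ^ CARD('n)) *\<^sub>R (\<integral>x. ?k x \<partial>lborel)"
    using s lborel_integral_scaleR(2)[of ?k s] by simp
  also have "\<dots> = (1 / s) powr (CARD('n) / 2) *\<^sub>R (\<integral>x. ?k x \<partial>lborel)"
  proof -
    have "?p * (1 / s ^ CARD('n)) = (1 / s) powr (CARD('n) / 2)"
      unfolding powr_half_square[OF s, symmetric] using s by (simp add: power2_eq_square powr_divide)
    then show ?thesis by simp
  qed
  also have "\<dots> = (\<integral>x. f x * dilation (1 / s) g x \<partial>lborel)"
    by (simp add: dilation_def)
  finally show ?thesis .
qed

definition bump_test :: "(real ^ 'n \<Rightarrow> complex) \<Rightarrow> bool" where
  "bump_test \<phi> \<longleftrightarrow> \<phi> \<in> bump_algebra \<and> (\<exists>R. \<forall>x. norm x > R \<longrightarrow> \<phi> x = 0)"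

lemma bump_test_test_function: "bump_test \<phi> \<Longrightarrow> test_function \<phi>"
  unfolding bump_test_def test_function_def
  using bump_algebra_C_k compact_support_bounded by blast

lemma bump_test_measurable: "bump_test \<phi> \<Longrightarrow> \<phi> \<in> borel_measurable borel"
  unfolding bump_test_def using borel_measurable_continuous_onI bump_algebra_continuous by blast

lemma bump_test_square_integrable:
  fixes \<phi> :: "real ^ 'n \<Rightarrow> complex"
  assumes "bump_test \<phi>"
  shows "square_integrable \<phi>"
proof -
  obtain R where c: "continuous_on UNIV \<phi>" and z: "\<And>x. norm x > R \<Longrightarrow> \<phi> x = 0"
    using assms bump_algebra_continuous unfolding bump_test_def by blast
  have "compact (\<phi> ` cball 0 R)"
    by (intro compact_continuous_image continuous_on_subset[OF c]) auto
  then obtain M where "\<And>x. x \<in> cball 0 R \<Longrightarrow> norm (\<phi> x) \<le> M"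
    by (metis bounded_iff compact_imp_bounded imageI)
  then have "norm (\<phi> x) \<le> max M 0" for x
    using z[of x] by (cases "norm x \<le> R") (fastforce simp: le_max_iff_disj)+
  then show ?thesis
    using z by (intro square_integrable_bounded_support[of _ "max M 0" R]) (auto intro: bump_test_measurable assms)
qed

lemma bump_test_box_bump: "bump_test (box_bump m a b)"
proof -
  obtain R where "\<And>x. x \<in> box a b \<Longrightarrow> norm x \<le> R"
    using bounded_box[of a b] by (auto simp: bounded_iff)
  then have "box_bump m a b x = 0" if "norm x > R" for x
    using that by (intro box_bump_outside) force
  then show ?thesis unfolding bump_test_def using box_bump_in_bump_algebra by blast
qed

lemma bump_test_dilation:
  assumes "bump_test \<phi>" and s: "s > 0"
  shows "bump_test (dilation s \<phi>)"
proof -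
  obtain R where R: "\<phi> \<in> bump_algebra" "\<And>x. norm x > R \<Longrightarrow> \<phi> x = 0"
    using assms unfolding bump_test_def by blast
  have "dilation s \<phi> \<in> bump_algebra"
    using bump_algebra.mult[OF bump_algebra.const bump_algebra_scale[OF R(1), of s]]
    by (simp add: dilation_def[abs_def] scaleR_conv_of_real)
  moreover have "dilation s \<phi> x = 0" if "norm x > R / s" for x
    using that s R(2)[of "s *\<^sub>R x"] by (simp add: dilation_def field_simps)
  ultimately show ?thesis unfolding bump_test_def by blast
qed

definition euler :: "(real ^ 'n \<Rightarrow> complex) \<Rightarrow> real ^ 'n \<Rightarrow> complex" where
  "euler \<phi> x = (\<Sum>j\<in>UNIV. complex_of_real (x $ j) * partial_deriv j \<phi> x)"

lemma frechet_eq_partial_derivs: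
  assumes "(\<phi> has_derivative D) (at (x :: real ^ 'n))"
  shows "D v = (\<Sum>j\<in>UNIV. complex_of_real (v $ j) * partial_deriv j \<phi> x)"
proof -
  interpret D: bounded_linear D using assms by (rule has_derivative_bounded_linear)
  have "D v = D (\<Sum>j\<in>UNIV. v $ j *\<^sub>R axis j 1)"
    using basis_expansion[of v] by (simp only: scalar_mult_eq_scaleR)
  also have "\<dots> = (\<Sum>j\<in>UNIV. v $ j *\<^sub>R D (axis j 1))"
    by (simp add: D.sum D.scale)
  finally show ?thesis
    by (simp add: partial_deriv_eq[OF assms] scaleR_conv_of_real)
qed

lemma bump_test_partial_deriv:
  assumes "bump_test \<phi>"
  shows "bump_test (partial_deriv j \<phi>)"
proof -
  obtain R where R: "\<phi> \<in> bump_algebra" "\<And>x. norm x > R \<Longrightarrow> \<phi> x = 0"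
    using assms unfolding bump_test_def by blast
  have "partial_deriv j \<phi> x = 0" if "norm x > R" for x
  proof -
    have "(\<phi> has_derivative (\<lambda>h. 0)) (at x)"
    proof (rule has_derivative_transform_within_open)
      show "((\<lambda>_. 0) has_derivative (\<lambda>h. 0)) (at x)" by simp
      show "open {x. norm x > R}" by (intro open_Collect_less continuous_intros)
    qed (use that R(2) in auto)
    then show ?thesis by (simp add: partial_deriv_eq)
  qed
  with R(1) show ?thesis unfolding bump_test_def using bump_algebra_partial_deriv by blast
qed

lemma bump_test_mult: "\<psi> \<in> bump_algebra \<Longrightarrow> bump_test \<phi> \<Longrightarrow> bump_test (\<lambda>x. \<psi> x * \<phi> x)"
  unfolding bump_test_def by (auto intro: bump_algebra.mult)

lemma bump_test_add: "bump_test \<phi> \<Longrightarrow> bump_test \<psi> \<Longrightarrow> bump_test (\<lambda>x. \<phi> x + \<psi> x)"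
  unfolding bump_test_def
proof safe
  fix R S assume *: "\<forall>x. R < norm x \<longrightarrow> \<phi> x = 0" "\<forall>x. S < norm x \<longrightarrow> \<psi> x = 0"
  show "\<exists>R. \<forall>x. R < norm x \<longrightarrow> \<phi> x + \<psi> x = 0"
    using * by (intro exI[of _ "max R S"]) auto
qed (auto intro: bump_algebra.add)

lemma bump_test_sum:
  "finite I \<Longrightarrow> (\<And>i. i \<in> I \<Longrightarrow> bump_test (\<phi> i)) \<Longrightarrow> bump_test (\<lambda>x. \<Sum>i\<in>I. \<phi> i x)"
proof (induction rule: finite_induct)
  case empty
  show ?case by (auto simp: bump_test_def intro: bump_algebra.const)
qed (auto intro: bump_test_add)

lemma bump_test_euler: "bump_test \<phi> \<Longrightarrow> bump_test (euler \<phi>)"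
  unfolding euler_def[abs_def]
  by (intro bump_test_sum bump_test_mult bump_test_partial_deriv bump_algebra.coord) auto

text \<open>The infinitesimal generator \<open>x \<cdot> \<nabla> + n/2\<close> of the dilation group in the parameter \<open>ln s\<close>.\<close>
definition dilation_generator :: "(real ^ 'n \<Rightarrow> complex) \<Rightarrow> real ^ 'n \<Rightarrow> complex" where
  "dilation_generator \<phi> x = of_real (CARD('n) / 2) * \<phi> x + euler \<phi> x"

lemma bump_test_generator: "bump_test \<phi> \<Longrightarrow> bump_test (dilation_generator \<phi>)"
  unfolding dilation_generator_def[abs_def]
  by (intro bump_test_add bump_test_mult bump_test_euler bump_algebra.const)

lemma dilation_has_vector_derivative:
  fixes \<phi> :: "real ^ 'n \<Rightarrow> complex"
  assumes "bump_test \<phi>" and s: "s > 0"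
  shows "((\<lambda>s. dilation s \<phi> x) has_vector_derivative (1 / s) *\<^sub>R dilation s (dilation_generator \<phi>) x) (at s)"
proof -
  obtain D where D: "(\<phi> has_derivative D) (at (s *\<^sub>R x))"
    using assms bump_algebra_differentiable unfolding bump_test_def differentiable_def by blast
  interpret D: bounded_linear D using D by (rule has_derivative_bounded_linear)
  have "((\<lambda>s. \<phi> (s *\<^sub>R x)) has_derivative (\<lambda>h. D (h *\<^sub>R x))) (at s)"
    by (rule has_derivative_compose[where g = \<phi>]) (auto intro!: derivative_eq_intros D)
  then have 1: "((\<lambda>s. \<phi> (s *\<^sub>R x)) has_vector_derivative D x) (at s)"
    by (simp add: has_vector_derivative_def D.scale)
  have 2: "((\<lambda>s. s powr (CARD('n) / 2)) has_real_derivative (CARD('n) / 2 * s powr (CARD('n) / 2 - 1))) (at s)"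
    using s by (auto intro!: derivative_eq_intros)
  have "((\<lambda>s. s powr (CARD('n) / 2) *\<^sub>R \<phi> (s *\<^sub>R x)) has_vector_derivative
     s powr (CARD('n) / 2) *\<^sub>R D x + (CARD('n) / 2 * s powr (CARD('n) / 2 - 1)) *\<^sub>R \<phi> (s *\<^sub>R x)) (at s)"
    by (rule has_vector_derivative_scaleR[OF 2 1])
  moreover have "D x = (1 / s) *\<^sub>R euler \<phi> (s *\<^sub>R x)"
  proof -
    have "D (s *\<^sub>R x) = euler \<phi> (s *\<^sub>R x)"
      unfolding euler_def by (rule frechet_eq_partial_derivs[OF D])
    moreover have "D x = (1 / s) *\<^sub>R D (s *\<^sub>R x)"
      using s by (simp add: D.scale)
    ultimately show ?thesis by simp
  qed
  moreover have "s powr (CARD('n) / 2 - 1) = s powr (CARD('n) / 2) / s"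
    using s by (simp add: powr_diff)
  ultimately have "((\<lambda>s. s powr (CARD('n) / 2) *\<^sub>R \<phi> (s *\<^sub>R x)) has_vector_derivative
     s powr (CARD('n) / 2) *\<^sub>R (1 / s) *\<^sub>R euler \<phi> (s *\<^sub>R x)
       + (CARD('n) / 2 * (s powr (CARD('n) / 2) / s)) *\<^sub>R \<phi> (s *\<^sub>R x)) (at s)"
    by (simp only:)
  moreover have "s powr (CARD('n) / 2) *\<^sub>R (1 / s) *\<^sub>R euler \<phi> (s *\<^sub>R x)
       + (CARD('n) / 2 * (s powr (CARD('n) / 2) / s)) *\<^sub>R \<phi> (s *\<^sub>R x)
     = (1 / s) *\<^sub>R dilation s (dilation_generator \<phi>) x"
    using s by (simp add: dilation_def dilation_generator_def scaleR_conv_of_real field_simps)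
  ultimately show ?thesis
    by (simp only: dilation_def)
qed

lemma dilation_generator_commute:
  fixes \<phi> :: "real ^ 'n \<Rightarrow> complex"
  assumes "bump_test \<phi>"
  shows "dilation_generator (dilation s \<phi>) = dilation s (dilation_generator \<phi>)"
proof
  fix x :: "real ^ 'n"
  obtain D where D: "(\<phi> has_derivative D) (at (s *\<^sub>R x))"
    using assms bump_algebra_differentiable unfolding bump_test_def differentiable_def by blast
  interpret D: bounded_linear D using D by (rule has_derivative_bounded_linear)
  have "((\<lambda>x. \<phi> (s *\<^sub>R x)) has_derivative (\<lambda>h. D (s *\<^sub>R h))) (at x)"
    by (rule has_derivative_compose[where g = \<phi>]) (auto intro!: derivative_eq_intros D)
  then have "((dilation s \<phi>) has_derivative (\<lambda>h. s powr (CARD('n) / 2) *\<^sub>R D (s *\<^sub>R h))) (at x)"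
    unfolding dilation_def[abs_def] by (rule has_derivative_scaleR_right)
  from frechet_eq_partial_derivs[OF this, of x]
  have "euler (dilation s \<phi>) x = s powr (CARD('n) / 2) *\<^sub>R D (s *\<^sub>R x)"
    by (simp add: euler_def)
  also have "D (s *\<^sub>R x) = euler \<phi> (s *\<^sub>R x)"
    unfolding euler_def by (rule frechet_eq_partial_derivs[OF D])
  finally have "dilation_generator (dilation s \<phi>) x
      = of_real (CARD('n) / 2) * (s powr (CARD('n) / 2) *\<^sub>R \<phi> (s *\<^sub>R x)) + s powr (CARD('n) / 2) *\<^sub>R euler \<phi> (s *\<^sub>R x)"
    by (simp only: dilation_generator_def) (simp only: dilation_def)
  then show "dilation_generator (dilation s \<phi>) x = dilation s (dilation_generator \<phi>) x"
    by (simp add: dilation_generator_def dilation_def scaleR_conv_of_real algebra_simps)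
qed

section \<open>The orbit of f under dilations\<close>

text \<open>The distributional equation \<open>(x \<cdot> \<nabla>) f = g\<close> for Borel representatives, tested only against the
  explicit bump functions.\<close>
definition weak_euler :: "(real ^ 'n \<Rightarrow> complex) \<Rightarrow> (real ^ 'n \<Rightarrow> complex) \<Rightarrow> bool" where
  "weak_euler f g \<longleftrightarrow> (\<forall>\<phi>. bump_test \<phi> \<longrightarrow>
     (\<Sum>j\<in>UNIV. - (\<integral>x. f x * partial_deriv j (\<lambda>x. complex_of_real (x $ j) * \<phi> x) x \<partial>lborel))
       = (\<integral>x. g x * \<phi> x \<partial>lborel))"

lemma sum_partial_deriv_coord_mult:
  fixes \<phi> :: "real ^ 'n \<Rightarrow> complex"
  assumes "\<phi> \<in> bump_algebra"
  shows "(\<Sum>j\<in>UNIV. partial_deriv j (\<lambda>x. complex_of_real (x $ j) * \<phi> x) x)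
    = of_nat CARD('n) * \<phi> x + euler \<phi> x"
proof -
  obtain D where D: "(\<phi> has_derivative D) (at x)"
    using assms bump_algebra_differentiable unfolding differentiable_def by blast
  have "partial_deriv j (\<lambda>x. complex_of_real (x $ j) * \<phi> x) x
      = complex_of_real (x $ j) * partial_deriv j \<phi> x + \<phi> x" for j
  proof -
    have "((\<lambda>x. complex_of_real (x $ j)) has_derivative (\<lambda>h. complex_of_real (h $ j))) (at x)"
      by (intro bounded_linear.has_derivative[OF bounded_linear_of_real]
          bounded_linear.has_derivative[OF bounded_linear_vec_nth] has_derivative_ident)
    from has_derivative_mult[OF this D]
    show ?thesis by (simp add: partial_deriv_eq partial_deriv_eq[OF D])
  qed
  then show ?thesis
    by (simp add: euler_def sum.distrib)
qed

text \<open>Since \<open>\<Sum>\<^sub>j \<partial>\<^sub>j (x\<^sub>j \<phi>) = n \<phi> + x \<cdot> \<nabla>\<phi>\<close>, adding \<open>(n/2) f\<close> to \<open>g\<close> splits the zeroth-order term evenly: the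
  generator is antisymmetric.\<close>
lemma weak_euler_generator:
  fixes f g \<phi> :: "real ^ 'n \<Rightarrow> complex"
  assumes w: "weak_euler f g" and f: "square_integrable f" and g: "square_integrable g"
    and \<phi>: "bump_test \<phi>"
  shows "(\<integral>x. (g x + of_real (CARD('n) / 2) * f x) * \<phi> x \<partial>lborel)
    = - (\<integral>x. f x * dilation_generator \<phi> x \<partial>lborel)"
proof -
  have b: "bump_test (partial_deriv j (\<lambda>x. complex_of_real (x $ j) * \<phi> x))" for j
    by (intro bump_test_partial_deriv bump_test_mult \<phi> bump_algebra.coord)
  have i: "bump_test \<psi> \<Longrightarrow> integrable lborel (\<lambda>x. f x * \<psi> x)" for \<psi>
    by (intro square_integrable_mult f bump_test_square_integrable)
  have ig: "integrable lborel (\<lambda>x. g x * \<phi> x)"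
    by (intro square_integrable_mult g bump_test_square_integrable \<phi>)
  have "(\<integral>x. g x * \<phi> x \<partial>lborel)
     = - (\<integral>x. (\<Sum>j\<in>UNIV. f x * partial_deriv j (\<lambda>x. complex_of_real (x $ j) * \<phi> x) x) \<partial>lborel)"
    using w \<phi> unfolding weak_euler_def
    by (subst Bochner_Integration.integral_sum) (auto simp: sum_negf intro: i b)
  also have "(\<lambda>x. \<Sum>j\<in>UNIV. f x * partial_deriv j (\<lambda>x. complex_of_real (x $ j) * \<phi> x) x)
     = (\<lambda>x. f x * dilation_generator \<phi> x + of_real (CARD('n) / 2) * (f x * \<phi> x))"
  proof
    fix x
    have "of_nat CARD('n) * \<phi> x + euler \<phi> x = dilation_generator \<phi> x + of_real (CARD('n) / 2) * \<phi> x"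
      by (simp add: dilation_generator_def field_simps)
    then show "(\<Sum>j\<in>UNIV. f x * partial_deriv j (\<lambda>x. complex_of_real (x $ j) * \<phi> x) x)
      = f x * dilation_generator \<phi> x + of_real (CARD('n) / 2) * (f x * \<phi> x)"
      using sum_partial_deriv_coord_mult[of \<phi> x] \<phi>
      by (simp add: bump_test_def sum_distrib_left[symmetric] algebra_simps)
  qed
  also have "(\<integral>x. f x * dilation_generator \<phi> x + of_real (CARD('n) / 2) * (f x * \<phi> x) \<partial>lborel)
    = (\<integral>x. f x * dilation_generator \<phi> x \<partial>lborel) + of_real (CARD('n) / 2) * (\<integral>x. f x * \<phi> x \<partial>lborel)"
    using i[OF \<phi>] i[OF bump_test_generator[OF \<phi>]] by (subst Bochner_Integration.integral_add) auto
  finally have "(\<integral>x. g x * \<phi> x \<partial>lborel) + of_real (CARD('n) / 2) * (\<integral>x. f x * \<phi> x \<partial>lborel)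
    = - (\<integral>x. f x * dilation_generator \<phi> x \<partial>lborel)"
    by simp
  moreover have "(\<integral>x. (g x + of_real (CARD('n) / 2) * f x) * \<phi> x \<partial>lborel)
    = (\<integral>x. g x * \<phi> x + of_real (CARD('n) / 2) * (f x * \<phi> x) \<partial>lborel)"
    by (simp add: algebra_simps)
  moreover have "\<dots> = (\<integral>x. g x * \<phi> x \<partial>lborel) + of_real (CARD('n) / 2) * (\<integral>x. f x * \<phi> x \<partial>lborel)"
    using i[OF \<phi>] ig by (subst Bochner_Integration.integral_add) auto
  ultimately show ?thesis by simp
qed

text \<open>
  Justifies Fubini for both uses of the double integral. The rescaling parameter \<open>t s\<close> is \<open>s\<close> when the
  dilation acts on the function and \<open>1 / s\<close> when it acts on the test function; by unitarity the
  inner integrals are bounded uniformly in \<open>s\<close>.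
\<close>
lemma dilation_pair_integrable:
  fixes u v :: "real ^ 'n \<Rightarrow> complex" and t :: "real \<Rightarrow> real"
  assumes u: "square_integrable u" and v: "square_integrable v" and l: "1 \<le> l"
    and [measurable]: "t \<in> borel_measurable borel" and t: "\<And>s. s \<ge> 1 \<Longrightarrow> t s > 0"
  shows "integrable (lborel \<Otimes>\<^sub>M lborel)
    (\<lambda>(s, x). indicator {1..l} s *\<^sub>R (1 / s) *\<^sub>R (dilation (t s) u x * v x))"
proof (rule integrableI_bounded)
  have [measurable]: "u \<in> borel_measurable borel" "v \<in> borel_measurable borel"
    using u v by (auto simp: square_integrable_def)
  let ?F = "\<lambda>s x. indicator {1..l} s *\<^sub>R (1 / s) *\<^sub>R (dilation (t s) u x * v x)"
  show m: "case_prod ?F \<in> borel_measurable (lborel \<Otimes>\<^sub>M lborel)"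
    unfolding dilation_def by measurable
  let ?K = "ennreal ((sqnorm u + sqnorm v) / 2)"
  have "(\<integral>\<^sup>+p. ennreal (norm (case_prod ?F p)) \<partial>(lborel \<Otimes>\<^sub>M lborel))
      = (\<integral>\<^sup>+s. \<integral>\<^sup>+x. ennreal (norm (?F s x)) \<partial>lborel \<partial>lborel)"
    using m by (subst lborel.nn_integral_fst[symmetric]) auto
  also have "\<dots> \<le> (\<integral>\<^sup>+s. ?K * indicator {1..l} s \<partial>lborel)"
  proof (rule nn_integral_mono)
    fix s :: real
    show "(\<integral>\<^sup>+x. ennreal (norm (?F s x)) \<partial>lborel) \<le> ?K * indicator {1..l} s"
    proof (cases "s \<in> {1..l}")
      case True
      then have s: "s \<ge> 1" by simp
      have "norm (?F s x) \<le> norm (dilation (t s) u x * v x)" for x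
        using s by (simp add: indicator_def mult_left_le_one_le divide_simps mult_le_cancel_left1)
      then have "(\<integral>\<^sup>+x. ennreal (norm (?F s x)) \<partial>lborel) \<le> (\<integral>\<^sup>+x. ennreal (norm (dilation (t s) u x * v x)) \<partial>lborel)"
        by (intro nn_integral_mono ennreal_leI)
      also have "\<dots> \<le> ?K"
        using square_integrable_mult(2)[OF square_integrable_dilation(1)[OF u t[OF s]] v]
          square_integrable_dilation(2)[OF u t[OF s]] by simp
      finally show ?thesis using True by simp
    qed simp
  qed
  also have "\<dots> = ?K * ennreal (l - 1)"
    using l by (simp add: nn_integral_cmult_indicator)
  also have "\<dots> < \<infinity>" by (simp add: ennreal_mult_less_top)
  finally show "(\<integral>\<^sup>+p. ennreal (norm (case_prod ?F p)) \<partial>(lborel \<Otimes>\<^sub>M lborel)) < \<infinity>" .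
qed

definition dilation_average :: "real \<Rightarrow> (real ^ 'n \<Rightarrow> complex) \<Rightarrow> real ^ 'n \<Rightarrow> complex" where
  "dilation_average l h x = (\<integral>s. indicator {1..l} s *\<^sub>R (1 / s) *\<^sub>R dilation s h x \<partial>lborel)"

lemma dilation_average_mult:
  "dilation_average l h x * c = (\<integral>s. indicator {1..l} s *\<^sub>R (1 / s) *\<^sub>R (dilation s h x * c) \<partial>lborel)"
proof -
  have "dilation_average l h x * c = (\<integral>s. (indicator {1..l} s *\<^sub>R (1 / s) *\<^sub>R dilation s h x) * c \<partial>lborel)"
    unfolding dilation_average_def by (simp only: integral_mult_left_zero)
  then show ?thesis by (simp add: scaleR_conv_of_real mult.assoc)
qed

lemma dilation_average_integral:
  fixes h v :: "real ^ 'n \<Rightarrow> complex"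
  assumes h: "square_integrable h" and v: "square_integrable v" and l: "1 \<le> l"
  shows "integrable lborel (\<lambda>x. dilation_average l h x * v x)"
    and "(\<integral>x. dilation_average l h x * v x \<partial>lborel)
      = (\<integral>s. indicator {1..l} s *\<^sub>R (1 / s) *\<^sub>R (\<integral>x. dilation s h x * v x \<partial>lborel) \<partial>lborel)"
proof -
  have i: "integrable (lborel \<Otimes>\<^sub>M lborel)
    (\<lambda>(s, x). indicator {1..l} s *\<^sub>R (1 / s) *\<^sub>R (dilation s h x * v x))"
    using dilation_pair_integrable[OF h v l, of "\<lambda>s. s"] by simp
  show "integrable lborel (\<lambda>x. dilation_average l h x * v x)"
    unfolding dilation_average_mult using lborel_pair.integrable_snd[OF i] .
  show "(\<integral>x. dilation_average l h x * v x \<partial>lborel)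
      = (\<integral>s. indicator {1..l} s *\<^sub>R (1 / s) *\<^sub>R (\<integral>x. dilation s h x * v x \<partial>lborel) \<partial>lborel)"
    unfolding dilation_average_mult lborel_pair.Fubini_integral[OF i] by simp
qed

text \<open>
  On the test side \<open>s \<mapsto> V\<^sub>1\<^sub>/\<^sub>s \<phi>(x)\<close> is differentiable with derivative
  \<open>-(1/s) V\<^sub>1\<^sub>/\<^sub>s\<close> applied to the generator of \<open>\<phi>\<close>, so the fundamental theorem of calculus and Fubini express
  the pairing with \<open>V\<^sub>l f - f\<close> as an integral over \<open>s\<close> of pairings of \<open>f\<close> with generators. The weak
  equation replaces each of them by a pairing with \<open>h\<close>.
\<close>
lemma dilation_difference_weak:
  fixes f g \<phi> :: "real ^ 'n \<Rightarrow> complex"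
  assumes w: "weak_euler f g" and f: "square_integrable f" and g: "square_integrable g"
    and \<phi>: "bump_test \<phi>" and l: "1 \<le> l"
  defines "h \<equiv> \<lambda>x. g x + of_real (CARD('n) / 2) * f x"
  shows "(\<integral>x. (dilation l f x - f x) * \<phi> x \<partial>lborel) = (\<integral>x. dilation_average l h x * \<phi> x \<partial>lborel)"
proof -
  have h: "square_integrable h"
    unfolding h_def by (rule square_integrable_linear[OF g f])
  have \<phi>2: "square_integrable \<phi>" by (rule bump_test_square_integrable[OF \<phi>])
  have \<psi>: "bump_test (dilation_generator \<phi>)" by (rule bump_test_generator[OF \<phi>])
  have \<psi>2: "square_integrable (dilation_generator \<phi>)" by (rule bump_test_square_integrable[OF \<psi>])
  let ?\<psi> = "dilation_generator \<phi>"
  have [measurable]: "f \<in> borel_measurable borel" "\<phi> \<in> borel_measurable borel" "h \<in> borel_measurable borel"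
    using f \<phi>2 h by (auto simp: square_integrable_def)
  have ftc: "dilation (1 / l) \<phi> x - \<phi> x
    = (\<integral>s. - (indicator {1..l} s *\<^sub>R (1 / s) *\<^sub>R dilation (1 / s) ?\<psi> x) \<partial>lborel)" for x
  proof -
    have d: "((\<lambda>s. dilation (1 / s) \<phi> x) has_vector_derivative (- (1 / s) *\<^sub>R dilation (1 / s) ?\<psi> x)) (at s)"
      if "s > 0" for s
    proof -
      have "((\<lambda>s. 1 / s) has_real_derivative (- 1 / s\<^sup>2)) (at s)"
        using that by (auto intro!: derivative_eq_intros simp: power2_eq_square)
      then have "((\<lambda>s. 1 / s) has_vector_derivative (- 1 / s\<^sup>2)) (at s)"
        by (simp only: has_real_derivative_iff_has_vector_derivative)
      from vector_diff_chain_at[OF this dilation_has_vector_derivative[OF \<phi>]]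
      have "((\<lambda>s. dilation (1 / s) \<phi> x) has_vector_derivative
          ((- 1 / s\<^sup>2) *\<^sub>R (1 / (1 / s)) *\<^sub>R dilation (1 / s) ?\<psi> x)) (at s)"
        using that by (simp add: o_def)
      then show ?thesis using that by (simp add: power2_eq_square)
    qed
    have c: "continuous_on {1..l} (\<lambda>s. - (1 / s) *\<^sub>R dilation (1 / s) ?\<psi> x)"
    proof -
      have "continuous_on UNIV ?\<psi>"
        using \<psi> bump_algebra_continuous unfolding bump_test_def by blast
      then have "continuous_on {1..l} (\<lambda>s. ?\<psi> ((1 / s) *\<^sub>R x))"
        by (rule continuous_on_compose2) (auto intro!: continuous_intros)
      then show ?thesis
        unfolding dilation_def by (intro continuous_intros) auto
    qed
    have "(\<integral>s. indicator {1..l} s *\<^sub>R (- (1 / s) *\<^sub>R dilation (1 / s) ?\<psi> x) \<partial>lborel)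
        = dilation (1 / l) \<phi> x - dilation (1 / 1) \<phi> x"
    proof (rule integral_FTC_Icc[OF l _ c])
      fix s :: real assume "1 \<le> s"
      then show "((\<lambda>s. dilation (1 / s) \<phi> x) has_vector_derivative - (1 / s) *\<^sub>R dilation (1 / s) ?\<psi> x) (at s within {1..l})"
        using has_vector_derivative_at_within[OF d[of s]] by simp
    qed
    then show ?thesis by (simp add: dilation_def)
  qed
  have i: "integrable (lborel \<Otimes>\<^sub>M lborel)
    (\<lambda>(s, x). indicator {1..l} s *\<^sub>R (1 / s) *\<^sub>R (dilation (1 / s) ?\<psi> x * f x))"
    using dilation_pair_integrable[OF \<psi>2 f l, of "\<lambda>s. 1 / s"] by simp
  have int: "integrable lborel (\<lambda>x. dilation l f x * \<phi> x)" "integrable lborel (\<lambda>x. f x * \<phi> x)"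
     "integrable lborel (\<lambda>x. f x * dilation (1 / l) \<phi> x)"
    using l by (auto intro!: square_integrable_mult f \<phi>2 square_integrable_dilation)
  have "(\<integral>x. (dilation l f x - f x) * \<phi> x \<partial>lborel)
      = (\<integral>x. f x * dilation (1 / l) \<phi> x \<partial>lborel) - (\<integral>x. f x * \<phi> x \<partial>lborel)"
    using l int by (simp add: integral_dilation_mult[symmetric] left_diff_distrib)
  also have "\<dots> = (\<integral>x. f x * (dilation (1 / l) \<phi> x - \<phi> x) \<partial>lborel)"
    using int by (simp add: right_diff_distrib)
  also have "\<dots> = (\<integral>x. - (\<integral>s. indicator {1..l} s *\<^sub>R (1 / s) *\<^sub>R (dilation (1 / s) ?\<psi> x * f x) \<partial>lborel) \<partial>lborel)"
  proof (intro Bochner_Integration.integral_cong refl)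
    fix x
    have "f x * (dilation (1 / l) \<phi> x - \<phi> x)
        = - ((\<integral>s. indicator {1..l} s *\<^sub>R (1 / s) *\<^sub>R dilation (1 / s) ?\<psi> x \<partial>lborel) * f x)"
      unfolding ftc by (simp only: integral_minus mult.commute mult_minus_left mult_minus_right)
    also have "(\<integral>s. indicator {1..l} s *\<^sub>R (1 / s) *\<^sub>R dilation (1 / s) ?\<psi> x \<partial>lborel) * f x
        = (\<integral>s. (indicator {1..l} s *\<^sub>R (1 / s) *\<^sub>R dilation (1 / s) ?\<psi> x) * f x \<partial>lborel)"
      by (simp only: integral_mult_left_zero)
    finally show "f x * (dilation (1 / l) \<phi> x - \<phi> x)
        = - (\<integral>s. indicator {1..l} s *\<^sub>R (1 / s) *\<^sub>R (dilation (1 / s) ?\<psi> x * f x) \<partial>lborel)"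
      by (simp add: scaleR_conv_of_real mult.assoc)
  qed
  also have "\<dots> = - (\<integral>s. (\<integral>x. indicator {1..l} s *\<^sub>R (1 / s) *\<^sub>R (dilation (1 / s) ?\<psi> x * f x) \<partial>lborel) \<partial>lborel)"
    unfolding integral_minus lborel_pair.Fubini_integral[OF i] ..
  also have "\<dots> = (\<integral>s. indicator {1..l} s *\<^sub>R (1 / s) *\<^sub>R (- (\<integral>x. f x * dilation (1 / s) ?\<psi> x \<partial>lborel)) \<partial>lborel)"
    unfolding integral_scaleR_right scaleR_minus_right integral_minus mult.commute[of _ "f _"] ..
  also have "\<dots> = (\<integral>s. indicator {1..l} s *\<^sub>R (1 / s) *\<^sub>R (\<integral>x. dilation s h x * \<phi> x \<partial>lborel) \<partial>lborel)"
  proof (intro Bochner_Integration.integral_cong refl)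
    fix s :: real
    show "indicator {1..l} s *\<^sub>R (1 / s) *\<^sub>R (- (\<integral>x. f x * dilation (1 / s) ?\<psi> x \<partial>lborel))
      = indicator {1..l} s *\<^sub>R (1 / s) *\<^sub>R (\<integral>x. dilation s h x * \<phi> x \<partial>lborel)"
    proof (cases "s \<in> {1..l}")
      case True
      then have s: "s > 0" by simp
      have "- (\<integral>x. f x * dilation (1 / s) ?\<psi> x \<partial>lborel) = (\<integral>x. h x * dilation (1 / s) \<phi> x \<partial>lborel)"
        unfolding h_def dilation_generator_commute[OF \<phi>, symmetric]
        by (rule weak_euler_generator[OF w f g bump_test_dilation[OF \<phi>], symmetric]) (use s in simp)
      also have "\<dots> = (\<integral>x. dilation s h x * \<phi> x \<partial>lborel)"
        using s by (simp add: integral_dilation_mult)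
      finally show ?thesis by simp
    qed simp
  qed
  also have "\<dots> = (\<integral>x. dilation_average l h x * \<phi> x \<partial>lborel)"
    by (rule dilation_average_integral(2)[OF h \<phi>2 l, symmetric])
  finally show ?thesis .
qed

theorem dilation_difference_AE:
  fixes f g :: "real ^ 'n \<Rightarrow> complex"
  assumes w: "weak_euler f g" and f: "square_integrable f" and g: "square_integrable g" and l: "1 \<le> l"
  defines "h \<equiv> \<lambda>x. g x + of_real (CARD('n) / 2) * f x"
  shows "AE x in lborel. dilation l f x - f x = dilation_average l h x"
proof -
  have h: "square_integrable h"
    unfolding h_def by (rule square_integrable_linear[OF g f])
  have df: "square_integrable (dilation l f)"
    using l by (intro square_integrable_dilation f) auto
  let ?D = "\<lambda>x. dilation l f x - f x - dilation_average l h x"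
  have i: "integrable lborel (\<lambda>x. ?D x * v x)" if v: "square_integrable v" for v
  proof -
    have "integrable lborel (\<lambda>x. dilation l f x * v x - f x * v x - dilation_average l h x * v x)"
      by (intro Bochner_Integration.integrable_diff square_integrable_mult(1) f df v
          dilation_average_integral(1) h l)
    then show ?thesis by (simp add: left_diff_distrib)
  qed
  have "AE x in lborel. ?D x = 0"
  proof (rule AE_zero_of_box_bumps)
    fix a b :: "real ^ 'n"
    obtain R where R: "\<And>x. x \<in> box a b \<Longrightarrow> norm x \<le> R"
      using bounded_box[of a b] by (auto simp: bounded_iff)
    have "square_integrable (\<lambda>x. indicator (box a b) x :: complex)"
    proof (rule square_integrable_bounded_support[of _ 1 R])
      show "(\<lambda>x. indicator (box a b) x :: complex) \<in> borel_measurable borel"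
        by simp
      show "norm (indicator (box a b) x :: complex) \<le> 1" for x
        by (simp add: indicator_def)
      show "indicator (box a b) x = (0 :: complex)" if "norm x > R" for x
        using R[of x] that by (auto simp: indicator_def)
    qed
    from i[OF this] show "set_integrable lborel (box a b) ?D"
      by (simp add: set_integrable_def scaleR_conv_of_real mult.commute of_real_indicator)
    fix m
    let ?\<phi> = "box_bump m a b"
    have \<phi>: "bump_test ?\<phi>" by (rule bump_test_box_bump)
    then have \<phi>2: "square_integrable ?\<phi>" by (rule bump_test_square_integrable)
    have "(\<integral>x. ?D x * ?\<phi> x \<partial>lborel) = (\<integral>x. (dilation l f x - f x) * ?\<phi> x - dilation_average l h x * ?\<phi> x \<partial>lborel)"
      by (simp add: left_diff_distrib)
    also have "\<dots> = (\<integral>x. (dilation l f x - f x) * ?\<phi> x \<partial>lborel) - (\<integral>x. dilation_average l h x * ?\<phi> x \<partial>lborel)"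
    proof (rule Bochner_Integration.integral_diff)
      show "integrable lborel (\<lambda>x. (dilation l f x - f x) * ?\<phi> x)"
        unfolding left_diff_distrib
        by (intro Bochner_Integration.integrable_diff square_integrable_mult(1) f df \<phi>2)
      show "integrable lborel (\<lambda>x. dilation_average l h x * ?\<phi> x)"
        by (rule dilation_average_integral(1)[OF h \<phi>2 l])
    qed
    also have "\<dots> = 0"
      using dilation_difference_weak[OF w f g \<phi> l] by (simp add: h_def)
    finally show "(\<integral>x. ?D x * ?\<phi> x \<partial>lborel) = 0" .
  qed
  then show ?thesis by eventually_elim simp
qed

section \<open>The energy identity\<close>
lemma nn_integral_inverse_Icc:
  assumes "1 \<le> l"
  shows "(\<integral>\<^sup>+s. ennreal (1 / s) * indicator {1..l} s \<partial>lborel) = ennreal (ln l)"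
proof -
  have "(\<integral>\<^sup>+s. ennreal (1 / s) * indicator {1..l} s \<partial>lborel) = ennreal (ln l - ln 1)"
    using assms by (intro nn_integral_FTC_Icc) (auto intro!: derivative_eq_intros)
  then show ?thesis by simp
qed

text \<open>Cauchy--Schwarz for the measure \<open>ds/s\<close>, which has mass \<open>ln l\<close>. It is stated in the extended
  nonnegative reals because the Bochner integral may fail to exist at exceptional points, where its
  value is \<open>0\<close>.\<close>
lemma dilation_average_square_le:
  fixes h :: "real ^ 'n \<Rightarrow> complex"
  assumes [measurable]: "h \<in> borel_measurable borel" and l: "1 \<le> l"
  shows "(ennreal (norm (dilation_average l h x)))\<^sup>2
    \<le> ennreal (ln l) * (\<integral>\<^sup>+s. ennreal (1 / s) * indicator {1..l} s * (ennreal (norm (dilation s h x)))\<^sup>2 \<partial>lborel)"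
proof -
  have [measurable]: "(\<lambda>s. dilation s h x) \<in> borel_measurable borel"
    unfolding dilation_def by measurable
  let ?w = "\<lambda>s. indicator {1..l} s * ennreal (sqrt (1 / s))"
  have w2: "(?w s)\<^sup>2 = ennreal (1 / s) * indicator {1..l} s" for s
    by (auto simp: indicator_def ennreal_power)
  have "ennreal (norm (dilation_average l h x))
      \<le> (\<integral>\<^sup>+s. ennreal (norm (indicator {1..l} s *\<^sub>R (1 / s) *\<^sub>R dilation s h x)) \<partial>lborel)"
  proof (cases "integrable lborel (\<lambda>s. indicator {1..l} s *\<^sub>R (1 / s) *\<^sub>R dilation s h x)")
    case True
    then show ?thesis
      unfolding dilation_average_def by (rule integral_norm_bound_ennreal)
  next
    case False
    then show ?thesis
      unfolding dilation_average_def by (simp add: not_integrable_integral_eq)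
  qed
  also have "\<dots> = (\<integral>\<^sup>+s. ?w s * (?w s * ennreal (norm (dilation s h x))) \<partial>lborel)"
  proof (rule nn_integral_cong)
    fix s :: real
    have "ennreal (norm (indicator {1..l} s *\<^sub>R (1 / s) *\<^sub>R dilation s h x)) = (?w s)\<^sup>2 * ennreal (norm (dilation s h x))"
      unfolding w2 by (auto simp: indicator_def ennreal_mult divide_inverse)
    then show "ennreal (norm (indicator {1..l} s *\<^sub>R (1 / s) *\<^sub>R dilation s h x))
        = ?w s * (?w s * ennreal (norm (dilation s h x)))"
      by (simp add: power2_eq_square mult.assoc)
  qed
  finally have "(ennreal (norm (dilation_average l h x)))\<^sup>2 \<le> (\<integral>\<^sup>+s. ?w s * (?w s * ennreal (norm (dilation s h x))) \<partial>lborel)\<^sup>2"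
    by (intro power_mono) auto
  also have "\<dots> \<le> (\<integral>\<^sup>+s. (?w s)\<^sup>2 \<partial>lborel) * (\<integral>\<^sup>+s. (?w s * ennreal (norm (dilation s h x)))\<^sup>2 \<partial>lborel)"
    by (rule Cauchy_Schwarz_nn_integral) measurable
  also have "(\<integral>\<^sup>+s. (?w s)\<^sup>2 \<partial>lborel) = ennreal (ln l)"
    unfolding w2 by (rule nn_integral_inverse_Icc[OF l])
  also have "(\<integral>\<^sup>+s. (?w s * ennreal (norm (dilation s h x)))\<^sup>2 \<partial>lborel)
     = (\<integral>\<^sup>+s. ennreal (1 / s) * indicator {1..l} s * (ennreal (norm (dilation s h x)))\<^sup>2 \<partial>lborel)"
    unfolding power_mult_distrib[of "?w _"] w2 ..
  finally show ?thesis .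
qed

lemma dilation_average_measurable:
  fixes h :: "real ^ 'n \<Rightarrow> complex"
  assumes [measurable]: "h \<in> borel_measurable borel"
  shows "dilation_average l h \<in> borel_measurable borel"
proof -
  have "(\<lambda>x. \<integral>s. indicator {1..l} s *\<^sub>R (1 / s) *\<^sub>R (s powr (CARD('n) / 2) *\<^sub>R h (s *\<^sub>R x)) \<partial>lborel) \<in> borel_measurable borel"
    by measurable
  then show ?thesis
    by (simp only: dilation_average_def[abs_def] dilation_def)
qed

lemma dilation_average_square_integrable:
  fixes h :: "real ^ 'n \<Rightarrow> complex"
  assumes h: "square_integrable h" and l: "1 \<le> l"
  shows "square_integrable (dilation_average l h)" "sqnorm (dilation_average l h) \<le> (ln l)\<^sup>2 * sqnorm h"
proof -
  have hm [measurable]: "h \<in> borel_measurable borel" using h by (simp add: square_integrable_def)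
  have am [measurable]: "dilation_average l h \<in> borel_measurable borel"
    by (rule dilation_average_measurable[OF hm])
  have "(\<integral>\<^sup>+x. (ennreal (norm (dilation_average l h x)))\<^sup>2 \<partial>lborel)
    \<le> (\<integral>\<^sup>+x. ennreal (ln l) * (\<integral>\<^sup>+s. ennreal (1 / s) * indicator {1..l} s * (ennreal (norm (dilation s h x)))\<^sup>2 \<partial>lborel) \<partial>lborel)"
    by (intro nn_integral_mono dilation_average_square_le[OF hm l])
  also have "\<dots> = ennreal (ln l) * (\<integral>\<^sup>+x. (\<integral>\<^sup>+s. ennreal (1 / s) * indicator {1..l} s * (ennreal (norm (dilation s h x)))\<^sup>2 \<partial>lborel) \<partial>lborel)"
    unfolding dilation_def by (rule nn_integral_cmult) measurable
  also have "(\<integral>\<^sup>+x. (\<integral>\<^sup>+s. ennreal (1 / s) * indicator {1..l} s * (ennreal (norm (dilation s h x)))\<^sup>2 \<partial>lborel) \<partial>lborel)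
    = (\<integral>\<^sup>+s. (\<integral>\<^sup>+x. ennreal (1 / s) * indicator {1..l} s * (ennreal (norm (dilation s h x)))\<^sup>2 \<partial>lborel) \<partial>lborel)"
    unfolding dilation_def by (rule lborel_pair.Fubini') measurable
  also have "\<dots> = (\<integral>\<^sup>+s. ennreal (sqnorm h) * (ennreal (1 / s) * indicator {1..l} s) \<partial>lborel)"
  proof (rule nn_integral_cong)
    fix s :: real
    show "(\<integral>\<^sup>+x. ennreal (1 / s) * indicator {1..l} s * (ennreal (norm (dilation s h x)))\<^sup>2 \<partial>lborel)
      = ennreal (sqnorm h) * (ennreal (1 / s) * indicator {1..l} s)"
    proof (cases "s \<in> {1..l}")
      case True
      then have s: "s > 0" by simp
      have [measurable]: "dilation s h \<in> borel_measurable borel" by (rule dilation_measurable[OF hm])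
      have "(\<integral>\<^sup>+x. ennreal (1 / s) * indicator {1..l} s * (ennreal (norm (dilation s h x)))\<^sup>2 \<partial>lborel)
        = ennreal (1 / s) * indicator {1..l} s * (\<integral>\<^sup>+x. (ennreal (norm (dilation s h x)))\<^sup>2 \<partial>lborel)"
        by (rule nn_integral_cmult) measurable
      also have "\<dots> = ennreal (1 / s) * indicator {1..l} s * ennreal (sqnorm h)"
        by (simp only: nn_integral_sqnorm[OF square_integrable_dilation(1)[OF h s]] square_integrable_dilation(2)[OF h s])
      finally show ?thesis by (simp add: ac_simps)
    qed simp
  qed
  also have "\<dots> = ennreal (sqnorm h) * ennreal (ln l)"
    by (simp add: nn_integral_cmult nn_integral_inverse_Icc[OF l])
  also have "ennreal (ln l) * (ennreal (sqnorm h) * ennreal (ln l)) = ennreal ((ln l)\<^sup>2 * sqnorm h)"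
    using l by (simp add: ennreal_mult power2_eq_square sqnorm_nonneg ac_simps)
  finally have *: "(\<integral>\<^sup>+x. (ennreal (norm (dilation_average l h x)))\<^sup>2 \<partial>lborel) \<le> ennreal ((ln l)\<^sup>2 * sqnorm h)" .
  show s: "square_integrable (dilation_average l h)"
    by (rule square_integrable_nn[OF am]) (use * in \<open>simp add: le_less_trans[OF _ ennreal_less_top]\<close>)
  show "sqnorm (dilation_average l h) \<le> (ln l)\<^sup>2 * sqnorm h"
    using * unfolding nn_integral_sqnorm[OF s] by (simp add: sqnorm_nonneg)
qed

lemma square_integrable_cnj: "square_integrable f \<Longrightarrow> square_integrable (\<lambda>x. cnj (f x))"
  unfolding square_integrable_def
  using measurable_compose[OF _ borel_measurable_continuous_onI[OF continuous_on_cnj[OF continuous_on_id]], of f]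
  by simp

lemma sqnorm_cnj: "sqnorm (\<lambda>x. cnj (f x)) = sqnorm f"
  by (simp add: sqnorm_def)

lemma sqnorm_add:
  assumes u: "square_integrable u" and v: "square_integrable v"
  shows "sqnorm (\<lambda>x. u x + v x) = sqnorm u + 2 * Re (\<integral>x. u x * cnj (v x) \<partial>lborel) + sqnorm v"
proof -
  have i: "integrable lborel (\<lambda>x. u x * cnj (v x))"
    by (intro square_integrable_mult u square_integrable_cnj v)
  define k where "k = (\<lambda>x. u x * cnj (v x))"
  have "sqnorm (\<lambda>x. u x + v x) = (\<integral>x. (norm (u x))\<^sup>2 + 2 * Re (k x) + (norm (v x))\<^sup>2 \<partial>lborel)"
    unfolding sqnorm_def k_def
    by (intro Bochner_Integration.integral_cong refl)
      (simp only: cmod_power2, simp add: power2_eq_square algebra_simps)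
  also have "\<dots> = sqnorm u + 2 * Re (\<integral>x. k x \<partial>lborel) + sqnorm v"
    unfolding sqnorm_def using u v i by (simp add: square_integrable_def flip: k_def)
  finally show ?thesis unfolding k_def .
qed

lemma integral_mult_Cauchy_Schwarz:
  assumes u: "square_integrable u" and v: "square_integrable v"
  shows "(norm (\<integral>x. u x * v x \<partial>lborel))\<^sup>2 \<le> sqnorm u * sqnorm v"
proof -
  have [measurable]: "u \<in> borel_measurable borel" "v \<in> borel_measurable borel"
    using u v by (auto simp: square_integrable_def)
  have "ennreal (norm (\<integral>x. u x * v x \<partial>lborel)) \<le> (\<integral>\<^sup>+x. ennreal (norm (u x * v x)) \<partial>lborel)"
    by (intro integral_norm_bound_ennreal square_integrable_mult u v)
  also have "\<dots> = (\<integral>\<^sup>+x. ennreal (norm (u x)) * ennreal (norm (v x)) \<partial>lborel)"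
    by (simp add: norm_mult ennreal_mult)
  finally have "(ennreal (norm (\<integral>x. u x * v x \<partial>lborel)))\<^sup>2 \<le> (\<integral>\<^sup>+x. ennreal (norm (u x)) * ennreal (norm (v x)) \<partial>lborel)\<^sup>2"
    by (intro power_mono) auto
  also have "\<dots> \<le> (\<integral>\<^sup>+x. (ennreal (norm (u x)))\<^sup>2 \<partial>lborel) * (\<integral>\<^sup>+x. (ennreal (norm (v x)))\<^sup>2 \<partial>lborel)"
    by (rule Cauchy_Schwarz_nn_integral) measurable
  also have "\<dots> = ennreal (sqnorm u * sqnorm v)"
    by (simp only: nn_integral_sqnorm[OF u] nn_integral_sqnorm[OF v] ennreal_mult[OF sqnorm_nonneg sqnorm_nonneg])
  finally show ?thesis
    by (simp add: ennreal_power sqnorm_nonneg)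
qed

lemma sqnorm_cong_AE:
  assumes "AE x in lborel. u x = v x" "square_integrable u" "square_integrable v"
  shows "sqnorm u = sqnorm v"
  unfolding sqnorm_def using assms
  by (intro integral_cong_AE) (auto simp: square_integrable_def elim!: eventually_mono)

text \<open>
  Let \<open>a = V\<^sub>l f - f\<close>. From \<open>\<parallel>f + a\<parallel> = \<parallel>f\<parallel>\<close> one gets \<open>2 Re \<langle>a, f\<rangle> = - \<parallel>a\<parallel>\<^sup>2\<close>, which is
  quadratic in \<open>ln l\<close>. On the other hand \<open>\<langle>a, f\<rangle>\<close> is the integral of \<open>\<langle>V\<^sub>s h, f\<rangle>\<close> against \<open>ds/s\<close>, which
  differs from \<open>ln l \<langle>h, f\<rangle>\<close> by another quadratic error, because \<open>\<langle>h, f\<rangle> = \<langle>V\<^sub>s h, V\<^sub>s f\<rangle>\<close> and \<open>V\<^sub>s f\<close> is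
  within \<open>ln s \<parallel>h\<parallel>\<close> of \<open>f\<close>. Dividing by \<open>ln l\<close> and letting \<open>l \<rightarrow> 1\<close> leaves \<open>Re \<langle>h, f\<rangle> = 0\<close>.
\<close>
theorem generator_antisymmetric:
  fixes f g :: "real ^ 'n \<Rightarrow> complex"
  assumes w: "weak_euler f g" and f: "square_integrable f" and g: "square_integrable g"
  defines "h \<equiv> \<lambda>x. g x + of_real (CARD('n) / 2) * f x"
  shows "Re (\<integral>x. h x * cnj (f x) \<partial>lborel) = 0"
proof -
  have h: "square_integrable h"
    unfolding h_def by (rule square_integrable_linear[OF g f])
  note cf = square_integrable_cnj[OF f]
  let ?B = "\<integral>x. h x * cnj (f x) \<partial>lborel"
  have DA: "AE x in lborel. dilation s f x - f x = dilation_average s h x" if "1 \<le> s" for s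
    unfolding h_def by (rule dilation_difference_AE[OF w f g that])
  have diff: "sqnorm (\<lambda>x. dilation s f x - f x) \<le> (ln s)\<^sup>2 * sqnorm h" if s: "1 \<le> s" for s
  proof -
    have sq: "square_integrable (\<lambda>x. dilation s f x - f x)"
      using square_integrable_linear[OF square_integrable_dilation(1)[OF f, of s] f, of "-1"] s by simp
    have "sqnorm (\<lambda>x. dilation s f x - f x) = sqnorm (dilation_average s h)"
      by (rule sqnorm_cong_AE[OF DA[OF s] sq dilation_average_square_integrable(1)[OF h s]])
    then show ?thesis using dilation_average_square_integrable(2)[OF h s] by simp
  qed
  have bound: "\<bar>Re ?B\<bar> \<le> 2 * sqnorm h * ln l" if l: "1 < l" for l
  proof -
    have l1: "1 \<le> l" and lnl: "ln l > 0" using l by auto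
    let ?a = "dilation_average l h"
    note a = dilation_average_square_integrable[OF h l1]
    have fl: "square_integrable (dilation l f)" "sqnorm (dilation l f) = sqnorm f"
      using square_integrable_dilation[OF f, of l] l by auto
    have af: "square_integrable (\<lambda>x. ?a x + f x)"
      using square_integrable_linear[OF a(1) f, of 1] by simp
    have "AE x in lborel. dilation l f x = ?a x + f x"
      using DA[OF l1] by eventually_elim (simp add: algebra_simps)
    then have "sqnorm (dilation l f) = sqnorm (\<lambda>x. ?a x + f x)"
      by (rule sqnorm_cong_AE[OF _ fl(1) af])
    also have "\<dots> = sqnorm ?a + 2 * Re (\<integral>x. ?a x * cnj (f x) \<partial>lborel) + sqnorm f"
      by (rule sqnorm_add[OF a(1) f])
    finally have "2 * Re (\<integral>x. ?a x * cnj (f x) \<partial>lborel) = - sqnorm ?a"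
      using fl by simp
    then have 1: "\<bar>Re (\<integral>x. ?a x * cnj (f x) \<partial>lborel)\<bar> \<le> (ln l)\<^sup>2 * sqnorm h"
      using a(2) sqnorm_nonneg[of ?a] by simp
    \<comment> \<open>The pairing \<open>?b s\<close> stays within \<open>ln l \<parallel>h\<parallel>\<^sup>2\<close> of its value \<open>?B\<close> at \<open>s = 1\<close>.\<close>
    let ?b = "\<lambda>s. \<integral>x. dilation s h x * cnj (f x) \<partial>lborel"
    have b: "norm (?b s - ?B) \<le> ln l * sqnorm h" if s: "s \<in> {1..l}" for s
    proof -
      have s0: "s > 0" and s1: "1 \<le> s" using s by auto
      note hs = square_integrable_dilation[OF h s0]
      have fs: "square_integrable (dilation s (\<lambda>x. cnj (f x)))"
        by (rule square_integrable_dilation(1)[OF cf s0])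
      have sq: "square_integrable (\<lambda>x. dilation s f x - f x)"
        using square_integrable_linear[OF square_integrable_dilation(1)[OF f s0] f, of "-1"] by simp
      have inv: "dilation (1 / s) (dilation s (\<lambda>x. cnj (f x))) = (\<lambda>x. cnj (f x))"
        using s0 by (auto simp: dilation_def fun_eq_iff powr_divide)
      have "(\<integral>x. dilation s h x * dilation s (\<lambda>x. cnj (f x)) x \<partial>lborel)
          = (\<integral>x. h x * dilation (1 / s) (dilation s (\<lambda>x. cnj (f x))) x \<partial>lborel)"
        by (rule integral_dilation_mult[OF square_integrable_measurable[OF h] square_integrable_measurable[OF fs] s0])
      then have "?B = (\<integral>x. dilation s h x * dilation s (\<lambda>x. cnj (f x)) x \<partial>lborel)"
        by (simp only: inv)
      then have "?B - ?b s = (\<integral>x. dilation s h x * dilation s (\<lambda>x. cnj (f x)) x \<partial>lborel) - ?b s"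
        by (rule arg_cong)
      also have "\<dots> = (\<integral>x. dilation s h x * dilation s (\<lambda>x. cnj (f x)) x - dilation s h x * cnj (f x) \<partial>lborel)"
        by (rule Bochner_Integration.integral_diff[symmetric, OF square_integrable_mult(1)[OF hs(1) fs] square_integrable_mult(1)[OF hs(1) cf]])
      also have "(\<lambda>x. dilation s h x * dilation s (\<lambda>x. cnj (f x)) x - dilation s h x * cnj (f x))
          = (\<lambda>x. dilation s h x * cnj (dilation s f x - f x))"
        by (rule ext) (simp add: dilation_def right_diff_distrib)
      finally have "?B - ?b s = (\<integral>x. dilation s h x * cnj (dilation s f x - f x) \<partial>lborel)" .
      then have "(norm (?B - ?b s))\<^sup>2 \<le> sqnorm (dilation s h) * sqnorm (\<lambda>x. cnj (dilation s f x - f x))"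
        using integral_mult_Cauchy_Schwarz[OF hs(1) square_integrable_cnj[OF sq]] by (simp only:)
      also have "\<dots> = sqnorm h * sqnorm (\<lambda>x. dilation s f x - f x)"
        by (simp only: hs(2) sqnorm_cnj)
      also have "\<dots> \<le> sqnorm h * ((ln s)\<^sup>2 * sqnorm h)"
        by (rule mult_left_mono[OF diff[OF s1] sqnorm_nonneg])
      also have "\<dots> = (ln s * sqnorm h)\<^sup>2"
        by (simp only: power2_eq_square mult_ac)
      finally have "norm (?B - ?b s) \<le> ln s * sqnorm h"
        by (rule power2_le_imp_le) (use s1 sqnorm_nonneg[of h] in simp)
      also have "\<dots> \<le> ln l * sqnorm h"
        using s sqnorm_nonneg[of h] by (intro mult_right_mono) auto
      finally show ?thesis unfolding norm_minus_commute[of ?B] .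
    qed
    have ln1: "(ln has_real_derivative 1 / s) (at s)" "0 \<le> 1 / s" if "s \<in> {1..l}" for s
      using that by (auto intro!: DERIV_ln_divide)
    have c1: "integrable lborel (\<lambda>s. indicator {1..l} s *\<^sub>R (1 / s) :: real)"
       "(\<integral>s. indicator {1..l} s *\<^sub>R (1 / s) \<partial>lborel) = ln l"
      using integrable_FTC_Icc_nonneg[OF _ ln1 l1] integral_FTC_Icc_nonneg[OF _ ln1 l1]
      by (simp_all add: mult.commute)
    have ib: "integrable lborel (\<lambda>s. indicator {1..l} s *\<^sub>R (1 / s) *\<^sub>R ?b s)"
      using lborel_pair.integrable_fst[OF dilation_pair_integrable[OF h cf l1, of "\<lambda>s. s"]] by simp
    have iB: "integrable lborel (\<lambda>s. (indicator {1..l} s *\<^sub>R (1 / s)) *\<^sub>R ?B)"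
      using c1 by (intro integrable_scaleR_left) auto
    have "(\<integral>x. ?a x * cnj (f x) \<partial>lborel) - ln l *\<^sub>R ?B
       = (\<integral>s. indicator {1..l} s *\<^sub>R (1 / s) *\<^sub>R ?b s \<partial>lborel) - (\<integral>s. (indicator {1..l} s *\<^sub>R (1 / s)) *\<^sub>R ?B \<partial>lborel)"
      using dilation_average_integral(2)[OF h cf l1] c1 by (simp only: integral_scaleR_left)
    also have "\<dots> = (\<integral>s. indicator {1..l} s *\<^sub>R (1 / s) *\<^sub>R ?b s - (indicator {1..l} s *\<^sub>R (1 / s)) *\<^sub>R ?B \<partial>lborel)"
      using ib iB by (simp only: Bochner_Integration.integral_diff)
    finally have "norm ((\<integral>x. ?a x * cnj (f x) \<partial>lborel) - ln l *\<^sub>R ?B)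
       \<le> (\<integral>s. norm (indicator {1..l} s *\<^sub>R (1 / s) *\<^sub>R ?b s - (indicator {1..l} s *\<^sub>R (1 / s)) *\<^sub>R ?B) \<partial>lborel)"
      by (simp only: integral_norm_bound)
    also have "\<dots> \<le> (\<integral>s. (indicator {1..l} s *\<^sub>R (1 / s)) * (ln l * sqnorm h) \<partial>lborel)"
    proof (rule integral_mono)
      show "integrable lborel (\<lambda>s. norm (indicator {1..l} s *\<^sub>R (1 / s) *\<^sub>R ?b s - (indicator {1..l} s *\<^sub>R (1 / s)) *\<^sub>R ?B))"
        using ib iB by (intro integrable_norm Bochner_Integration.integrable_diff)
      show "integrable lborel (\<lambda>s. (indicator {1..l} s *\<^sub>R (1 / s)) * (ln l * sqnorm h))"
        using c1 by (intro integrable_mult_left) auto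
      fix s :: real
      show "norm (indicator {1..l} s *\<^sub>R (1 / s) *\<^sub>R ?b s - (indicator {1..l} s *\<^sub>R (1 / s)) *\<^sub>R ?B)
         \<le> (indicator {1..l} s *\<^sub>R (1 / s)) * (ln l * sqnorm h)"
      proof (cases "s \<in> {1..l}")
        case True
        then have "norm (indicator {1..l} s *\<^sub>R (1 / s) *\<^sub>R ?b s - (indicator {1..l} s *\<^sub>R (1 / s)) *\<^sub>R ?B)
            = norm ((1 / s) *\<^sub>R (?b s - ?B))"
          by (simp add: scaleR_diff_right)
        also have "\<dots> = (1 / s) * norm (?b s - ?B)"
          using True by simp
        also have "\<dots> \<le> (1 / s) * (ln l * sqnorm h)"
          using True by (intro mult_left_mono b) auto
        finally show ?thesis using True by simp
      qed simp
    qed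
    also have "\<dots> = ln l * (ln l * sqnorm h)"
      using c1 by (simp only: integral_mult_left_zero)
    finally have "\<bar>Re ((\<integral>x. ?a x * cnj (f x) \<partial>lborel) - ln l *\<^sub>R ?B)\<bar> \<le> ln l * (ln l * sqnorm h)"
      by (rule order.trans[OF abs_Re_le_cmod])
    then have "\<bar>Re (\<integral>x. ?a x * cnj (f x) \<partial>lborel) - ln l * Re ?B\<bar> \<le> (ln l)\<^sup>2 * sqnorm h"
      by (simp add: power2_eq_square)
    with 1 have "\<bar>ln l * Re ?B\<bar> \<le> 2 * ((ln l)\<^sup>2 * sqnorm h)"
      by linarith
    then have "ln l * \<bar>Re ?B\<bar> \<le> ln l * (2 * sqnorm h * ln l)"
      using lnl by (simp add: abs_mult power2_eq_square ac_simps)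
    then show ?thesis using lnl by simp
  qed
  have "\<bar>Re ?B\<bar> \<le> 0"
  proof (rule field_le_epsilon)
    fix e :: real assume e: "e > 0"
    define d where "d = e / (2 * sqnorm h + 1)"
    have d: "d > 0" using e sqnorm_nonneg[of h] by (simp add: d_def)
    have "\<bar>Re ?B\<bar> \<le> 2 * sqnorm h * d"
      using bound[of "exp d"] d by simp
    also have "\<dots> \<le> (2 * sqnorm h + 1) * d" using d by (simp add: algebra_simps)
    also have "\<dots> = e" using sqnorm_nonneg[of h] by (simp add: d_def)
    finally show "\<bar>Re ?B\<bar> \<le> 0 + e" by simp
  qed
  then show ?thesis by simp
qed

text \<open>Expand \<open>\<parallel>h - (n/2) f\<parallel>\<^sup>2\<close>; the cross term vanishes.\<close>
corollary sqnorm_euler: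
  fixes f g :: "real ^ 'n \<Rightarrow> complex"
  assumes w: "weak_euler f g" and f: "square_integrable f" and g: "square_integrable g"
  defines "h \<equiv> \<lambda>x. g x + of_real (CARD('n) / 2) * f x"
  shows "sqnorm g - (real CARD('n))\<^sup>2 / 4 * sqnorm f = sqnorm h"
proof -
  let ?c = "CARD('n) / 2"
  have h: "square_integrable h"
    unfolding h_def by (rule square_integrable_linear[OF g f])
  have cf: "square_integrable (\<lambda>x. - of_real ?c * f x)"
    using square_integrable_linear[OF f f, of "- of_real ?c - 1"] by (simp add: algebra_simps)
  have "sqnorm g = sqnorm (\<lambda>x. h x + (- of_real ?c * f x))"
    by (simp add: h_def)
  also have "\<dots> = sqnorm h + 2 * Re (\<integral>x. h x * cnj (- of_real ?c * f x) \<partial>lborel) + sqnorm (\<lambda>x. - of_real ?c * f x)"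
    by (rule sqnorm_add[OF h cf])
  also have "(\<lambda>x. h x * cnj (- of_real ?c * f x)) = (\<lambda>x. complex_of_real (- ?c) * (h x * cnj (f x)))"
    by (simp add: fun_eq_iff)
  also have "Re (\<integral>x. complex_of_real (- ?c) * (h x * cnj (f x)) \<partial>lborel) = - ?c * Re (\<integral>x. h x * cnj (f x) \<partial>lborel)"
    unfolding integral_mult_right_zero by simp
  also have "Re (\<integral>x. h x * cnj (f x) \<partial>lborel) = 0"
    unfolding h_def by (rule generator_antisymmetric[OF w f g])
  also have "sqnorm (\<lambda>x. - of_real ?c * f x) = ?c\<^sup>2 * sqnorm f"
  proof -
    have "(norm (- of_real ?c * f x))\<^sup>2 = ?c\<^sup>2 * (norm (f x))\<^sup>2" for x
      by (simp add: norm_mult power_mult_distrib[symmetric])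
    then show ?thesis
      unfolding sqnorm_def by (simp only: integral_mult_right_zero)
  qed
  finally show ?thesis by (simp add: power_divide)
qed

section \<open>Spherical means\<close>
lemma measure_sphere_measure_eq:
  "measure (sphere_measure :: (real ^ 'n) measure) (sphere 0 1) = measure (cone_measure :: (real ^ 'n) measure) (sphere 0 1)"
proof -
  have "sphere 0 1 \<in> sets (cone_measure :: (real ^ 'n) measure)"
    using sets.top[of "cone_measure :: (real ^ 'n) measure"] by (simp only: space_cone_measure)
  then show ?thesis
    by (simp add: sphere_measure_eq measure_def main_part_sets emeasure_completion)
qed

lemma cone_measurable_scale:
  assumes f: "f \<in> borel_measurable borel"
  shows "(\<lambda>\<omega>. f (r *\<^sub>R \<omega>)) \<in> borel_measurable cone_measure"
proof -
  have "(\<lambda>\<omega>. f (r *\<^sub>R \<omega>)) \<in> borel_measurable borel"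
    using f by measurable
  from measurable_compose[OF measurable_cone_ident this] show ?thesis by simp
qed

lemma cone_joint_measurable:
  assumes f: "f \<in> borel_measurable borel"
  shows "(\<lambda>(r, \<omega>). f (r *\<^sub>R \<omega>)) \<in> borel_measurable (borel \<Otimes>\<^sub>M cone_measure)"
proof -
  have 1: "(\<lambda>(r, \<omega>). f (r *\<^sub>R \<omega>)) \<in> borel_measurable (borel \<Otimes>\<^sub>M borel)"
    using f by measurable
  have 2: "(\<lambda>p. (fst p, snd p)) \<in> borel \<Otimes>\<^sub>M cone_measure \<rightarrow>\<^sub>M borel \<Otimes>\<^sub>M borel"
    by (intro measurable_Pair measurable_fst measurable_compose[OF measurable_snd measurable_cone_ident])
  from measurable_compose[OF 2 1] show ?thesis by (simp add: case_prod_beta')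
qed

lemma spherical_mean_borel:
  fixes f :: "real ^ 'n \<Rightarrow> complex"
  assumes f: "f \<in> borel_measurable borel"
  shows "spherical_mean f r = (\<integral>\<omega>. f (r *\<^sub>R \<omega>) \<partial>cone_measure) /\<^sub>R measure (cone_measure :: (real ^ 'n) measure) (sphere 0 1)"
  unfolding spherical_mean_def measure_sphere_measure_eq
  by (simp add: sphere_measure_eq integral_completion[OF cone_measurable_scale[OF f]])

lemma spherical_mean_measurable:
  fixes f :: "real ^ 'n \<Rightarrow> complex"
  assumes f: "f \<in> borel_measurable borel"
  shows "spherical_mean f \<in> borel_measurable borel"
proof -
  interpret C: sigma_finite_measure "cone_measure :: (real ^ 'n) measure"
    by (rule sigma_finite_cone_measure)
  have "(\<lambda>r. \<integral>\<omega>. f (r *\<^sub>R \<omega>) \<partial>cone_measure) \<in> borel_measurable borel"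
    by (rule C.borel_measurable_lebesgue_integral[OF cone_joint_measurable[OF f]])
  then show ?thesis
    unfolding spherical_mean_borel[OF f, abs_def] by simp
qed

definition sphere_energy :: "(real ^ 'n \<Rightarrow> complex) \<Rightarrow> real \<Rightarrow> ennreal" where
  "sphere_energy f r = (\<integral>\<^sup>+\<omega>. (ennreal (norm (f (r *\<^sub>R \<omega>))))\<^sup>2 \<partial>cone_measure)"

lemma sphere_energy_measurable:
  fixes f :: "real ^ 'n \<Rightarrow> complex"
  assumes f: "f \<in> borel_measurable borel"
  shows "sphere_energy f \<in> borel_measurable borel"
proof -
  interpret C: sigma_finite_measure "cone_measure :: (real ^ 'n) measure"
    by (rule sigma_finite_cone_measure)
  have "(\<lambda>p. (ennreal (norm ((\<lambda>(r, \<omega>). f (r *\<^sub>R \<omega>)) p)))\<^sup>2) \<in> borel_measurable (borel \<Otimes>\<^sub>M cone_measure)"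
    using cone_joint_measurable[OF f] by measurable
  then have "(\<lambda>(r, \<omega>). (ennreal (norm (f (r *\<^sub>R \<omega>))))\<^sup>2) \<in> borel_measurable (borel \<Otimes>\<^sub>M cone_measure)"
    by (simp add: case_prod_beta')
  from C.borel_measurable_nn_integral[OF this] show ?thesis
    by (simp only: sphere_energy_def[abs_def])
qed

lemma nn_integral_sphere_energy:
  fixes f :: "real ^ 'n \<Rightarrow> complex"
  assumes f: "square_integrable f"
  shows "(\<integral>\<^sup>+r. sphere_energy f r * ennreal (r ^ (CARD('n) - 1)) * indicator {0<..} r \<partial>lborel) = ennreal (sqnorm f)"
proof -
  have [measurable]: "f \<in> borel_measurable borel" using f by (simp add: square_integrable_def)
  have "(\<lambda>x. (ennreal (norm (f x)))\<^sup>2) \<in> borel_measurable borel" by measurable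
  from nn_integral_polar[OF this] show ?thesis
    by (simp only: nn_integral_sqnorm[OF f] sphere_energy_def)
qed

lemma AE_sphere_energy_finite:
  fixes f :: "real ^ 'n \<Rightarrow> complex"
  assumes f: "square_integrable f"
  shows "AE r in lborel. r > 0 \<longrightarrow> sphere_energy f r < \<infinity>"
proof -
  have [measurable]: "sphere_energy f \<in> borel_measurable borel"
    by (rule sphere_energy_measurable[OF square_integrable_measurable[OF f]])
  have "AE r in lborel. sphere_energy f r * ennreal (r ^ (CARD('n) - 1)) * indicator {0<..} r \<noteq> \<infinity>"
    by (rule nn_integral_PInf_AE) (measurable, simp only: nn_integral_sphere_energy[OF f], simp)
  then show ?thesis
  proof eventually_elim
    case (elim r)
    show ?case
    proof
      assume r: "r > 0"
      then have "ennreal (r ^ (CARD('n) - 1)) \<noteq> 0" by simp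
      with elim r show "sphere_energy f r < \<infinity>"
        by (auto simp: less_top ennreal_mult_eq_top_iff)
    qed
  qed
qed

text \<open>A null set meets almost every sphere in a null set: integrate its indicator in polar coordinates.\<close>
lemma AE_polar:
  fixes P :: "real ^ 'n \<Rightarrow> bool"
  assumes "AE x in lborel. P x"
  shows "AE r in lborel. r > 0 \<longrightarrow> (AE \<omega> in cone_measure. P (r *\<^sub>R \<omega>))"
proof -
  interpret C: sigma_finite_measure "cone_measure :: (real ^ 'n) measure"
    by (rule sigma_finite_cone_measure)
  obtain N where N: "{x. \<not> P x} \<subseteq> N" "N \<in> null_sets lborel"
    using assms by (auto simp: eventually_ae_filter)
  then have Nm [measurable]: "N \<in> sets borel" by auto
  have im: "(indicator N :: _ \<Rightarrow> ennreal) \<in> borel_measurable borel" by measurable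
  let ?J = "\<lambda>r. \<integral>\<^sup>+\<omega>. indicator N (r *\<^sub>R \<omega>) \<partial>(cone_measure :: (real ^ 'n) measure)"
  have [measurable]: "?J \<in> borel_measurable borel"
    by (rule C.borel_measurable_nn_integral[OF cone_joint_measurable[OF im]])
  have "(\<integral>\<^sup>+x. indicator N x \<partial>lborel) = (0 :: ennreal)"
    using N by (simp add: null_setsD1)
  then have "(\<integral>\<^sup>+r. ?J r * ennreal (r ^ (CARD('n) - 1)) * indicator {0<..} r \<partial>lborel) = 0"
    by (simp only: nn_integral_polar[OF im])
  then have "AE r in lborel. ?J r * ennreal (r ^ (CARD('n) - 1)) * indicator {0<..} r = 0"
    by (subst (asm) nn_integral_0_iff_AE) auto
  then show ?thesis
  proof eventually_elim
    case (elim r)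
    show ?case
    proof
      assume r: "r > 0"
      then have "ennreal (r ^ (CARD('n) - 1)) \<noteq> 0" by simp
      with elim r have "?J r = 0" by auto
      then have "AE \<omega> in cone_measure. indicator N (r *\<^sub>R \<omega> :: real ^ 'n) = (0 :: ennreal)"
        by (subst (asm) nn_integral_0_iff_AE) (auto intro: cone_measurable_scale[OF im])
      then show "AE \<omega> in cone_measure. P (r *\<^sub>R \<omega>)"
        by eventually_elim (use N in \<open>auto simp: indicator_def split: if_splits\<close>)
    qed
  qed
qed

lemma cone_integral_square_le:
  fixes k :: "real ^ 'n \<Rightarrow> complex"
  assumes [measurable]: "k \<in> borel_measurable cone_measure"
  shows "(ennreal (norm (\<integral>\<omega>. k \<omega> \<partial>cone_measure)))\<^sup>2
    \<le> ennreal (measure (cone_measure :: (real ^ 'n) measure) (sphere 0 1)) * (\<integral>\<^sup>+\<omega>. (ennreal (norm (k \<omega>)))\<^sup>2 \<partial>cone_measure)"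
proof -
  interpret C: finite_measure "cone_measure :: (real ^ 'n) measure"
    by (rule finite_cone_measure)
  have "ennreal (norm (\<integral>\<omega>. k \<omega> \<partial>cone_measure)) \<le> (\<integral>\<^sup>+\<omega>. ennreal (norm (k \<omega>)) \<partial>cone_measure)"
  proof (cases "integrable cone_measure k")
    case True
    then show ?thesis by (rule integral_norm_bound_ennreal)
  qed (simp add: not_integrable_integral_eq)
  also have "\<dots> = (\<integral>\<^sup>+\<omega>. 1 * ennreal (norm (k \<omega>)) \<partial>cone_measure)" by simp
  finally have "(ennreal (norm (\<integral>\<omega>. k \<omega> \<partial>cone_measure)))\<^sup>2 \<le> (\<integral>\<^sup>+\<omega>. 1 * ennreal (norm (k \<omega>)) \<partial>cone_measure)\<^sup>2"
    by (intro power_mono) auto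
  also have "\<dots> \<le> (\<integral>\<^sup>+\<omega>. 1\<^sup>2 \<partial>(cone_measure :: (real ^ 'n) measure)) * (\<integral>\<^sup>+\<omega>. (ennreal (norm (k \<omega>)))\<^sup>2 \<partial>cone_measure)"
    by (rule Cauchy_Schwarz_nn_integral) measurable
  also have "(\<integral>\<^sup>+\<omega>. 1\<^sup>2 \<partial>(cone_measure :: (real ^ 'n) measure)) = ennreal (measure (cone_measure :: (real ^ 'n) measure) (sphere 0 1))"
    by (simp add: space_cone_measure C.emeasure_eq_measure)
  finally show ?thesis .
qed

lemma spherical_mean_square_le:
  fixes f :: "real ^ 'n \<Rightarrow> complex"
  assumes f: "f \<in> borel_measurable borel"
  shows "(ennreal (norm (spherical_mean f r)))\<^sup>2
    \<le> ennreal (1 / measure (cone_measure :: (real ^ 'n) measure) (sphere 0 1)) * sphere_energy f r"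
proof -
  let ?m = "measure (cone_measure :: (real ^ 'n) measure) (sphere 0 1)"
  have m: "?m > 0" by (rule measure_cone_pos)
  have "norm (spherical_mean f r) = norm (\<integral>\<omega>. f (r *\<^sub>R \<omega>) \<partial>cone_measure) * (1 / ?m)"
    using m by (simp add: spherical_mean_borel[OF f] divide_inverse)
  then have "(ennreal (norm (spherical_mean f r)))\<^sup>2
      = (ennreal (norm (\<integral>\<omega>. f (r *\<^sub>R \<omega>) \<partial>cone_measure)))\<^sup>2 * (ennreal (1 / ?m))\<^sup>2"
    using m by (simp only: ennreal_mult[OF norm_ge_zero] less_imp_le zero_le_divide_1_iff power_mult_distrib)
  also have "\<dots> \<le> (ennreal ?m * sphere_energy f r) * (ennreal (1 / ?m))\<^sup>2"
    unfolding sphere_energy_def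
    by (intro mult_right_mono cone_integral_square_le cone_measurable_scale f) auto
  also have "\<dots> = (ennreal ?m * (ennreal (1 / ?m))\<^sup>2) * sphere_energy f r"
    by (simp only: ac_simps)
  also have "ennreal ?m * (ennreal (1 / ?m))\<^sup>2 = ennreal (1 / ?m)"
    using m by (subst ennreal_power, simp, subst ennreal_mult[symmetric]) (auto simp: power2_eq_square)
  finally show ?thesis .
qed

text \<open>The normalisation \<open>u(r) = r\<^sup>n\<^sup>/\<^sup>2 F(r)\<close> intertwines the dilations of \<open>f\<close> with plain dilations
  \<open>r \<mapsto> l r\<close> of \<open>u\<close> and turns the weight \<open>r\<^sup>n\<^sup>-\<^sup>1 dr\<close> into the invariant measure \<open>dr/r\<close>.\<close>
definition log_profile :: "(real ^ 'n \<Rightarrow> complex) \<Rightarrow> real \<Rightarrow> complex" where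
  "log_profile f r = r powr (CARD('n) / 2) *\<^sub>R spherical_mean f r"

lemma log_profile_measurable:
  fixes f :: "real ^ 'n \<Rightarrow> complex"
  assumes f: "f \<in> borel_measurable borel"
  shows "log_profile f \<in> borel_measurable borel"
proof -
  have [measurable]: "spherical_mean f \<in> borel_measurable borel"
    by (rule spherical_mean_measurable[OF f])
  show ?thesis unfolding log_profile_def[abs_def] by measurable
qed

lemma log_profile_square_le:
  fixes f :: "real ^ 'n \<Rightarrow> complex"
  assumes f: "f \<in> borel_measurable borel" and r: "r > 0"
  shows "(ennreal (norm (log_profile f r)))\<^sup>2
    \<le> ennreal (1 / measure (cone_measure :: (real ^ 'n) measure) (sphere 0 1)) * (ennreal (r ^ CARD('n)) * sphere_energy f r)"
proof -
  have "(ennreal (norm (log_profile f r)))\<^sup>2 = (ennreal (r powr (CARD('n) / 2)))\<^sup>2 * (ennreal (norm (spherical_mean f r)))\<^sup>2"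
    unfolding power_mult_distrib[symmetric] using r
    by (simp add: log_profile_def ennreal_mult)
  also have "(ennreal (r powr (CARD('n) / 2)))\<^sup>2 = ennreal (r ^ CARD('n))"
    using r by (simp add: ennreal_power powr_half_square)
  also have "ennreal (r ^ CARD('n)) * (ennreal (norm (spherical_mean f r)))\<^sup>2
     \<le> ennreal (r ^ CARD('n)) * (ennreal (1 / measure (cone_measure :: (real ^ 'n) measure) (sphere 0 1)) * sphere_energy f r)"
    by (intro mult_left_mono spherical_mean_square_le f) simp
  finally show ?thesis by (simp only: ac_simps)
qed

lemma log_profile_energy:
  fixes f :: "real ^ 'n \<Rightarrow> complex"
  assumes f: "square_integrable f"
  shows "(\<integral>\<^sup>+r. (ennreal (norm (log_profile f r)))\<^sup>2 * ennreal (1 / r) * indicator {0<..} r \<partial>lborel)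
    \<le> ennreal (sqnorm f / measure (cone_measure :: (real ^ 'n) measure) (sphere 0 1))"
proof -
  let ?m = "measure (cone_measure :: (real ^ 'n) measure) (sphere 0 1)"
  have fm: "f \<in> borel_measurable borel" by (rule square_integrable_measurable[OF f])
  have [measurable]: "sphere_energy f \<in> borel_measurable borel"
    by (rule sphere_energy_measurable[OF fm])
  have "(\<integral>\<^sup>+r. (ennreal (norm (log_profile f r)))\<^sup>2 * ennreal (1 / r) * indicator {0<..} r \<partial>lborel)
    \<le> (\<integral>\<^sup>+r. ennreal (1 / ?m) * (sphere_energy f r * ennreal (r ^ (CARD('n) - 1)) * indicator {0<..} r) \<partial>lborel)"
  proof (rule nn_integral_mono)
    fix r :: real
    show "(ennreal (norm (log_profile f r)))\<^sup>2 * ennreal (1 / r) * indicator {0<..} r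
      \<le> ennreal (1 / ?m) * (sphere_energy f r * ennreal (r ^ (CARD('n) - 1)) * indicator {0<..} r)"
    proof (cases "r > 0")
      case True
      have "r ^ CARD('n) * (1 / r) = r ^ (CARD('n) - 1)"
        using True by (cases "CARD('n)") auto
      then have e: "ennreal (r ^ CARD('n)) * ennreal (1 / r) = ennreal (r ^ (CARD('n) - 1))"
        using True by (subst ennreal_mult[symmetric]) auto
      have "(ennreal (norm (log_profile f r)))\<^sup>2 * ennreal (1 / r)
        \<le> ennreal (1 / ?m) * (ennreal (r ^ CARD('n)) * sphere_energy f r) * ennreal (1 / r)"
        by (intro mult_right_mono log_profile_square_le fm True) simp
      also have "\<dots> = ennreal (1 / ?m) * (sphere_energy f r * (ennreal (r ^ CARD('n)) * ennreal (1 / r)))"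
        by (simp only: ac_simps)
      finally show ?thesis unfolding e using True by simp
    qed simp
  qed
  also have "\<dots> = ennreal (1 / ?m) * ennreal (sqnorm f)"
    unfolding nn_integral_sphere_energy[OF f, symmetric] by (rule nn_integral_cmult) measurable
  also have "\<dots> = ennreal (sqnorm f / ?m)"
    using measure_cone_pos[where 'n='n] by (subst ennreal_mult[symmetric]) (auto simp: sqnorm_nonneg)
  finally show ?thesis .
qed

text \<open>
  For fixed \<open>r\<close> the averages over \<open>s\<close> and \<open>\<omega>\<close> combine, through \<open>\<rho> = s r\<close>, into the polar integral of
  \<open>|h|\<^sup>2\<close> over a spherical shell. This is what makes a pointwise bound in \<open>r\<close> possible although \<open>h\<close> is
  only square integrable.
\<close>
lemma sphere_energy_dilation_average:
  fixes h :: "real ^ 'n \<Rightarrow> complex"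
  assumes h: "square_integrable h" and l: "1 \<le> l" and r: "r > 0"
  shows "ennreal (r ^ CARD('n)) * sphere_energy (dilation_average l h) r \<le> ennreal (ln l * sqnorm h)"
proof -
  interpret C: sigma_finite_measure "cone_measure :: (real ^ 'n) measure"
    by (rule sigma_finite_cone_measure)
  interpret P: pair_sigma_finite "lborel :: real measure" "cone_measure :: (real ^ 'n) measure" ..
  have hm: "h \<in> borel_measurable borel" by (rule square_integrable_measurable[OF h])
  have [measurable]: "sphere_energy h \<in> borel_measurable borel"
    by (rule sphere_energy_measurable[OF hm])
  define k where "k = (\<lambda>s \<omega>. ennreal (1 / s) * indicator {1..l} s * (ennreal (norm (dilation s h (r *\<^sub>R \<omega> :: real ^ 'n))))\<^sup>2)"
  have km: "case_prod k \<in> borel_measurable (lborel \<Otimes>\<^sub>M cone_measure)"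
  proof -
    have hm' [measurable]: "h \<in> borel_measurable borel" by (rule hm)
    have 1: "case_prod k \<in> borel_measurable (borel \<Otimes>\<^sub>M borel)"
      unfolding k_def dilation_def by measurable
    have 2: "(\<lambda>p. (fst p, snd p)) \<in> lborel \<Otimes>\<^sub>M cone_measure \<rightarrow>\<^sub>M borel \<Otimes>\<^sub>M borel"
      by (intro measurable_Pair measurable_compose[OF measurable_fst]
          measurable_compose[OF measurable_snd measurable_cone_ident]) simp
    from measurable_compose[OF 2 1] show ?thesis by simp
  qed
  have "sphere_energy (dilation_average l h) r \<le> (\<integral>\<^sup>+\<omega>. ennreal (ln l) * (\<integral>\<^sup>+s. k s \<omega> \<partial>lborel) \<partial>cone_measure)"
    unfolding sphere_energy_def k_def by (intro nn_integral_mono dilation_average_square_le hm l)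
  also have "\<dots> = ennreal (ln l) * (\<integral>\<^sup>+\<omega>. (\<integral>\<^sup>+s. k s \<omega> \<partial>lborel) \<partial>cone_measure)"
  proof (rule nn_integral_cmult)
    have "(\<lambda>(\<omega>, s). k s \<omega>) \<in> borel_measurable (cone_measure \<Otimes>\<^sub>M lborel)"
      using measurable_pair_swap[OF km] by (simp add: case_prod_beta')
    then show "(\<lambda>\<omega>. \<integral>\<^sup>+s. k s \<omega> \<partial>lborel) \<in> borel_measurable cone_measure"
      by (rule lborel.borel_measurable_nn_integral)
  qed
  also have "(\<integral>\<^sup>+\<omega>. (\<integral>\<^sup>+s. k s \<omega> \<partial>lborel) \<partial>cone_measure) = (\<integral>\<^sup>+s. (\<integral>\<^sup>+\<omega>. k s \<omega> \<partial>cone_measure) \<partial>lborel)"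
    by (rule P.Fubini'[OF km])
  also have "\<dots> = (\<integral>\<^sup>+s. ennreal (s ^ (CARD('n) - 1)) * indicator {1..l} s * sphere_energy h (s * r) \<partial>lborel)"
  proof (rule nn_integral_cong)
    fix s :: real
    show "(\<integral>\<^sup>+\<omega>. k s \<omega> \<partial>cone_measure) = ennreal (s ^ (CARD('n) - 1)) * indicator {1..l} s * sphere_energy h (s * r)"
    proof (cases "s \<in> {1..l}")
      case True
      then have s: "s > 0" by simp
      have "1 / s * s ^ CARD('n) = s ^ (CARD('n) - 1)"
        using s by (cases "CARD('n)") auto
      then have e: "ennreal (1 / s) * ennreal (s ^ CARD('n)) = ennreal (s ^ (CARD('n) - 1))"
        using s by (subst ennreal_mult[symmetric]) auto
      have "k s \<omega> = ennreal (s ^ (CARD('n) - 1)) * (ennreal (norm (h ((s * r) *\<^sub>R \<omega>))))\<^sup>2" for \<omega>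
      proof -
        have "(ennreal (norm (dilation s h (r *\<^sub>R \<omega>))))\<^sup>2
            = (ennreal (s powr (CARD('n) / 2)))\<^sup>2 * (ennreal (norm (h ((s * r) *\<^sub>R \<omega>))))\<^sup>2"
          unfolding power_mult_distrib[symmetric] using s by (simp add: dilation_def ennreal_mult)
        also have "(ennreal (s powr (CARD('n) / 2)))\<^sup>2 = ennreal (s ^ CARD('n))"
          using s by (simp add: ennreal_power powr_half_square)
        finally show ?thesis
          using True unfolding k_def e[symmetric] by (simp add: mult.assoc)
      qed
      then have "(\<integral>\<^sup>+\<omega>. k s \<omega> \<partial>cone_measure)
        = (\<integral>\<^sup>+\<omega>. ennreal (s ^ (CARD('n) - 1)) * (ennreal (norm (h ((s * r) *\<^sub>R \<omega>))))\<^sup>2 \<partial>cone_measure)"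
        by (simp only:)
      also have "\<dots> = ennreal (s ^ (CARD('n) - 1)) * sphere_energy h (s * r)"
        unfolding sphere_energy_def
      proof (rule nn_integral_cmult)
        have [measurable]: "(\<lambda>\<omega>. h ((s * r) *\<^sub>R \<omega>)) \<in> borel_measurable cone_measure"
          by (rule cone_measurable_scale[OF hm])
        show "(\<lambda>\<omega>. (ennreal (norm (h ((s * r) *\<^sub>R \<omega>))))\<^sup>2) \<in> borel_measurable cone_measure"
          by measurable
      qed
      finally show ?thesis using True by simp
    qed (simp add: k_def)
  qed
  finally have "ennreal (r ^ CARD('n)) * sphere_energy (dilation_average l h) r
    \<le> ennreal (r ^ CARD('n)) * (ennreal (ln l) * (\<integral>\<^sup>+s. ennreal (s ^ (CARD('n) - 1)) * indicator {1..l} s * sphere_energy h (s * r) \<partial>lborel))"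
    by (rule mult_left_mono) simp
  also have "\<dots> = ennreal (ln l) * (ennreal r * (\<integral>\<^sup>+s. ennreal (r ^ (CARD('n) - 1)) * (ennreal (s ^ (CARD('n) - 1)) * indicator {1..l} s * sphere_energy h (s * r)) \<partial>lborel))"
  proof -
    have "r ^ CARD('n) = r * r ^ (CARD('n) - 1)" by (cases "CARD('n)") auto
    then have "ennreal (r ^ CARD('n)) = ennreal r * ennreal (r ^ (CARD('n) - 1))"
      using r by (simp add: ennreal_mult)
    moreover have "(\<integral>\<^sup>+s. ennreal (r ^ (CARD('n) - 1)) * (ennreal (s ^ (CARD('n) - 1)) * indicator {1..l} s * sphere_energy h (s * r)) \<partial>lborel)
      = ennreal (r ^ (CARD('n) - 1)) * (\<integral>\<^sup>+s. ennreal (s ^ (CARD('n) - 1)) * indicator {1..l} s * sphere_energy h (s * r) \<partial>lborel)"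
      by (rule nn_integral_cmult) measurable
    ultimately show ?thesis by (simp only: ac_simps)
  qed
  also have "\<dots> \<le> ennreal (ln l) * (ennreal r * (\<integral>\<^sup>+s. sphere_energy h (0 + r * s) * ennreal ((0 + r * s) ^ (CARD('n) - 1)) * indicator {0<..} (0 + r * s) \<partial>lborel))"
  proof (intro mult_left_mono nn_integral_mono)
    fix s :: real
    have "ennreal (r ^ (CARD('n) - 1)) * ennreal (s ^ (CARD('n) - 1)) = ennreal ((r * s) ^ (CARD('n) - 1))" if "s \<ge> 1"
      using that r by (subst ennreal_mult[symmetric]) (auto simp: power_mult_distrib)
    then show "ennreal (r ^ (CARD('n) - 1)) * (ennreal (s ^ (CARD('n) - 1)) * indicator {1..l} s * sphere_energy h (s * r))
      \<le> sphere_energy h (0 + r * s) * ennreal ((0 + r * s) ^ (CARD('n) - 1)) * indicator {0<..} (0 + r * s)"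
      using r by (cases "s \<in> {1..l}") (auto simp: ac_simps)
  qed auto
  also have "ennreal r * (\<integral>\<^sup>+s. sphere_energy h (0 + r * s) * ennreal ((0 + r * s) ^ (CARD('n) - 1)) * indicator {0<..} (0 + r * s) \<partial>lborel)
     = (\<integral>\<^sup>+\<rho>. sphere_energy h \<rho> * ennreal (\<rho> ^ (CARD('n) - 1)) * indicator {0<..} \<rho> \<partial>lborel)"
    using nn_integral_real_affine[of "\<lambda>\<rho>. sphere_energy h \<rho> * ennreal (\<rho> ^ (CARD('n) - 1)) * indicator {0<..} \<rho>" r 0] r
    by simp
  also have "\<dots> = ennreal (sqnorm h)" by (rule nn_integral_sphere_energy[OF h])
  also have "ennreal (ln l) * ennreal (sqnorm h) = ennreal (ln l * sqnorm h)"
    using l by (simp add: ennreal_mult sqnorm_nonneg)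
  finally show ?thesis .
qed

lemma cone_integrable_of_energy:
  fixes f :: "real ^ 'n \<Rightarrow> complex"
  assumes f: "f \<in> borel_measurable borel" and fin: "sphere_energy f r < \<infinity>"
  shows "integrable cone_measure (\<lambda>\<omega>. f (r *\<^sub>R \<omega>))"
proof -
  interpret C: finite_measure "cone_measure :: (real ^ 'n) measure"
    by (rule finite_cone_measure)
  have m [measurable]: "(\<lambda>\<omega>. f (r *\<^sub>R \<omega>)) \<in> borel_measurable cone_measure"
    by (rule cone_measurable_scale[OF f])
  have i: "integrable cone_measure (\<lambda>\<omega>. (norm (f (r *\<^sub>R \<omega>)))\<^sup>2)"
  proof (rule integrableI_bounded)
    have "(\<integral>\<^sup>+\<omega>. ennreal (norm ((norm (f (r *\<^sub>R \<omega>)))\<^sup>2)) \<partial>cone_measure) = sphere_energy f r"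
      unfolding sphere_energy_def by (simp add: ennreal_power)
    then show "(\<integral>\<^sup>+\<omega>. ennreal (norm ((norm (f (r *\<^sub>R \<omega>)))\<^sup>2)) \<partial>cone_measure) < \<infinity>"
      using fin by simp
  qed measurable
  then have "integrable cone_measure (\<lambda>\<omega>. (1\<^sup>2 + (norm (f (r *\<^sub>R \<omega>)))\<^sup>2) / 2)"
    by simp
  then show ?thesis
  proof (rule Bochner_Integration.integrable_bound)
    show "AE \<omega> in cone_measure. norm (f (r *\<^sub>R \<omega>)) \<le> norm ((1\<^sup>2 + (norm (f (r *\<^sub>R \<omega>)))\<^sup>2) / 2)"
    proof (rule AE_I2)
      fix \<omega> :: "real ^ 'n"
      show "norm (f (r *\<^sub>R \<omega>)) \<le> norm ((1\<^sup>2 + (norm (f (r *\<^sub>R \<omega>)))\<^sup>2) / 2)"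
        using mult_le_half_squares[of 1 "norm (f (r *\<^sub>R \<omega>))"] by simp
    qed
  qed (rule m)
qed

text \<open>The spherical mean of \<open>V\<^sub>l f - f\<close> is the increment of the profile, up to the factor \<open>r\<^sup>n\<^sup>/\<^sup>2\<close>.
  Splitting the mean of the difference requires \<open>f\<close> and \<open>V\<^sub>l f\<close> to be integrable on the sphere of
  radius \<open>r\<close>, which holds for almost every \<open>r\<close>.\<close>
theorem log_profile_holder:
  fixes f g :: "real ^ 'n \<Rightarrow> complex"
  assumes w: "weak_euler f g" and f: "square_integrable f" and g: "square_integrable g" and l: "1 \<le> l"
  defines "h \<equiv> \<lambda>x. g x + of_real (CARD('n) / 2) * f x"
  shows "AE r in lborel. r > 0 \<longrightarrow>
    (norm (log_profile f (l * r) - log_profile f r))\<^sup>2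
      \<le> sqnorm h / measure (cone_measure :: (real ^ 'n) measure) (sphere 0 1) * ln l"
proof -
  let ?m = "measure (cone_measure :: (real ^ 'n) measure) (sphere 0 1)"
  have m: "?m > 0" by (rule measure_cone_pos)
  have h: "square_integrable h"
    unfolding h_def by (rule square_integrable_linear[OF g f])
  have l0: "l > 0" using l by simp
  note df = square_integrable_dilation(1)[OF f l0]
  note fm = square_integrable_measurable[OF f] square_integrable_measurable[OF df]
  have hm: "h \<in> borel_measurable borel" by (rule square_integrable_measurable[OF h])
  have am: "dilation_average l h \<in> borel_measurable borel" by (rule dilation_average_measurable[OF hm])
  have "AE x in lborel. dilation l f x - f x = dilation_average l h x"
    unfolding h_def by (rule dilation_difference_AE[OF w f g l])
  from AE_polar[OF this] AE_sphere_energy_finite[OF f] AE_sphere_energy_finite[OF df]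
  show ?thesis
  proof eventually_elim
    case (elim r)
    show ?case
    proof
      assume r: "r > 0"
      have i: "integrable cone_measure (\<lambda>\<omega>. f (r *\<^sub>R \<omega>))" "integrable cone_measure (\<lambda>\<omega>. dilation l f (r *\<^sub>R \<omega>))"
        using elim r by (auto intro!: cone_integrable_of_energy fm)
      have "l powr (CARD('n) / 2) *\<^sub>R spherical_mean f (l * r) = spherical_mean (dilation l f) r"
        unfolding spherical_mean_borel[OF fm(1)] spherical_mean_borel[OF fm(2)]
        by (simp add: dilation_def scaleR_left_commute)
      then have "l powr (CARD('n) / 2) *\<^sub>R spherical_mean f (l * r) - spherical_mean f r
          = ((\<integral>\<omega>. dilation l f (r *\<^sub>R \<omega>) \<partial>cone_measure) - (\<integral>\<omega>. f (r *\<^sub>R \<omega>) \<partial>cone_measure)) /\<^sub>R ?m"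
        by (simp only: spherical_mean_borel[OF fm(1)] spherical_mean_borel[OF fm(2)] scaleR_diff_right)
      also have "(\<integral>\<omega>. dilation l f (r *\<^sub>R \<omega>) \<partial>cone_measure) - (\<integral>\<omega>. f (r *\<^sub>R \<omega>) \<partial>cone_measure)
          = (\<integral>\<omega>. dilation l f (r *\<^sub>R \<omega>) - f (r *\<^sub>R \<omega>) \<partial>cone_measure)"
        by (rule Bochner_Integration.integral_diff[symmetric, OF i(2) i(1)])
      also have "\<dots> = (\<integral>\<omega>. dilation_average l h (r *\<^sub>R \<omega>) \<partial>cone_measure)"
        using elim(1) r
        by (intro integral_cong_AE borel_measurable_diff cone_measurable_scale fm am) auto
      also have "\<dots> /\<^sub>R ?m = spherical_mean (dilation_average l h) r"
        by (simp only: spherical_mean_borel[OF am])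
      finally have d: "l powr (CARD('n) / 2) *\<^sub>R spherical_mean f (l * r) - spherical_mean f r
          = spherical_mean (dilation_average l h) r" .
      have "log_profile f (l * r) - log_profile f r
          = r powr (CARD('n) / 2) *\<^sub>R (l powr (CARD('n) / 2) *\<^sub>R spherical_mean f (l * r) - spherical_mean f r)"
        using l0 r by (simp add: log_profile_def powr_mult scaleR_diff_right mult.commute)
      also have "\<dots> = log_profile (dilation_average l h) r"
        unfolding d by (simp add: log_profile_def)
      finally have "(ennreal (norm (log_profile f (l * r) - log_profile f r)))\<^sup>2
          = (ennreal (norm (log_profile (dilation_average l h) r)))\<^sup>2" by simp
      also have "\<dots> \<le> ennreal (1 / ?m) * (ennreal (r ^ CARD('n)) * sphere_energy (dilation_average l h) r)"
        by (rule log_profile_square_le[OF am r])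
      also have "\<dots> \<le> ennreal (1 / ?m) * ennreal (ln l * sqnorm h)"
        by (intro mult_left_mono sphere_energy_dilation_average h l r) simp
      also have "\<dots> = ennreal (sqnorm h / ?m * ln l)"
        using m l by (subst ennreal_mult[symmetric]) (auto simp: sqnorm_nonneg)
      finally show "(norm (log_profile f (l * r) - log_profile f r))\<^sup>2 \<le> sqnorm h / ?m * ln l"
        using m l by (simp add: ennreal_power sqnorm_nonneg)
    qed
  qed
qed

section \<open>The one-dimensional inequality\<close>

text \<open>The optimal choice is \<open>d = sqrt (A / K)\<close>. Replacing \<open>A\<close> and \<open>K\<close> by \<open>A + e\<close> and \<open>K + e\<close> avoids a
  case distinction when one of them vanishes.\<close>
lemma le_sqrt_of_balance:
  fixes x A K :: real
  assumes b: "\<And>d. d > 0 \<Longrightarrow> d * x \<le> 2 * A + 2 * K * d\<^sup>2" and A: "A \<ge> 0" and K: "K \<ge> 0"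
  shows "x \<le> 4 * sqrt (A * K)"
proof -
  have e: "x \<le> 4 * sqrt ((A + e) * (K + e))" if e: "e > 0" for e
  proof -
    define a k where "a = sqrt (A + e)" and "k = sqrt (K + e)"
    have a: "a > 0" "a\<^sup>2 = A + e" and k: "k > 0" "k\<^sup>2 = K + e"
      using A K e by (auto simp: a_def k_def)
    have "(a / k) * x \<le> 2 * A + 2 * K * (a / k)\<^sup>2"
      by (rule b) (use a k in simp)
    also have "\<dots> \<le> 2 * a\<^sup>2 + 2 * k\<^sup>2 * (a / k)\<^sup>2"
      using a k e by (intro add_mono mult_right_mono) auto
    also have "\<dots> = (a / k) * (4 * (a * k))"
      using a(1) k(1) by (simp add: field_simps power2_eq_square)
    finally have "x \<le> 4 * (a * k)"
      by (rule mult_left_le_imp_le) (use a(1) k(1) in simp)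
    then show ?thesis by (simp add: a_def k_def real_sqrt_mult)
  qed
  show ?thesis
  proof (rule tendsto_lowerbound)
    show "((\<lambda>e. 4 * sqrt ((A + e) * (K + e))) \<longlongrightarrow> 4 * sqrt (A * K)) (at_right 0)"
      by (auto intro!: tendsto_eq_intros)
    show "eventually (\<lambda>e. x \<le> 4 * sqrt ((A + e) * (K + e))) (at_right 0)"
      using e eventually_at_right_less[of 0] by (auto elim!: eventually_mono)
  qed simp
qed

text \<open>
  A sup bound without a continuous representative. By Fubini, for almost every \<open>r\<close> the increment
  bound holds for almost every \<open>l \<ge> 1\<close>. Integrating
  \<open>|u(r)|\<^sup>2 \<le> 2 |u(l r)|\<^sup>2 + 2 K ln l\<close> against \<open>dl/l\<close> over \<open>1 \<le> l \<le> exp d\<close> and using the dilation invariance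
  of \<open>dl/l\<close> gives \<open>d |u(r)|\<^sup>2 \<le> 2 A + 2 K d\<^sup>2\<close> for every \<open>d > 0\<close>.
\<close>
lemma AE_bound_of_dilation_holder:
  fixes u :: "real \<Rightarrow> complex"
  assumes um [measurable]: "u \<in> borel_measurable borel" and A: "A \<ge> 0" and K: "K \<ge> 0"
    and energy: "(\<integral>\<^sup>+r. (ennreal (norm (u r)))\<^sup>2 * ennreal (1 / r) * indicator {0<..} r \<partial>lborel) \<le> ennreal A"
    and holder: "\<And>l. 1 \<le> l \<Longrightarrow> AE r in lborel. r > 0 \<longrightarrow> (norm (u (l * r) - u r))\<^sup>2 \<le> K * ln l"
  shows "AE r in lborel. r > 0 \<longrightarrow> (norm (u r))\<^sup>2 \<le> 4 * sqrt (A * K)"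
proof -
  let ?P = "\<lambda>l r. 1 \<le> l \<longrightarrow> r > 0 \<longrightarrow> (norm (u (l * r) - u r))\<^sup>2 \<le> K * ln l"
  have "AE l in lborel. AE r in lborel. ?P l r"
  proof (rule AE_I2)
    fix l :: real
    show "AE r in lborel. ?P l r"
    proof (cases "1 \<le> l")
      case True
      show ?thesis using holder[OF True] by eventually_elim simp
    qed simp
  qed
  moreover have "{p \<in> space (lborel \<Otimes>\<^sub>M lborel). ?P (fst p) (snd p)} \<in> sets (lborel \<Otimes>\<^sub>M lborel)"
    by measurable
  ultimately have "AE r in lborel. AE l in lborel. ?P l r"
    by (simp only: lborel_pair.AE_commute)
  then show ?thesis
  proof eventually_elim
    case (elim r)
    show ?case
    proof
      assume r: "r > 0"
      show "(norm (u r))\<^sup>2 \<le> 4 * sqrt (A * K)"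
      proof (rule le_sqrt_of_balance[OF _ A K])
        fix d :: real assume d: "d > 0"
        let ?L = "exp d"
        let ?G = "\<lambda>\<rho>. (ennreal (norm (u \<rho>)))\<^sup>2 * ennreal (1 / \<rho>) * indicator {0<..} \<rho>"
        let ?w = "\<lambda>l. ennreal (1 / l) * indicator {1..?L} l"
        have L: "1 \<le> ?L" using d by simp
        have w: "(\<integral>\<^sup>+l. ?w l \<partial>lborel) = ennreal d"
          using nn_integral_inverse_Icc[OF L] by simp
        have "ennreal ((norm (u r))\<^sup>2) * ennreal d = (\<integral>\<^sup>+l. ennreal ((norm (u r))\<^sup>2) * ?w l \<partial>lborel)"
          unfolding w[symmetric] by (rule nn_integral_cmult[symmetric]) measurable
        also have "\<dots> \<le> (\<integral>\<^sup>+l. 2 * (ennreal r * ?G (0 + r * l)) + ennreal (2 * K * d) * ?w l \<partial>lborel)"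
        proof (rule nn_integral_mono_AE)
          show "AE l in lborel. ennreal ((norm (u r))\<^sup>2) * ?w l \<le> 2 * (ennreal r * ?G (0 + r * l)) + ennreal (2 * K * d) * ?w l"
            using elim
          proof eventually_elim
            case (elim l)
            show ?case
            proof (cases "l \<in> {1..?L}")
              case True
              then have l: "1 \<le> l" "l \<le> ?L" by auto
              have "ln l \<le> d" using l by (metis exp_gt_zero ln_exp ln_le_cancel_iff less_le_trans zero_less_one)
              then have "K * ln l \<le> K * d" by (rule mult_left_mono[OF _ K])
              with elim l r have "(norm (u (l * r) - u r))\<^sup>2 \<le> K * d" by simp
              moreover have "(norm (u r))\<^sup>2 \<le> 2 * (norm (u (l * r)))\<^sup>2 + 2 * (norm (u (l * r) - u r))\<^sup>2"
              proof -
                have "norm (u r) \<le> norm (u (l * r)) + norm (u (l * r) - u r)"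
                  by (metis norm_triangle_sub norm_minus_commute)
                then have "(norm (u r))\<^sup>2 \<le> (norm (u (l * r)) + norm (u (l * r) - u r))\<^sup>2"
                  by (rule power_mono) simp
                also have "\<dots> \<le> 2 * (norm (u (l * r)))\<^sup>2 + 2 * (norm (u (l * r) - u r))\<^sup>2"
                  using mult_le_half_squares[of "norm (u (l * r))" "norm (u (l * r) - u r)"]
                  by (simp add: power2_sum)
                finally show ?thesis .
              qed
              ultimately have "(norm (u r))\<^sup>2 \<le> 2 * (norm (u (r * l)))\<^sup>2 + 2 * K * d"
                unfolding mult.commute[of r l] by linarith
              then have "(norm (u r))\<^sup>2 * (1 / l) \<le> (2 * (norm (u (r * l)))\<^sup>2 + 2 * K * d) * (1 / l)"
                using l by (intro mult_right_mono) auto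
              also have "\<dots> = 2 * (r * ((norm (u (r * l)))\<^sup>2 * (1 / (r * l)))) + 2 * K * d * (1 / l)"
                using r l by (simp add: field_simps)
              finally have "ennreal ((norm (u r))\<^sup>2 * (1 / l))
                \<le> ennreal (2 * (r * ((norm (u (r * l)))\<^sup>2 * (1 / (r * l)))) + 2 * K * d * (1 / l))"
                by (rule ennreal_leI)
              also have "\<dots> = ennreal (2 * (r * ((norm (u (r * l)))\<^sup>2 * (1 / (r * l))))) + ennreal (2 * K * d * (1 / l))"
                using r l K d by (intro ennreal_plus) auto
              also have "ennreal (2 * (r * ((norm (u (r * l)))\<^sup>2 * (1 / (r * l))))) = 2 * (ennreal r * ((ennreal (norm (u (r * l))))\<^sup>2 * ennreal (1 / (r * l))))"
              proof -
                have "ennreal (2 * (r * ((norm (u (r * l)))\<^sup>2 * (1 / (r * l))))) = ennreal 2 * ennreal (r * ((norm (u (r * l)))\<^sup>2 * (1 / (r * l))))"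
                  by (rule ennreal_mult) (use r l in auto)
                also have "ennreal (r * ((norm (u (r * l)))\<^sup>2 * (1 / (r * l)))) = ennreal r * ennreal ((norm (u (r * l)))\<^sup>2 * (1 / (r * l)))"
                  by (rule ennreal_mult) (use r l in auto)
                also have "ennreal ((norm (u (r * l)))\<^sup>2 * (1 / (r * l))) = ennreal ((norm (u (r * l)))\<^sup>2) * ennreal (1 / (r * l))"
                  by (rule ennreal_mult) (use r l in auto)
                finally show ?thesis by (simp only: ennreal_power norm_ge_zero ennreal_numeral)
              qed
              also have "ennreal (2 * K * d * (1 / l)) = ennreal (2 * K * d) * ennreal (1 / l)"
                using K d l by (intro ennreal_mult) auto
              also have "ennreal ((norm (u r))\<^sup>2 * (1 / l)) = ennreal ((norm (u r))\<^sup>2) * ennreal (1 / l)"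
                using l by (intro ennreal_mult) auto
              finally show ?thesis
                using True r l by (simp add: zero_less_mult_iff)
            qed simp
          qed
        qed
        also have "\<dots> = (\<integral>\<^sup>+l. 2 * (ennreal r * ?G (0 + r * l)) \<partial>lborel) + (\<integral>\<^sup>+l. ennreal (2 * K * d) * ?w l \<partial>lborel)"
          by (rule nn_integral_add) measurable
        also have "(\<integral>\<^sup>+l. ennreal (2 * K * d) * ?w l \<partial>lborel) = ennreal (2 * K * d) * ennreal d"
          unfolding w[symmetric] by (rule nn_integral_cmult) measurable
        also have "(\<integral>\<^sup>+l. 2 * (ennreal r * ?G (0 + r * l)) \<partial>lborel) = 2 * (\<integral>\<^sup>+l. ennreal r * ?G (0 + r * l) \<partial>lborel)"
          by (rule nn_integral_cmult) measurable
        also have "(\<integral>\<^sup>+l. ennreal r * ?G (0 + r * l) \<partial>lborel) = ennreal r * (\<integral>\<^sup>+l. ?G (0 + r * l) \<partial>lborel)"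
          by (rule nn_integral_cmult) measurable
        also have "\<dots> = (\<integral>\<^sup>+\<rho>. ?G \<rho> \<partial>lborel)"
        proof -
          have "?G \<in> borel_measurable borel" by measurable
          from nn_integral_real_affine[OF this, of r 0] r show ?thesis by simp
        qed
        finally have "ennreal ((norm (u r))\<^sup>2) * ennreal d \<le> 2 * (\<integral>\<^sup>+\<rho>. ?G \<rho> \<partial>lborel) + ennreal (2 * K * d) * ennreal d" .
        also have "\<dots> \<le> 2 * ennreal A + ennreal (2 * K * d) * ennreal d"
          by (intro add_mono mult_left_mono energy) auto
        also have "\<dots> = ennreal (2 * A + 2 * K * d * d)"
        proof -
          have "ennreal (2 * A + 2 * K * d * d) = ennreal (2 * A) + ennreal (2 * K * d * d)"
            by (rule ennreal_plus) (use A K d in auto)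
          also have "ennreal (2 * A) = ennreal 2 * ennreal A"
            by (rule ennreal_mult) (use A in auto)
          also have "ennreal (2 * K * d * d) = ennreal (2 * K * d) * ennreal d"
            by (rule ennreal_mult) (use K d in auto)
          finally show ?thesis by (simp only: ennreal_numeral)
        qed
        also have "ennreal ((norm (u r))\<^sup>2) * ennreal d = ennreal (d * (norm (u r))\<^sup>2)"
          unfolding mult.commute[of d] by (rule ennreal_mult[symmetric]) (use d in auto)
        finally have "d * (norm (u r))\<^sup>2 \<le> 2 * A + 2 * K * d * d"
          by (rule ennreal_le_iff[THEN iffD1, rotated]) (use A K d in auto)
        then show "d * (norm (u r))\<^sup>2 \<le> 2 * A + 2 * K * d\<^sup>2"
          by (simp only: power2_eq_square mult.assoc)
      qed
    qed
  qed
qed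

lemma nn_integral_powr_le:
  fixes u :: "real \<Rightarrow> complex"
  assumes [measurable]: "u \<in> borel_measurable borel" and A: "A \<ge> 0" and S: "S \<ge> 0" and p: "p > 2"
    and energy: "(\<integral>\<^sup>+r. (ennreal (norm (u r)))\<^sup>2 * ennreal (1 / r) * indicator {0<..} r \<partial>lborel) \<le> ennreal A"
    and bound: "AE r in lborel. r > 0 \<longrightarrow> (norm (u r))\<^sup>2 \<le> S"
  shows "(\<integral>\<^sup>+r. ennreal (norm (u r) powr p * (1 / r)) * indicator {0<..} r \<partial>lborel) \<le> ennreal (S powr ((p - 2) / 2) * A)"
proof -
  let ?s = "S powr ((p - 2) / 2)"
  have "(\<integral>\<^sup>+r. ennreal (norm (u r) powr p * (1 / r)) * indicator {0<..} r \<partial>lborel)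
    \<le> (\<integral>\<^sup>+r. ennreal ?s * ((ennreal (norm (u r)))\<^sup>2 * ennreal (1 / r) * indicator {0<..} r) \<partial>lborel)"
  proof (rule nn_integral_mono_AE)
    show "AE r in lborel. ennreal (norm (u r) powr p * (1 / r)) * indicator {0<..} r
      \<le> ennreal ?s * ((ennreal (norm (u r)))\<^sup>2 * ennreal (1 / r) * indicator {0<..} r)"
      using bound
    proof eventually_elim
      case (elim r)
      show ?case
      proof (cases "r > 0")
        case True
        have "norm (u r) powr p = ((norm (u r))\<^sup>2) powr ((p - 2) / 2) * (norm (u r))\<^sup>2"
        proof (cases "u r = 0")
          case False
          then have n: "norm (u r) > 0" by simp
          have "norm (u r) powr p = norm (u r) powr (p - 2) * norm (u r) powr 2"
            using powr_add[of "norm (u r)" "p - 2" 2] by simp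
          then show ?thesis
          proof -
            have "((norm (u r))\<^sup>2) powr ((p - 2) / 2) = (norm (u r) powr 2) powr ((p - 2) / 2)"
              using n by simp
            also have "\<dots> = norm (u r) powr (p - 2)"
              unfolding powr_powr by (rule arg_cong[where f = "(powr) _"]) simp
            finally show ?thesis
              using \<open>norm (u r) powr p = norm (u r) powr (p - 2) * norm (u r) powr 2\<close> n by simp
          qed
        qed simp
        also have "\<dots> \<le> ?s * (norm (u r))\<^sup>2"
          using elim True p by (intro mult_right_mono powr_mono2) auto
        finally have "norm (u r) powr p * (1 / r) \<le> ?s * (norm (u r))\<^sup>2 * (1 / r)"
          using True by (intro mult_right_mono) auto
        then have "ennreal (norm (u r) powr p * (1 / r)) \<le> ennreal (?s * (norm (u r))\<^sup>2 * (1 / r))"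
          by (rule ennreal_leI)
        also have "\<dots> = ennreal ?s * ((ennreal (norm (u r)))\<^sup>2 * ennreal (1 / r))"
        proof -
          have "ennreal (?s * (norm (u r))\<^sup>2 * (1 / r)) = ennreal (?s * (norm (u r))\<^sup>2) * ennreal (1 / r)"
            using True by (intro ennreal_mult) auto
          also have "ennreal (?s * (norm (u r))\<^sup>2) = ennreal ?s * ennreal ((norm (u r))\<^sup>2)"
            by (intro ennreal_mult) auto
          finally show ?thesis by (simp only: ennreal_power norm_ge_zero mult.assoc)
        qed
        finally show ?thesis using True by simp
      qed simp
    qed
  qed
  also have "\<dots> = ennreal ?s * (\<integral>\<^sup>+r. (ennreal (norm (u r)))\<^sup>2 * ennreal (1 / r) * indicator {0<..} r \<partial>lborel)"
    by (rule nn_integral_cmult) measurable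
  also have "\<dots> \<le> ennreal ?s * ennreal A"
    by (intro mult_left_mono energy) simp
  also have "\<dots> = ennreal (?s * A)"
    using A by (simp add: ennreal_mult)
  finally show ?thesis .
qed

section \<open>From Lebesgue to Borel representatives\<close>
lemma measurable_completion_cong_AE:
  fixes f g :: "'a \<Rightarrow> 'b::topological_space"
  assumes g: "g \<in> borel_measurable (completion M)" and eq: "AE x in M. f x = g x"
  shows "f \<in> borel_measurable (completion M)"
proof (rule measurableI)
  fix B :: "'b set" assume B: "B \<in> sets borel"
  let ?X = "space (completion M)"
  have 1: "{x \<in> ?X. f x \<noteq> g x} \<in> sets (completion M)"
  proof -
    have "AE x in M. \<not> (f x \<noteq> g x)" using eq by eventually_elim simp
    from sets_completion_AE[OF this] show ?thesis by (simp only: pred_def)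
  qed
  have 2: "{x \<in> ?X. f x \<noteq> g x \<and> f x \<in> B} \<in> sets (completion M)"
  proof -
    have "AE x in M. \<not> (f x \<noteq> g x \<and> f x \<in> B)" using eq by eventually_elim simp
    from sets_completion_AE[OF this] show ?thesis by (simp only: pred_def)
  qed
  have "f -` B \<inter> ?X = (g -` B \<inter> ?X - {x \<in> ?X. f x \<noteq> g x}) \<union> {x \<in> ?X. f x \<noteq> g x \<and> f x \<in> B}"
    by auto
  also have "\<dots> \<in> sets (completion M)"
    by (rule sets.Un[OF sets.Diff[OF measurable_sets[OF g B] 1] 2])
  finally show "f -` B \<inter> ?X \<in> sets (completion M)" .
qed simp

lemma lebesgue_square_integrable_version:
  fixes f :: "real ^ 'n \<Rightarrow> complex"
  assumes "mem_Lp 2 lebesgue f"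
  obtains f' where "square_integrable f'" "AE x in lborel. f x = f' x"
    "(Lp_norm 2 lebesgue f)\<^sup>2 = sqnorm f'" "Lp_norm 2 lebesgue f = sqrt (sqnorm f')"
proof -
  have fm: "f \<in> borel_measurable lebesgue" and fi: "integrable lebesgue (\<lambda>x. norm (f x) powr 2)"
    using assms by (auto simp: mem_Lp_def)
  have "(\<lambda>x. Re (f x)) \<in> borel_measurable lebesgue" and Im: "(\<lambda>x. Im (f x)) \<in> borel_measurable lebesgue"
    using fm unfolding borel_measurable_complex_iff by blast+
  from completion_ex_borel_measurable_real[OF this(1)] completion_ex_borel_measurable_real[OF Im]
  obtain a b where abm: "a \<in> borel_measurable lborel" "b \<in> borel_measurable lborel"
    and ab: "AE x in lborel. Re (f x) = a x" "AE x in lborel. Im (f x) = b x"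
    by blast
  define f' where "f' = (\<lambda>x. Complex (a x) (b x))"
  have f'm: "f' \<in> borel_measurable borel"
    using abm by (simp add: borel_measurable_complex_iff f'_def)
  have eq: "AE x in lborel. f x = f' x"
    using ab by eventually_elim (simp add: f'_def complex_eq_iff)
  have eq2: "AE x in lebesgue. norm (f x) powr 2 = (norm (f' x))\<^sup>2"
    using AE_completion[OF eq] by eventually_elim simp
  have sm: "(\<lambda>x. (norm (f' x))\<^sup>2) \<in> borel_measurable lborel" using f'm by simp
  have sm': "(\<lambda>x. (norm (f' x))\<^sup>2) \<in> borel_measurable lebesgue" by (rule measurable_completion[OF sm])
  have pm: "(\<lambda>x. norm (f x) powr 2) \<in> borel_measurable lebesgue" by (rule borel_measurable_integrable[OF fi])
  have "integrable lebesgue (\<lambda>x. (norm (f' x))\<^sup>2)"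
    using integrable_cong_AE[OF pm sm' eq2] fi by simp
  then have sq: "square_integrable f'"
    unfolding square_integrable_def integrable_completion[OF sm] using f'm by blast
  have "(\<integral>x. norm (f x) powr 2 \<partial>lebesgue) = (\<integral>x. (norm (f' x))\<^sup>2 \<partial>lebesgue)"
    by (rule integral_cong_AE[OF pm sm' eq2])
  also have "\<dots> = sqnorm f'"
    unfolding sqnorm_def by (rule integral_completion[OF sm])
  finally have "Lp_norm 2 lebesgue f = sqrt (sqnorm f')"
    by (simp add: Lp_norm_def powr_half_sqrt sqnorm_nonneg)
  then show ?thesis using that[OF sq eq] by (simp add: sqnorm_nonneg)
qed

lemma integral_lebesgue_version:
  assumes f: "f \<in> borel_measurable lebesgue" and f': "f' \<in> borel_measurable borel"
    and eq: "AE x in lborel. f x = f' x" and \<phi>: "\<phi> \<in> borel_measurable borel"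
  shows "(\<integral>x. f x * \<phi> x \<partial>lebesgue) = (\<integral>x. f' x * (\<phi> x :: complex) \<partial>lborel)"
proof -
  have \<phi>': "\<phi> \<in> borel_measurable lebesgue" using \<phi> by (intro measurable_completion) simp
  have m: "(\<lambda>x. f' x * \<phi> x) \<in> borel_measurable lborel"
    using f' \<phi> by simp
  have "(\<integral>x. f x * \<phi> x \<partial>lebesgue) = (\<integral>x. f' x * \<phi> x \<partial>lebesgue)"
  proof (rule integral_cong_AE)
    show "(\<lambda>x. f x * \<phi> x) \<in> borel_measurable lebesgue"
      by (rule borel_measurable_times[OF f \<phi>'])
    show "(\<lambda>x. f' x * \<phi> x) \<in> borel_measurable lebesgue"
      by (rule measurable_completion[OF m])
    show "AE x in lebesgue. f x * \<phi> x = f' x * \<phi> x"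
      using AE_completion[OF eq] by eventually_elim simp
  qed
  also have "\<dots> = (\<integral>x. f' x * \<phi> x \<partial>lborel)"
    by (rule integral_completion[OF m])
  finally show ?thesis .
qed

lemma is_euler_derivative_weak_euler:
  fixes f g :: "real ^ 'n \<Rightarrow> complex"
  assumes e: "is_euler_derivative f g"
    and f: "f \<in> borel_measurable lebesgue" and f': "f' \<in> borel_measurable borel" "AE x in lborel. f x = f' x"
    and g: "g \<in> borel_measurable lebesgue" and g': "g' \<in> borel_measurable borel" "AE x in lborel. g x = g' x"
  shows "weak_euler f' g'"
  unfolding weak_euler_def
proof (intro allI impI)
  fix \<phi> :: "real ^ 'n \<Rightarrow> complex"
  assume \<phi>: "bump_test \<phi>"
  have b: "partial_deriv j (\<lambda>x. complex_of_real (x $ j) * \<phi> x) \<in> borel_measurable borel" for j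
    by (intro bump_test_measurable bump_test_partial_deriv bump_test_mult \<phi> bump_algebra.coord)
  have "distr_euler (regular_distribution f) \<phi> = regular_distribution g \<phi>"
    using e bump_test_test_function[OF \<phi>] unfolding is_euler_derivative_def by blast
  then show "(\<Sum>j\<in>UNIV. - (\<integral>x. f' x * partial_deriv j (\<lambda>x. complex_of_real (x $ j) * \<phi> x) x \<partial>lborel))
       = (\<integral>x. g' x * \<phi> x \<partial>lborel)"
    unfolding distr_euler_def distr_mult_def distr_partial_def regular_distribution_def
      integral_lebesgue_version[OF f f' b] integral_lebesgue_version[OF g g' bump_test_measurable[OF \<phi>]] .
qed

text \<open>For almost every \<open>r\<close>, the two functions agree almost everywhere on the sphere of radius \<open>r\<close>, and the
  completion in the surface measure makes \<open>f\<close> measurable there.\<close>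
lemma spherical_mean_cong_AE:
  fixes f f' :: "real ^ 'n \<Rightarrow> complex"
  assumes f': "f' \<in> borel_measurable borel" and eq: "AE x in lborel. f x = f' x"
  shows "AE r in lborel. r > 0 \<longrightarrow> spherical_mean f r = spherical_mean f' r"
  using AE_polar[OF eq]
proof eventually_elim
  case (elim r)
  show ?case
  proof
    assume "r > 0"
    with elim have e: "AE \<omega> in cone_measure. f (r *\<^sub>R \<omega>) = f' (r *\<^sub>R \<omega>)" by blast
    have m: "(\<lambda>\<omega>. f' (r *\<^sub>R \<omega>)) \<in> borel_measurable (completion cone_measure)"
      by (intro measurable_completion cone_measurable_scale f')
    have "(\<integral>\<omega>. f (r *\<^sub>R \<omega>) \<partial>completion cone_measure) = (\<integral>\<omega>. f' (r *\<^sub>R \<omega>) \<partial>completion cone_measure)"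
      by (rule integral_cong_AE[OF measurable_completion_cong_AE[OF m e] m AE_completion[OF e]])
    then show "spherical_mean f r = spherical_mean f' r"
      by (simp only: spherical_mean_def sphere_measure_eq)
  qed
qed

text \<open>Reduces membership and norm in the radial space to an extended nonnegative integral of a Borel
  function agreeing almost everywhere.\<close>
lemma radial_Lp_bound:
  fixes F F' :: "real \<Rightarrow> complex"
  assumes F': "F' \<in> borel_measurable borel" and eq: "AE r in lborel. r > 0 \<longrightarrow> F r = F' r"
    and B: "B \<ge> 0" and p: "p > 0"
    and le: "(\<integral>\<^sup>+r. ennreal (norm (F' r) powr p * r ^ (n - 1)) * indicator {0<..} r \<partial>lborel) \<le> ennreal B"
  shows "mem_Lp p (radial_measure n) F" "Lp_norm p (radial_measure n) F \<le> B powr (1 / p)"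
proof -
  let ?L = "lebesgue_on {0<..} :: real measure"
  let ?H = "\<lambda>r. if r > 0 then F r else F' r"
  have "?H \<in> borel_measurable lebesgue"
  proof (rule measurable_completion_cong_AE)
    show "F' \<in> borel_measurable lebesgue" using F' by (intro measurable_completion) simp
    show "AE r in lborel. ?H r = F' r" using eq by eventually_elim simp
  qed
  then have "?H \<in> borel_measurable ?L" by (rule measurable_restrict_space1)
  then have FL: "F \<in> borel_measurable ?L"
    by (rule measurable_cong[THEN iffD1, rotated]) (simp add: space_restrict_space)
  then have Fm: "F \<in> borel_measurable (radial_measure n)"
    by (simp add: radial_measure_def)
  have dm: "(\<lambda>r::real. ennreal (r ^ (n - 1))) \<in> borel_measurable ?L"
    by (intro measurable_restrict_space1 measurable_completion) simp
  have gm: "(\<lambda>r. ennreal (norm (F r) powr p)) \<in> borel_measurable ?L"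
    using FL by simp
  have "(\<integral>\<^sup>+r. ennreal (norm (F r) powr p) \<partial>radial_measure n)
      = (\<integral>\<^sup>+r. ennreal (r ^ (n - 1)) * ennreal (norm (F r) powr p) \<partial>?L)"
    unfolding radial_measure_def by (rule nn_integral_density[OF dm gm])
  also have "\<dots> = (\<integral>\<^sup>+r. ennreal (r ^ (n - 1)) * ennreal (norm (F r) powr p) * indicator {0<..} r \<partial>lebesgue)"
    by (rule nn_integral_restrict_space) simp
  also have "\<dots> = (\<integral>\<^sup>+r. ennreal (r ^ (n - 1)) * ennreal (norm (F r) powr p) * indicator {0<..} r \<partial>lborel)"
    by (rule nn_integral_completion)
  also have "\<dots> = (\<integral>\<^sup>+r. ennreal (norm (F' r) powr p * r ^ (n - 1)) * indicator {0<..} r \<partial>lborel)"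
  proof (rule nn_integral_cong_AE)
    show "AE r in lborel. ennreal (r ^ (n - 1)) * ennreal (norm (F r) powr p) * indicator {0<..} r
      = ennreal (norm (F' r) powr p * r ^ (n - 1)) * indicator {0<..} r"
      using eq by eventually_elim (auto simp: indicator_def ennreal_mult mult.commute)
  qed
  finally have nn: "(\<integral>\<^sup>+r. ennreal (norm (F r) powr p) \<partial>radial_measure n) \<le> ennreal B"
    using le by simp
  have pm: "(\<lambda>r. norm (F r) powr p) \<in> borel_measurable (radial_measure n)"
    using Fm by simp
  show "mem_Lp p (radial_measure n) F"
    unfolding mem_Lp_def
  proof (intro conjI Fm integrableI_bounded pm)
    show "(\<integral>\<^sup>+r. ennreal (norm (norm (F r) powr p)) \<partial>radial_measure n) < \<infinity>"
      using le_less_trans[OF nn ennreal_less_top] by simp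
  qed
  have "(\<integral>r. norm (F r) powr p \<partial>radial_measure n) = enn2real (\<integral>\<^sup>+r. ennreal (norm (F r) powr p) \<partial>radial_measure n)"
    by (rule integral_eq_nn_integral[OF pm]) simp
  also have "\<dots> \<le> enn2real (ennreal B)"
    by (rule enn2real_mono[OF nn]) simp
  finally have "(\<integral>r. norm (F r) powr p \<partial>radial_measure n) \<le> B"
    using B by simp
  then show "Lp_norm p (radial_measure n) F \<le> B powr (1 / p)"
    unfolding Lp_norm_def using p by (intro powr_mono2) auto
qed

section \<open>The inequality for spherical means\<close>
theorem corollary4:
  fixes n :: nat and p :: real
  assumes "n = CARD('n::finite)" and "n > 2"
    and "p = 2 * real n / (real n - 2)"
  shows "\<exists>C>0. \<forall>(f :: real ^ 'n \<Rightarrow> complex) Lf.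
    mem_Lp 2 lebesgue f \<longrightarrow> mem_Lp 2 lebesgue Lf \<longrightarrow> is_euler_derivative f Lf \<longrightarrow>
      mem_Lp p (radial_measure n) (\<lambda>r. of_real r * spherical_mean f r) \<and>
      (Lp_norm p (radial_measure n) (\<lambda>r. of_real r * spherical_mean f r))\<^sup>2
        \<le> C * ((Lp_norm 2 lebesgue Lf)\<^sup>2 - (real n)\<^sup>2 / 4 * (Lp_norm 2 lebesgue f)\<^sup>2) powr (1 / real n)
            * Lp_norm 2 lebesgue f powr (2 * (1 - 1 / real n))"
proof -
  define m where "m = measure (cone_measure :: (real ^ 'n) measure) (sphere 0 1)"
  have m: "m > 0" unfolding m_def by (rule measure_cone_pos)
  define N where "N = real n"
  have N: "N > 2" using assms(2) by (simp add: N_def)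
  have pN: "p = 2 * N / (N - 2)" using assms(3) by (simp add: N_def)
  have p: "p > 2" unfolding pN using N by (simp add: field_simps)
  have p1: "(p - 2) / 2 * (2 / p) = 2 / N" "2 / p = 1 - 2 / N" "p * (N / 2) = p + N"
  proof -
    have d: "N - 2 \<noteq> 0" "N \<noteq> 0" using N by auto
    show "2 / p = 1 - 2 / N" "p * (N / 2) = p + N"
      unfolding pN using d by (simp_all add: field_simps)
    then have "(p - 2) / 2 * (2 / p) = 1 - 2 / p"
      using p by (simp add: field_simps)
    then show "(p - 2) / 2 * (2 / p) = 2 / N"
      using \<open>2 / p = 1 - 2 / N\<close> by simp
  qed
  define C where "C = 16 powr (1 / N) / m"
  have "mem_Lp p (radial_measure n) (\<lambda>r. of_real r * spherical_mean f r) \<and>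
      (Lp_norm p (radial_measure n) (\<lambda>r. of_real r * spherical_mean f r))\<^sup>2
        \<le> C * ((Lp_norm 2 lebesgue Lf)\<^sup>2 - (real n)\<^sup>2 / 4 * (Lp_norm 2 lebesgue f)\<^sup>2) powr (1 / real n)
            * Lp_norm 2 lebesgue f powr (2 * (1 - 1 / real n))"
    if f: "mem_Lp 2 lebesgue f" and g: "mem_Lp 2 lebesgue Lf" and e: "is_euler_derivative f Lf"
    for f Lf :: "real ^ 'n \<Rightarrow> complex"
  proof -
    obtain f' where f': "square_integrable f'" "AE x in lborel. f x = f' x"
      "(Lp_norm 2 lebesgue f)\<^sup>2 = sqnorm f'" "Lp_norm 2 lebesgue f = sqrt (sqnorm f')"
      by (rule lebesgue_square_integrable_version[OF f])
    obtain g' where g': "square_integrable g'" "AE x in lborel. Lf x = g' x"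
      "(Lp_norm 2 lebesgue Lf)\<^sup>2 = sqnorm g'" "Lp_norm 2 lebesgue Lf = sqrt (sqnorm g')"
      by (rule lebesgue_square_integrable_version[OF g])
    note fm = square_integrable_measurable[OF f'(1)] and gm = square_integrable_measurable[OF g'(1)]
    have w: "weak_euler f' g'"
      by (rule is_euler_derivative_weak_euler[OF e _ fm f'(2) _ gm g'(2)]) (use f g in \<open>simp_all add: mem_Lp_def\<close>)
    define h where "h = (\<lambda>x. g' x + of_real (CARD('n) / 2) * f' x)"
    have hn: "sqnorm g' - N\<^sup>2 / 4 * sqnorm f' = sqnorm h"
      unfolding h_def N_def assms(1) by (rule sqnorm_euler[OF w f'(1) g'(1)])
    define A K where "A = sqnorm f' / m" and "K = sqnorm h / m"
    have A: "A \<ge> 0" and K: "K \<ge> 0" using m by (auto simp: A_def K_def sqnorm_nonneg)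
    let ?u = "log_profile f'"
    have um [measurable]: "?u \<in> borel_measurable borel" by (rule log_profile_measurable[OF fm])
    have en: "(\<integral>\<^sup>+r. (ennreal (norm (?u r)))\<^sup>2 * ennreal (1 / r) * indicator {0<..} r \<partial>lborel) \<le> ennreal A"
      unfolding A_def m_def by (rule log_profile_energy[OF f'(1)])
    have ho: "AE r in lborel. r > 0 \<longrightarrow> (norm (?u (l * r) - ?u r))\<^sup>2 \<le> K * ln l" if "1 \<le> l" for l
      unfolding K_def m_def h_def by (rule log_profile_holder[OF w f'(1) g'(1) that])
    \<comment> \<open>\<open>S\<close> bounds \<open>|u|\<^sup>2\<close>, and \<open>B\<close> bounds the integral of \<open>|u|\<^sup>p\<close> against \<open>dr/r\<close>.\<close>
    define S where "S = 4 * sqrt (A * K)"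
    have S: "S \<ge> 0" using A K by (simp add: S_def)
    have bd: "AE r in lborel. r > 0 \<longrightarrow> (norm (?u r))\<^sup>2 \<le> S"
      unfolding S_def by (rule AE_bound_of_dilation_holder[OF um A K en ho])
    define B where "B = S powr ((p - 2) / 2) * A"
    have B: "B \<ge> 0" using A by (simp add: B_def)
    let ?F = "\<lambda>r. of_real r * spherical_mean f r" and ?F' = "\<lambda>r. of_real r * spherical_mean f' r"
    have Fm: "?F' \<in> borel_measurable borel"
      using spherical_mean_measurable[OF fm] by simp
    have Feq: "AE r in lborel. r > 0 \<longrightarrow> ?F r = ?F' r"
      using spherical_mean_cong_AE[OF fm f'(2)] by eventually_elim simp
    \<comment> \<open>The exponents match since \<open>p n / 2 = p + n\<close> for \<open>p = 2\<^sup>*\<close>.\<close>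
    have "(\<integral>\<^sup>+r. ennreal (norm (?F' r) powr p * r ^ (n - 1)) * indicator {0<..} r \<partial>lborel)
      = (\<integral>\<^sup>+r. ennreal (norm (?u r) powr p * (1 / r)) * indicator {0<..} r \<partial>lborel)"
    proof (rule nn_integral_cong)
      fix r :: real
      show "ennreal (norm (?F' r) powr p * r ^ (n - 1)) * indicator {0<..} r
        = ennreal (norm (?u r) powr p * (1 / r)) * indicator {0<..} r"
      proof (cases "r > 0")
        case True
        let ?a = "norm (spherical_mean f' r)"
        have "norm (?u r) powr p * (1 / r) = r powr (N / 2 * p) * r powr (-1) * ?a powr p"
        proof -
          have "norm (?u r) = r powr (N / 2) * ?a"
            unfolding log_profile_def N_def assms(1) by simp
          then have "norm (?u r) powr p = r powr (N / 2 * p) * ?a powr p"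
            by (simp add: powr_mult powr_powr)
          moreover have "r powr (-1) = 1 / r" using True by (simp add: powr_minus divide_inverse)
          ultimately show ?thesis by simp
        qed
        also have "r powr (N / 2 * p) * r powr (-1) = r powr (p + (N - 1))"
        proof -
          have "N / 2 * p + (-1) = p + (N - 1)" using p1(3) unfolding mult.commute[of p] by linarith
          then show ?thesis by (simp only: powr_add[symmetric])
        qed
        also have "\<dots> = r powr p * r ^ (n - 1)"
        proof -
          have "r powr (N - 1) = r ^ (n - 1)"
            using True assms(2) powr_realpow[of r "n - 1"] by (simp add: N_def of_nat_diff)
          then show ?thesis by (simp only: powr_add)
        qed
        finally have "norm (?u r) powr p * (1 / r) = norm (?F' r) powr p * r ^ (n - 1)"
          using True by (simp add: norm_mult powr_mult)
        then show ?thesis by simp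
      qed simp
    qed
    also have "\<dots> \<le> ennreal B"
      unfolding B_def by (rule nn_integral_powr_le[OF um A S p en bd])
    finally have le: "(\<integral>\<^sup>+r. ennreal (norm (?F' r) powr p * r ^ (n - 1)) * indicator {0<..} r \<partial>lborel) \<le> ennreal B" .
    have p0: "p > 0" using p by simp
    note R = radial_Lp_bound[OF Fm Feq B p0 le]
    have "(Lp_norm p (radial_measure n) ?F)\<^sup>2 \<le> (B powr (1 / p))\<^sup>2"
      by (rule power_mono[OF R(2)]) (simp add: Lp_norm_def)
    also have "(B powr (1 / p))\<^sup>2 = B powr (2 / p)"
      by (simp add: power2_eq_square powr_add[symmetric])
    also have "\<dots> = S powr (2 / N) * A powr (1 - 2 / N)"
      unfolding B_def using A S p1(1,2) by (simp add: powr_mult powr_powr)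
    also have "S powr (2 / N) = (S\<^sup>2) powr (1 / N)"
    proof (cases "S = 0")
      case False
      with S have "S > 0" by simp
      then have "S\<^sup>2 = S powr 2" by simp
      then have "(S\<^sup>2) powr (1 / N) = S powr (2 * (1 / N))" by (simp only: powr_powr)
      then show ?thesis by simp
    qed simp
    also have "S\<^sup>2 = 16 * (A * K)"
      using A K by (simp add: S_def power_mult_distrib)
    also have "(16 * (A * K)) powr (1 / N) * A powr (1 - 2 / N) = 16 powr (1 / N) * K powr (1 / N) * (A powr (1 / N) * A powr (1 - 2 / N))"
      using A K by (simp add: powr_mult)
    also have "A powr (1 / N) * A powr (1 - 2 / N) = A powr (1 - 1 / N)"
      unfolding powr_add[symmetric] using N by (simp add: field_simps)
    also have "16 powr (1 / N) * K powr (1 / N) * A powr (1 - 1 / N)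
       = C * sqnorm h powr (1 / N) * sqnorm f' powr (1 - 1 / N)"
    proof -
      have "m powr (1 / N) * m powr (1 - 1 / N) = m"
        unfolding powr_add[symmetric] using m by simp
      then show ?thesis
        using m by (simp add: A_def K_def C_def powr_divide sqnorm_nonneg field_simps)
    qed
    also have "sqnorm f' powr (1 - 1 / N) = Lp_norm 2 lebesgue f powr (2 * (1 - 1 / N))"
    proof -
      have "Lp_norm 2 lebesgue f = sqnorm f' powr (1 / 2)"
        unfolding f'(4) by (simp only: powr_half_sqrt sqnorm_nonneg)
      then have "Lp_norm 2 lebesgue f powr (2 * (1 - 1 / N)) = sqnorm f' powr (1 / 2 * (2 * (1 - 1 / N)))"
        by (simp only: powr_powr)
      also have "1 / 2 * (2 * (1 - 1 / N)) = 1 - 1 / N" by simp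
      finally show ?thesis ..
    qed
    finally have "(Lp_norm p (radial_measure n) ?F)\<^sup>2 \<le> C * sqnorm h powr (1 / N) * Lp_norm 2 lebesgue f powr (2 * (1 - 1 / N))" .
    then show ?thesis
      using R(1) unfolding f'(3) g'(3) N_def[symmetric] hn by blast
  qed
  moreover have "C > 0" using m by (simp add: C_def)
  ultimately show ?thesis by blast
qed

end
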